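(* (Subject reduction.) (1) If $\Gamma\vdash M:A$ and $M\to M'$, then $\Gamma\vdash M':A$. (2) If $\Gamma;B\vdash l:C$ and $l\to l'$, then $\Gamma;B\vdash l':C$.
   Context: Ground PTSC syntax: given sorts $\mathcal S$ and variables, terms $M ::= \Pi x^{A}.B \mid \lambda x^{A}.M \mid s \mid x\,l \mid M\,l \mid \langle N/x\rangle_A M$ and lists $l ::= [\,] \mid M\cdot l \mid l @ l' \mid \langle N/x\rangle_A l$ ($\langle N/x\rangle_A$ explicit substitution binding $x$; $\Pi,\lambda$ bind $x$; up to $\alpha$-conversion). One-step reduction $\to$ is the contextual closure (inside terms and lists) of: $(\lambda x^A.M)(N\cdot l)\to(\langle N/x\rangle_A M)\,l$; $M\,[\,]\to M$; $(x\,l)\,l'\to x\,(l@l')$; $(M\,l)\,l'\to M\,(l@l')$; $(M\cdot l')@l\to M\cdot(l'@l)$; $[\,]@l\to l$; $(l@l')@l''\to l@(l'@l'')$; $l@[\,]\to l$; $\langle P/y\rangle_G(\lambda x^A.M)\to\lambda x^{\langle P/y\rangle_G A}.\langle P/y\rangle_G M$; $\langle P/y\rangle_G(y\,l)\to P\,(\langle P/y\rangle_G l)$; $\langle P/y\rangle_G(x\,l)\to x\,(\langle P/y\rangle_G l)$ ($x\ne y$); $\langle P/y\rangle_G(M\,l)\to(\langle P/y\rangle_G M)(\langle P/y\rangle_G l)$; $\langle P/y\rangle_G(\Pi x^A.B)\to\Pi x^{\langle P/y\rangle_G A}.\langle P/y\rangle_G B$; $\langle P/y\rangle_G s\to s$;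 $\langle P/y\rangle_G[\,]\to[\,]$; $\langle P/y\rangle_G(M\cdot l)\to(\langle P/y\rangle_G M)\cdot(\langle P/y\rangle_G l)$; $\langle P/y\rangle_G(l@l')\to(\langle P/y\rangle_G l)@(\langle P/y\rangle_G l')$ (capture avoidance understood). $\leftrightarrow^*$ is the induced equivalence. A PTSC is given by $\mathcal A\subseteq\mathcal S^2$, $\mathcal R\subseteq\mathcal S^3$. An environment is a list of declarations $(x:A)$; $\mathrm{dom}$ is the list of declared variables; $\langle P/x\rangle_A\Delta$ applies $\langle P/x\rangle_A$ to every type in $\Delta$; $\Gamma\sqsubseteq\Delta$ means for each $(x:A)\in\Gamma$ there is $(x:B)\in\Delta$ with $A\leftrightarrow^*B$. Judgements $\Gamma\ \mathsf{wf}$, $\Gamma\vdash M:A$, $\Gamma;B\vdash l:C$ are derived by: (empty) $\emptyset\ \mathsf{wf}$; (extend) $\Gamma\vdash A:s$, $x\notin\mathrm{dom}\,\Gamma$ $\Rightarrow$ $\Gamma,(x:A)\ \mathsf{wf}$; (sorted) $\Gamma\ \mathsf{wf}$, $(s,s')\in\mathcal A$ $\Rightarrow$ $\Gamma\vdash s:s'$; ($\Pi$wf) $\Gamma\vdash A:s_1$, $\Gamma,(x:A)\vdash B:s_2$, $(s_1,s_2,s_3)\in\mathcal R$ $\Rightarrow$ $\Gamma\vdash\Pi x^A.B:s_3$; ($\Pi$R) $\Gamma\vdash\Pi x^A.B:s$, $\Gamma,(x:A)\vdash M:B$ $\Rightarrow$ $\Gamma\vdash\lambda x^A.M:\Pi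 x^A.B$; (select) $\Gamma;A\vdash l:B$, $(x:A)\in\Gamma$ $\Rightarrow$ $\Gamma\vdash x\,l:B$; (axiom) $\Gamma\vdash A:s$ $\Rightarrow$ $\Gamma;A\vdash[\,]:A$; (conv$_R$) $\Gamma\vdash M:A$, $\Gamma\vdash B:s$, $A\leftrightarrow^*B$ $\Rightarrow$ $\Gamma\vdash M:B$; ($\Pi$L) $\Gamma\vdash\Pi x^A.B:s$, $\Gamma\vdash M:A$, $\Gamma;\langle M/x\rangle_A B\vdash l:C$ $\Rightarrow$ $\Gamma;\Pi x^A.B\vdash M\cdot l:C$; (conv$'_R$) $\Gamma;C\vdash l:A$, $\Gamma\vdash B:s$, $A\leftrightarrow^*B$ $\Rightarrow$ $\Gamma;C\vdash l:B$; (conv$_L$) $\Gamma;A\vdash l:C$, $\Gamma\vdash B:s$, $A\leftrightarrow^*B$ $\Rightarrow$ $\Gamma;B\vdash l:C$; (Cut$_1$) $\Gamma;C\vdash l':A$, $\Gamma;A\vdash l:B$ $\Rightarrow$ $\Gamma;C\vdash l'@l:B$; (Cut$_2$) $\Gamma\vdash P:A$, $\Gamma,(x:A),\Delta;B\vdash l:C$, $\Gamma,\langle P/x\rangle_A\Delta\sqsubseteq\Delta'$, $\Delta'\ \mathsf{wf}$ $\Rightarrow$ $\Delta';\langle P/x\rangle_A B\vdash\langle P/x\rangle_A l:\langle P/x\rangle_A C$; (Cut$_3$) $\Gamma\vdash M:A$, $\Gamma;A\vdash l:B$ $\Rightarrow$ $\Gamma\vdash M\,l:B$; (Cut$_4$)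 $\Gamma\vdash P:A$, $\Gamma,(x:A),\Delta\vdash M:C$, $\Gamma,\langle P/x\rangle_A\Delta\sqsubseteq\Delta'$, $\Delta'\ \mathsf{wf}$ $\Rightarrow$ $\Delta'\vdash\langle P/x\rangle_A M:C'$, where $C'=C$ if $C\in\mathcal S$ and $C'=\langle P/x\rangle_A C$ otherwise. In all rules $s,s',s_i\in\mathcal S$. *)

theory Defs
  imports Main
begin

section \<open>Raw locally nameless expressions\<close>

text \<open>
  The sorts are the elements of the type parameter; the variables are the natural numbers.
  Terms and lists up to \<open>\<alpha>\<close>-conversion are represented in locally nameless style: free variables
  are names, bound variables are de Bruijn indices. Only the well-scoped expressions are kept
  (types \<open>trm\<close> and \<open>lst\<close> below), and these are accessed solely through constructors that bind
  a name, so indices do not occur in the definition of the calculus.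
\<close>

type_synonym var = nat

datatype head = Free var | Bound nat

datatype 's rtrm =
    RPi "'s rtrm" "'s rtrm"
  | RLam "'s rtrm" "'s rtrm"
  | RSort 's
  | RVar head "'s rlst"
  | RCut "'s rtrm" "'s rlst"
  | RSub "'s rtrm" "'s rtrm" "'s rtrm"
and 's rlst =
    RNil
  | RCons "'s rtrm" "'s rlst"
  | RApp "'s rlst" "'s rlst"
  | RSubL "'s rtrm" "'s rtrm" "'s rlst"

text \<open>
  The index 0 is bound in the last argument of \<open>RPi\<close>, \<open>RLam\<close>, \<open>RSub\<close> and \<open>RSubL\<close>.
  \<open>RSub N A M\<close> is the explicit substitution of \<open>N\<close>, annotated with the type \<open>A\<close>, in \<open>M\<close>.
\<close>

primrec lc_head :: "nat \<Rightarrow> head \<Rightarrow> bool" where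
  "lc_head k (Free x) = True"
| "lc_head k (Bound i) = (i < k)"

primrec lc_trm :: "nat \<Rightarrow> 's rtrm \<Rightarrow> bool" and lc_lst :: "nat \<Rightarrow> 's rlst \<Rightarrow> bool" where
  "lc_trm k (RPi A B) = (lc_trm k A \<and> lc_trm (Suc k) B)"
| "lc_trm k (RLam A M) = (lc_trm k A \<and> lc_trm (Suc k) M)"
| "lc_trm k (RSort s) = True"
| "lc_trm k (RVar h l) = (lc_head k h \<and> lc_lst k l)"
| "lc_trm k (RCut M l) = (lc_trm k M \<and> lc_lst k l)"
| "lc_trm k (RSub N A M) = (lc_trm k N \<and> lc_trm k A \<and> lc_trm (Suc k) M)"
| "lc_lst k RNil = True"
| "lc_lst k (RCons M l) = (lc_trm k M \<and> lc_lst k l)"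
| "lc_lst k (RApp l l') = (lc_lst k l \<and> lc_lst k l')"
| "lc_lst k (RSubL N A l) = (lc_trm k N \<and> lc_trm k A \<and> lc_lst (Suc k) l)"

primrec close_head :: "nat \<Rightarrow> var \<Rightarrow> head \<Rightarrow> head" where
  "close_head k x (Free y) = (if x = y then Bound k else Free y)"
| "close_head k x (Bound i) = Bound i"

primrec close_trm :: "nat \<Rightarrow> var \<Rightarrow> 's rtrm \<Rightarrow> 's rtrm"
  and close_lst :: "nat \<Rightarrow> var \<Rightarrow> 's rlst \<Rightarrow> 's rlst" where
  "close_trm k x (RPi A B) = RPi (close_trm k x A) (close_trm (Suc k) x B)"
| "close_trm k x (RLam A M) = RLam (close_trm k x A) (close_trm (Suc k) x M)"
| "close_trm k x (RSort s) = RSort s"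
| "close_trm k x (RVar h l) = RVar (close_head k x h) (close_lst k x l)"
| "close_trm k x (RCut M l) = RCut (close_trm k x M) (close_lst k x l)"
| "close_trm k x (RSub N A M) =
     RSub (close_trm k x N) (close_trm k x A) (close_trm (Suc k) x M)"
| "close_lst k x RNil = RNil"
| "close_lst k x (RCons M l) = RCons (close_trm k x M) (close_lst k x l)"
| "close_lst k x (RApp l l') = RApp (close_lst k x l) (close_lst k x l')"
| "close_lst k x (RSubL N A l) =
     RSubL (close_trm k x N) (close_trm k x A) (close_lst (Suc k) x l)"

primrec fv_head :: "head \<Rightarrow> var set" where
  "fv_head (Free x) = {x}"
| "fv_head (Bound i) = {}"

primrec rfv_trm :: "'s rtrm \<Rightarrow> var set" and rfv_lst :: "'s rlst \<Rightarrow> var set" where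
  "rfv_trm (RPi A B) = rfv_trm A \<union> rfv_trm B"
| "rfv_trm (RLam A M) = rfv_trm A \<union> rfv_trm M"
| "rfv_trm (RSort s) = {}"
| "rfv_trm (RVar h l) = fv_head h \<union> rfv_lst l"
| "rfv_trm (RCut M l) = rfv_trm M \<union> rfv_lst l"
| "rfv_trm (RSub N A M) = rfv_trm N \<union> rfv_trm A \<union> rfv_trm M"
| "rfv_lst RNil = {}"
| "rfv_lst (RCons M l) = rfv_trm M \<union> rfv_lst l"
| "rfv_lst (RApp l l') = rfv_lst l \<union> rfv_lst l'"
| "rfv_lst (RSubL N A l) = rfv_trm N \<union> rfv_trm A \<union> rfv_lst l"

primrec swap_head :: "var \<Rightarrow> var \<Rightarrow> head \<Rightarrow> head" where
  "swap_head x y (Free z) = Free (if z = x then y else if z = y then x else z)"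
| "swap_head x y (Bound i) = Bound i"

primrec rswap_trm :: "var \<Rightarrow> var \<Rightarrow> 's rtrm \<Rightarrow> 's rtrm"
  and rswap_lst :: "var \<Rightarrow> var \<Rightarrow> 's rlst \<Rightarrow> 's rlst" where
  "rswap_trm x y (RPi A B) = RPi (rswap_trm x y A) (rswap_trm x y B)"
| "rswap_trm x y (RLam A M) = RLam (rswap_trm x y A) (rswap_trm x y M)"
| "rswap_trm x y (RSort s) = RSort s"
| "rswap_trm x y (RVar h l) = RVar (swap_head x y h) (rswap_lst x y l)"
| "rswap_trm x y (RCut M l) = RCut (rswap_trm x y M) (rswap_lst x y l)"
| "rswap_trm x y (RSub N A M) = RSub (rswap_trm x y N) (rswap_trm x y A) (rswap_trm x y M)"
| "rswap_lst x y RNil = RNil"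
| "rswap_lst x y (RCons M l) = RCons (rswap_trm x y M) (rswap_lst x y l)"
| "rswap_lst x y (RApp l l') = RApp (rswap_lst x y l) (rswap_lst x y l')"
| "rswap_lst x y (RSubL N A l) = RSubL (rswap_trm x y N) (rswap_trm x y A) (rswap_lst x y l)"

lemma lc_head_close: "lc_head k h \<Longrightarrow> lc_head (Suc k) (close_head k x h)"
  by (cases h) auto

lemma lc_close:
  fixes t :: "'s rtrm" and l :: "'s rlst"
  shows "lc_trm k t \<Longrightarrow> lc_trm (Suc k) (close_trm k x t)"
  "lc_lst j l \<Longrightarrow> lc_lst (Suc j) (close_lst j x l)"
  by (induction t and l arbitrary: k and j) (auto simp: lc_head_close)

lemma lc_head_swap: "lc_head k (swap_head x y h) = lc_head k h"
  by (cases h) auto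

lemma lc_swap:
  fixes t :: "'s rtrm" and l :: "'s rlst"
  shows "lc_trm k (rswap_trm x y t) = lc_trm k t"
  "lc_lst j (rswap_lst x y l) = lc_lst j l"
  by (induction t and l arbitrary: k and j) (auto simp: lc_head_swap)

lemma fv_head_close: "fv_head (close_head k x h) = fv_head h - {x}"
  by (cases h) auto

lemma rfv_close:
  fixes t :: "'s rtrm" and l :: "'s rlst"
  shows "rfv_trm (close_trm k x t) = rfv_trm t - {x}"
  "rfv_lst (close_lst j x l) = rfv_lst l - {x}"
  by (induction t and l arbitrary: k and j) (auto simp: fv_head_close)

lemma finite_fv_head: "finite (fv_head h)"
  by (cases h) auto

lemma finite_rfv:
  "finite (rfv_trm (t :: 's rtrm))"
  "finite (rfv_lst (l :: 's rlst))"
  by (induction t and l) (auto simp: finite_fv_head)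

lemma close_head_inj:
  "close_head k x h = close_head k x h' \<Longrightarrow> lc_head k h \<Longrightarrow> lc_head k h' \<Longrightarrow> h = h'"
  by (cases h; cases h') (auto split: if_splits)

lemma close_inj:
  fixes t :: "'s rtrm" and l :: "'s rlst"
  shows "close_trm k x t = close_trm k x t' \<Longrightarrow> lc_trm k t \<Longrightarrow> lc_trm k t' \<Longrightarrow> t = t'"
  "close_lst j x l = close_lst j x l' \<Longrightarrow> lc_lst j l \<Longrightarrow> lc_lst j l' \<Longrightarrow> l = l'"
proof (induction t and l arbitrary: k t' and j l')
  case (RPi A B) then show ?case by (cases t') auto
next
  case (RLam A B) then show ?case by (cases t') auto
next
  case (RSort s) then show ?case by (cases t') auto
next
  case (RVar h l) then show ?case by (cases t') (auto dest: close_head_inj)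
next
  case (RCut M l) then show ?case by (cases t') auto
next
  case (RSub N A M) then show ?case by (cases t') auto
next
  case RNil then show ?case by (cases l') auto
next
  case (RCons M l) then show ?case by (cases l') auto
next
  case (RApp l1 l2) then show ?case by (cases l') auto
next
  case (RSubL N A l) then show ?case by (cases l') auto
qed

lemma close_head_swap:
  "y \<notin> fv_head h - {x} \<Longrightarrow> close_head k y (swap_head x y h) = close_head k x h"
  by (cases h) auto

lemma close_swap:
  fixes t :: "'s rtrm" and l :: "'s rlst"
  shows "y \<notin> rfv_trm t - {x} \<Longrightarrow> close_trm k y (rswap_trm x y t) = close_trm k x t"
  "y \<notin> rfv_lst l - {x} \<Longrightarrow> close_lst j y (rswap_lst x y l) = close_lst j x l"
  by (induction t and l arbitrary: k and j) (auto simp: close_head_swap)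

lemma close_head_surj:
  "lc_head (Suc k) h \<Longrightarrow> x \<notin> fv_head h \<Longrightarrow> \<exists>h'. lc_head k h' \<and> close_head k x h' = h"
  by (cases h) (auto simp: less_Suc_eq intro: exI[of _ "Free x"] exI[of _ "Free y" for y]
      exI[of _ "Bound i" for i])

lemma close_surj:
  fixes t :: "'s rtrm" and l :: "'s rlst"
  shows "lc_trm (Suc k) t \<Longrightarrow> x \<notin> rfv_trm t \<Longrightarrow>
     \<exists>u. lc_trm k u \<and> close_trm k x u = t"
  "lc_lst (Suc j) l \<Longrightarrow> x \<notin> rfv_lst l \<Longrightarrow>
     \<exists>m. lc_lst j m \<and> close_lst j x m = l"
proof (induction t and l arbitrary: k and j)
  case (RPi A B)
  then obtain u v where "lc_trm k u" "close_trm k x u = A"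
    "lc_trm (Suc k) v" "close_trm (Suc k) x v = B" by fastforce
  then show ?case by (intro exI[of _ "RPi u v"]) auto
next
  case (RLam A B)
  then obtain u v where "lc_trm k u" "close_trm k x u = A"
    "lc_trm (Suc k) v" "close_trm (Suc k) x v = B" by fastforce
  then show ?case by (intro exI[of _ "RLam u v"]) auto
next
  case (RSort s) then show ?case by (intro exI[of _ "RSort s"]) auto
next
  case (RVar h l)
  then obtain h' m where "lc_head k h'" "close_head k x h' = h"
    "lc_lst k m" "close_lst k x m = l" using close_head_surj[of k h x] by fastforce
  then show ?case by (intro exI[of _ "RVar h' m"]) auto
next
  case (RCut M l)
  then obtain u m where "lc_trm k u" "close_trm k x u = M"
    "lc_lst k m" "close_lst k x m = l" by fastforce
  then show ?case by (intro exI[of _ "RCut u m"]) auto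
next
  case (RSub N A M)
  obtain u where "lc_trm k u" "close_trm k x u = N" using RSub by fastforce
  moreover obtain v where "lc_trm k v" "close_trm k x v = A" using RSub by fastforce
  moreover obtain w where "lc_trm (Suc k) w" "close_trm (Suc k) x w = M" using RSub by fastforce
  ultimately show ?case by (intro exI[of _ "RSub u v w"]) auto
next
  case RNil then show ?case by (intro exI[of _ RNil]) auto
next
  case (RCons M l)
  then obtain u m where "lc_trm j u" "close_trm j x u = M"
    "lc_lst j m" "close_lst j x m = l" by fastforce
  then show ?case by (intro exI[of _ "RCons u m"]) auto
next
  case (RApp l l')
  then obtain u m where "lc_lst j u" "close_lst j x u = l"
    "lc_lst j m" "close_lst j x m = l'" by fastforce
  then show ?case by (intro exI[of _ "RApp u m"]) auto
next
  case (RSubL N A l)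
  obtain u where "lc_trm j u" "close_trm j x u = N" using RSubL by fastforce
  moreover obtain v where "lc_trm j v" "close_trm j x v = A" using RSubL by fastforce
  moreover obtain w where "lc_lst (Suc j) w" "close_lst (Suc j) x w = l" using RSubL by fastforce
  ultimately show ?case by (intro exI[of _ "RSubL u v w"]) auto
qed

lemma size_close [simp]:
  fixes t :: "'s rtrm" and l :: "'s rlst"
  shows "size (close_trm k x t) = size t"
  "size (close_lst j x l) = size l"
  by (induction t and l arbitrary: k and j) auto


section \<open>Terms and lists up to \<open>\<alpha>\<close>-conversion\<close>

typedef 's trm = "{t :: 's rtrm. lc_trm 0 t}"
  by (rule exI[of _ "RSort undefined"]) simp

typedef 's lst = "{l :: 's rlst. lc_lst 0 l}"
  by (rule exI[of _ RNil]) simp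

setup_lifting type_definition_trm
setup_lifting type_definition_lst

text \<open>
  \<open>TPi x A B\<close>, \<open>TLam x A M\<close>, \<open>TSub x N A M\<close> and \<open>LSub x N A l\<close> bind \<open>x\<close> in their last argument;
  \<open>TSub x N A M\<close> and \<open>LSub x N A l\<close> stand for \<open>\<langle>N/x\<rangle>\<^sub>A M\<close> and \<open>\<langle>N/x\<rangle>\<^sub>A l\<close>. \<open>TVar x l\<close> is \<open>x l\<close>,
  \<open>TCut M l\<close> is \<open>M l\<close>, \<open>LCons M l\<close> is \<open>M\<cdot>l\<close> and \<open>LApp l l'\<close> is \<open>l@l'\<close>.
\<close>

lift_definition TPi :: "var \<Rightarrow> 's trm \<Rightarrow> 's trm \<Rightarrow> 's trm" is
  "\<lambda>x A B. RPi A (close_trm 0 x B)" by (simp add: lc_close)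

lift_definition TLam :: "var \<Rightarrow> 's trm \<Rightarrow> 's trm \<Rightarrow> 's trm" is
  "\<lambda>x A M. RLam A (close_trm 0 x M)" by (simp add: lc_close)

lift_definition TSort :: "'s \<Rightarrow> 's trm" is RSort by simp

lift_definition TVar :: "var \<Rightarrow> 's lst \<Rightarrow> 's trm" is "\<lambda>x l. RVar (Free x) l" by simp

lift_definition TCut :: "'s trm \<Rightarrow> 's lst \<Rightarrow> 's trm" is RCut by simp

lift_definition TSub :: "var \<Rightarrow> 's trm \<Rightarrow> 's trm \<Rightarrow> 's trm \<Rightarrow> 's trm" is
  "\<lambda>x N A M. RSub N A (close_trm 0 x M)" by (simp add: lc_close)

lift_definition LNil :: "'s lst" is RNil by simp

lift_definition LCons :: "'s trm \<Rightarrow> 's lst \<Rightarrow> 's lst" is RCons by simp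

lift_definition LApp :: "'s lst \<Rightarrow> 's lst \<Rightarrow> 's lst" is RApp by simp

lift_definition LSub :: "var \<Rightarrow> 's trm \<Rightarrow> 's trm \<Rightarrow> 's lst \<Rightarrow> 's lst" is
  "\<lambda>x N A l. RSubL N A (close_lst 0 x l)" by (simp add: lc_close)

lift_definition fv_trm :: "'s trm \<Rightarrow> var set" is rfv_trm .
lift_definition fv_lst :: "'s lst \<Rightarrow> var set" is rfv_lst .

lift_definition swap_trm :: "var \<Rightarrow> var \<Rightarrow> 's trm \<Rightarrow> 's trm" is rswap_trm by (simp add: lc_swap)
lift_definition swap_lst :: "var \<Rightarrow> var \<Rightarrow> 's lst \<Rightarrow> 's lst" is rswap_lst by (simp add: lc_swap)

text \<open>
  The following facts show that the two types are the grammar of terms and lists modulo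
  \<open>\<alpha>\<close>-conversion: free variables are as expected, bound names can be renamed and are otherwise
  irrelevant, and the constructors are injective and generate everything.
\<close>

lemma fv_simps [simp]:
  "fv_trm (TPi x A B) = fv_trm A \<union> (fv_trm B - {x})"
  "fv_trm (TLam x A M) = fv_trm A \<union> (fv_trm M - {x})"
  "fv_trm (TSort s) = {}"
  "fv_trm (TVar x l) = insert x (fv_lst l)"
  "fv_trm (TCut M l) = fv_trm M \<union> fv_lst l"
  "fv_trm (TSub x N A M) = fv_trm N \<union> fv_trm A \<union> (fv_trm M - {x})"
  "fv_lst LNil = {}"
  "fv_lst (LCons M l) = fv_trm M \<union> fv_lst l"
  "fv_lst (LApp l l') = fv_lst l \<union> fv_lst l'"
  "fv_lst (LSub x N A l) = fv_trm N \<union> fv_trm A \<union> (fv_lst l - {x})"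
  by (transfer; simp add: rfv_close)+

lemma finite_fv [simp]: "finite (fv_trm M)" "finite (fv_lst l)"
  by (transfer; simp add: finite_rfv)+

lemma alpha_rename:
  "y \<notin> fv_trm M - {x} \<Longrightarrow> TPi x A M = TPi y A (swap_trm x y M)"
  "y \<notin> fv_trm M - {x} \<Longrightarrow> TLam x A M = TLam y A (swap_trm x y M)"
  "y \<notin> fv_trm M - {x} \<Longrightarrow> TSub x N A M = TSub y N A (swap_trm x y M)"
  "y \<notin> fv_lst l - {x} \<Longrightarrow> LSub x N A l = LSub y N A (swap_lst x y l)"
  by (transfer; auto simp: close_swap)+

lemma binder_inject [simp]:
  "TPi x A M = TPi x A' M' \<longleftrightarrow> A = A' \<and> M = M'"
  "TLam x A M = TLam x A' M' \<longleftrightarrow> A = A' \<and> M = M'"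
  "TSub x N A M = TSub x N' A' M' \<longleftrightarrow> N = N' \<and> A = A' \<and> M = M'"
  "LSub x N A l = LSub x N' A' l' \<longleftrightarrow> N = N' \<and> A = A' \<and> l = l'"
  by (transfer; auto dest: close_inj)+

lemma nonbinder_inject [simp]:
  "TSort s = TSort s' \<longleftrightarrow> s = s'"
  "TVar x l = TVar x' l' \<longleftrightarrow> x = x' \<and> l = l'"
  "TCut M l = TCut M' l' \<longleftrightarrow> M = M' \<and> l = l'"
  "LCons M l = LCons M' l' \<longleftrightarrow> M = M' \<and> l = l'"
  "LApp l1 l2 = LApp l1' l2' \<longleftrightarrow> l1 = l1' \<and> l2 = l2'"
  by (transfer; auto)+

lemma trm_lst_induct:
  fixes P :: "'s trm \<Rightarrow> bool" and Q :: "'s lst \<Rightarrow> bool" and M :: "'s trm" and l :: "'s lst"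
  assumes X: "finite X"
    and TPi: "\<And>x A B. x \<notin> X \<Longrightarrow> P A \<Longrightarrow> P B \<Longrightarrow> P (TPi x A B)"
    and TLam: "\<And>x A M. x \<notin> X \<Longrightarrow> P A \<Longrightarrow> P M \<Longrightarrow> P (TLam x A M)"
    and TSort: "\<And>s. P (TSort s)"
    and TVar: "\<And>x l. Q l \<Longrightarrow> P (TVar x l)"
    and TCut: "\<And>M l. P M \<Longrightarrow> Q l \<Longrightarrow> P (TCut M l)"
    and TSub: "\<And>x N A M. x \<notin> X \<Longrightarrow> P N \<Longrightarrow> P A \<Longrightarrow> P M \<Longrightarrow> P (TSub x N A M)"
    and LNil: "Q LNil"
    and LCons: "\<And>M l. P M \<Longrightarrow> Q l \<Longrightarrow> Q (LCons M l)"
    and LApp: "\<And>l l'. Q l \<Longrightarrow> Q l' \<Longrightarrow> Q (LApp l l')"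
    and LSub: "\<And>x N A l. x \<notin> X \<Longrightarrow> P N \<Longrightarrow> P A \<Longrightarrow> Q l \<Longrightarrow> Q (LSub x N A l)"
  shows "P M" and "Q l"
proof -
  have fresh: "\<exists>x. x \<notin> X \<and> x \<notin> S" if "finite S" for S :: "var set"
    using ex_new_if_finite[OF infinite_UNIV_nat, of "X \<union> S"] X that by auto
  have "(\<forall>t :: 's rtrm. size t < n \<longrightarrow> lc_trm 0 t \<longrightarrow> P (Abs_trm t)) \<and>
        (\<forall>l :: 's rlst. size l < n \<longrightarrow> lc_lst 0 l \<longrightarrow> Q (Abs_lst l))" for n
  proof (induction n)
    case (Suc n)
    have IHt: "P (Abs_trm t)" if "size t < n" "lc_trm 0 t" for t using Suc that by blast
    have IHl: "Q (Abs_lst t)" if "size t < n" "lc_lst 0 t" for t using Suc that by blast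
    have eqs: "TPi x (Abs_trm a) (Abs_trm b) = Abs_trm (RPi a (close_trm 0 x b))"
      "TLam x (Abs_trm a) (Abs_trm b) = Abs_trm (RLam a (close_trm 0 x b))"
      "TSub x (Abs_trm c) (Abs_trm a) (Abs_trm b) = Abs_trm (RSub c a (close_trm 0 x b))"
      "TVar x (Abs_lst m) = Abs_trm (RVar (Free x) m)"
      "TCut (Abs_trm a) (Abs_lst m) = Abs_trm (RCut a m)"
      "LCons (Abs_trm a) (Abs_lst m) = Abs_lst (RCons a m)"
      "LApp (Abs_lst m) (Abs_lst m') = Abs_lst (RApp m m')"
      "LSub x (Abs_trm c) (Abs_trm a) (Abs_lst m) = Abs_lst (RSubL c a (close_lst 0 x m))"
      if "lc_trm 0 a" "lc_trm 0 b" "lc_trm 0 c" "lc_lst 0 m" "lc_lst 0 m'"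
      for x a b c m m'
      using that by (simp_all add: TPi.abs_eq TLam.abs_eq TSub.abs_eq TVar.abs_eq TCut.abs_eq
          LCons.abs_eq LApp.abs_eq LSub.abs_eq eq_onp_def)
    have sortn: "Abs_trm (RSort s) = TSort s" "Abs_lst RNil = (LNil :: 's lst)" for s :: 's
      by (simp_all add: TSort_def LNil_def)
    have t: "P (Abs_trm t)" if tm: "size t < Suc n" "lc_trm 0 t" for t
    proof (cases t)
      case (RPi a b)
      obtain x where x: "x \<notin> X" "x \<notin> rfv_trm b" using fresh finite_rfv by metis
      obtain b' where b': "lc_trm 0 b'" "close_trm 0 x b' = b"
        using close_surj(1)[of 0 b x] tm x RPi by auto
      have "size b' = size b" using b' size_close(1)[of 0 x b'] by simp
      then show ?thesis
        using TPi[of x "Abs_trm a" "Abs_trm b'"] x b' tm RPi IHt[of a] IHt[of b']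
          eqs(1)[of a b' a RNil RNil x] by simp
    next
      case (RLam a b)
      obtain x where x: "x \<notin> X" "x \<notin> rfv_trm b" using fresh finite_rfv by metis
      obtain b' where b': "lc_trm 0 b'" "close_trm 0 x b' = b"
        using close_surj(1)[of 0 b x] tm x RLam by auto
      have "size b' = size b" using b' size_close(1)[of 0 x b'] by simp
      then show ?thesis
        using TLam[of x "Abs_trm a" "Abs_trm b'"] x b' tm RLam IHt[of a] IHt[of b']
          eqs(2)[of a b' a RNil RNil x] by simp
    next
      case (RSort s)
      then show ?thesis using TSort sortn by simp
    next
      case (RVar h m)
      then obtain x where "h = Free x" using tm by (cases h) auto
      then show ?thesis
        using TVar[of "Abs_lst m" x] tm RVar IHl[of m]
          eqs(4)[of "RSort undefined" "RSort undefined" "RSort undefined" m RNil x] by simp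
    next
      case (RCut a m)
      then show ?thesis
        using TCut[of "Abs_trm a" "Abs_lst m"] tm IHt[of a] IHl[of m] eqs(5)[of a a a m RNil]
        by simp
    next
      case (RSub c a b)
      obtain x where x: "x \<notin> X" "x \<notin> rfv_trm b" using fresh finite_rfv by metis
      obtain b' where b': "lc_trm 0 b'" "close_trm 0 x b' = b"
        using close_surj(1)[of 0 b x] tm x RSub by auto
      have "size b' = size b" using b' size_close(1)[of 0 x b'] by simp
      then show ?thesis
        using TSub[of x "Abs_trm c" "Abs_trm a" "Abs_trm b'"] x b' tm RSub
          IHt[of c] IHt[of a] IHt[of b'] eqs(3)[of a b' c RNil RNil x] by simp
    qed
    have l: "Q (Abs_lst m)" if tm: "size m < Suc n" "lc_lst 0 m" for m
    proof (cases m)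
      case RNil
      then show ?thesis using LNil sortn by simp
    next
      case (RCons a b)
      then show ?thesis
        using LCons[of "Abs_trm a" "Abs_lst b"] tm IHt[of a] IHl[of b] eqs(6)[of a a a b RNil]
        by simp
    next
      case (RApp a b)
      then show ?thesis
        using LApp[of "Abs_lst a" "Abs_lst b"] tm IHl[of a] IHl[of b]
          eqs(7)[of "RSort undefined" "RSort undefined" "RSort undefined" a b]
        by simp
    next
      case (RSubL c a b)
      obtain x where x: "x \<notin> X" "x \<notin> rfv_lst b" using fresh finite_rfv by metis
      obtain b' where b': "lc_lst 0 b'" "close_lst 0 x b' = b"
        using close_surj(2)[of 0 b x] tm x RSubL by auto
      have "size b' = size b" using b' size_close(2)[of 0 x b'] by simp
      then show ?thesis
        using LSub[of x "Abs_trm c" "Abs_trm a" "Abs_lst b'"] x b' tm RSubL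
          IHt[of c] IHt[of a] IHl[of b'] eqs(8)[of a a c b' RNil x] by simp
    qed
    show ?case using t l by blast
  qed simp
  then show "P M" "Q l"
    using Rep_trm[of M] Rep_lst[of l] Rep_trm_inverse[of M] Rep_lst_inverse[of l]
    by (metis lessI mem_Collect_eq)+
qed


section \<open>Reduction\<close>

text \<open>
  Capture avoidance has to be requested only for \<open>TLam\<close> and \<open>TPi\<close>. The annotation \<open>G\<close>
  of the substitution also moves below the binder, hence \<open>x\<close> must not be free in it either.
\<close>

inductive red_trm :: "'s trm \<Rightarrow> 's trm \<Rightarrow> bool" and red_lst :: "'s lst \<Rightarrow> 's lst \<Rightarrow> bool" where
  beta: "red_trm (TCut (TLam x A M) (LCons N l)) (TCut (TSub x N A M) l)"
| cut_nil: "red_trm (TCut M LNil) M"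
| cut_var: "red_trm (TCut (TVar x l) l') (TVar x (LApp l l'))"
| cut_cut: "red_trm (TCut (TCut M l) l') (TCut M (LApp l l'))"
| app_cons: "red_lst (LApp (LCons M l') l) (LCons M (LApp l' l))"
| app_nil_left: "red_lst (LApp LNil l) l"
| app_app: "red_lst (LApp (LApp l l') l'') (LApp l (LApp l' l''))"
| app_nil_right: "red_lst (LApp l LNil) l"
| sub_lam: "x \<noteq> y \<Longrightarrow> x \<notin> fv_trm P \<Longrightarrow> x \<notin> fv_trm G \<Longrightarrow>
    red_trm (TSub y P G (TLam x A M)) (TLam x (TSub y P G A) (TSub y P G M))"
| sub_var_same: "red_trm (TSub y P G (TVar y l)) (TCut P (LSub y P G l))"
| sub_var_other: "x \<noteq> y \<Longrightarrow> red_trm (TSub y P G (TVar x l)) (TVar x (LSub y P G l))"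
| sub_cut: "red_trm (TSub y P G (TCut M l)) (TCut (TSub y P G M) (LSub y P G l))"
| sub_pi: "x \<noteq> y \<Longrightarrow> x \<notin> fv_trm P \<Longrightarrow> x \<notin> fv_trm G \<Longrightarrow>
    red_trm (TSub y P G (TPi x A B)) (TPi x (TSub y P G A) (TSub y P G B))"
| sub_sort: "red_trm (TSub y P G (TSort s)) (TSort s)"
| sub_nil: "red_lst (LSub y P G LNil) LNil"
| sub_cons: "red_lst (LSub y P G (LCons M l)) (LCons (TSub y P G M) (LSub y P G l))"
| sub_app: "red_lst (LSub y P G (LApp l l')) (LApp (LSub y P G l) (LSub y P G l'))"
| ctx_pi1: "red_trm A A' \<Longrightarrow> red_trm (TPi x A B) (TPi x A' B)"
| ctx_pi2: "red_trm B B' \<Longrightarrow> red_trm (TPi x A B) (TPi x A B')"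
| ctx_lam1: "red_trm A A' \<Longrightarrow> red_trm (TLam x A M) (TLam x A' M)"
| ctx_lam2: "red_trm M M' \<Longrightarrow> red_trm (TLam x A M) (TLam x A M')"
| ctx_var: "red_lst l l' \<Longrightarrow> red_trm (TVar x l) (TVar x l')"
| ctx_cut1: "red_trm M M' \<Longrightarrow> red_trm (TCut M l) (TCut M' l)"
| ctx_cut2: "red_lst l l' \<Longrightarrow> red_trm (TCut M l) (TCut M l')"
| ctx_sub1: "red_trm N N' \<Longrightarrow> red_trm (TSub x N A M) (TSub x N' A M)"
| ctx_sub2: "red_trm A A' \<Longrightarrow> red_trm (TSub x N A M) (TSub x N A' M)"
| ctx_sub3: "red_trm M M' \<Longrightarrow> red_trm (TSub x N A M) (TSub x N A M')"
| ctx_cons1: "red_trm M M' \<Longrightarrow> red_lst (LCons M l) (LCons M' l)"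
| ctx_cons2: "red_lst l l' \<Longrightarrow> red_lst (LCons M l) (LCons M l')"
| ctx_app1: "red_lst l l'' \<Longrightarrow> red_lst (LApp l l') (LApp l'' l')"
| ctx_app2: "red_lst l' l'' \<Longrightarrow> red_lst (LApp l l') (LApp l l'')"
| ctx_subl1: "red_trm N N' \<Longrightarrow> red_lst (LSub x N A l) (LSub x N' A l)"
| ctx_subl2: "red_trm A A' \<Longrightarrow> red_lst (LSub x N A l) (LSub x N A' l)"
| ctx_subl3: "red_lst l l' \<Longrightarrow> red_lst (LSub x N A l) (LSub x N A l')"

abbreviation conv :: "'s trm \<Rightarrow> 's trm \<Rightarrow> bool" where
  "conv \<equiv> equivclp red_trm"


section \<open>Environments and typing\<close>

text \<open>The rightmost declaration of an environment is the last element of the list.\<close>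

type_synonym 's env = "(var \<times> 's trm) list"

definition env_dom :: "'s env \<Rightarrow> var set" where
  "env_dom \<Gamma> = fst ` set \<Gamma>"

definition sub_env :: "var \<Rightarrow> 's trm \<Rightarrow> 's trm \<Rightarrow> 's env \<Rightarrow> 's env" where
  "sub_env x P A \<Delta> = map (\<lambda>(y, B). (y, TSub x P A B)) \<Delta>"

definition sub_environment :: "'s env \<Rightarrow> 's env \<Rightarrow> bool" (infix \<open>\<sqsubseteq>\<close> 50) where
  "\<Gamma> \<sqsubseteq> \<Delta> \<longleftrightarrow> (\<forall>x A. (x, A) \<in> set \<Gamma> \<longrightarrow> (\<exists>B. (x, B) \<in> set \<Delta> \<and> conv A B))"

definition sub_type :: "var \<Rightarrow> 's trm \<Rightarrow> 's trm \<Rightarrow> 's trm \<Rightarrow> 's trm" where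
  "sub_type x P A C = (if C \<in> range TSort then C else TSub x P A C)"

text \<open>
  For the PTSC given by the axioms \<open>\<A>\<close> and the rules \<open>\<R>\<close>, \<open>wf_env \<A> \<R> \<Gamma>\<close> is \<open>\<Gamma> wf\<close>,
  \<open>has_type \<A> \<R> \<Gamma> M A\<close> is \<open>\<Gamma> \<turnstile> M : A\<close>, and \<open>lst_type \<A> \<R> \<Gamma> B l C\<close> is \<open>\<Gamma>; B \<turnstile> l : C\<close>.
\<close>

inductive wf_env :: "('s \<times> 's) set \<Rightarrow> ('s \<times> 's \<times> 's) set \<Rightarrow> 's env \<Rightarrow> bool"
  and has_type :: "('s \<times> 's) set \<Rightarrow> ('s \<times> 's \<times> 's) set \<Rightarrow> 's env \<Rightarrow> 's trm \<Rightarrow> 's trm \<Rightarrow> bool"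
  and lst_type :: "('s \<times> 's) set \<Rightarrow> ('s \<times> 's \<times> 's) set \<Rightarrow>
    's env \<Rightarrow> 's trm \<Rightarrow> 's lst \<Rightarrow> 's trm \<Rightarrow> bool"
  for \<A> :: "('s \<times> 's) set" and \<R> :: "('s \<times> 's \<times> 's) set" where
  empty: "wf_env \<A> \<R> []"
| extend: "has_type \<A> \<R> \<Gamma> A (TSort s) \<Longrightarrow> x \<notin> env_dom \<Gamma> \<Longrightarrow> wf_env \<A> \<R> (\<Gamma> @ [(x, A)])"
| sorted: "wf_env \<A> \<R> \<Gamma> \<Longrightarrow> (s, s') \<in> \<A> \<Longrightarrow> has_type \<A> \<R> \<Gamma> (TSort s) (TSort s')"
| Pi_wf: "has_type \<A> \<R> \<Gamma> A (TSort s1) \<Longrightarrow> has_type \<A> \<R> (\<Gamma> @ [(x, A)]) B (TSort s2) \<Longrightarrow>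
    (s1, s2, s3) \<in> \<R> \<Longrightarrow> has_type \<A> \<R> \<Gamma> (TPi x A B) (TSort s3)"
| Pi_R: "has_type \<A> \<R> \<Gamma> (TPi x A B) (TSort s) \<Longrightarrow> has_type \<A> \<R> (\<Gamma> @ [(x, A)]) M B \<Longrightarrow>
    has_type \<A> \<R> \<Gamma> (TLam x A M) (TPi x A B)"
| select: "lst_type \<A> \<R> \<Gamma> A l B \<Longrightarrow> (x, A) \<in> set \<Gamma> \<Longrightarrow> has_type \<A> \<R> \<Gamma> (TVar x l) B"
| "axiom": "has_type \<A> \<R> \<Gamma> A (TSort s) \<Longrightarrow> lst_type \<A> \<R> \<Gamma> A LNil A"
| conv_R: "has_type \<A> \<R> \<Gamma> M A \<Longrightarrow> has_type \<A> \<R> \<Gamma> B (TSort s) \<Longrightarrow> conv A B \<Longrightarrow>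
    has_type \<A> \<R> \<Gamma> M B"
| Pi_L: "has_type \<A> \<R> \<Gamma> (TPi x A B) (TSort s) \<Longrightarrow> has_type \<A> \<R> \<Gamma> M A \<Longrightarrow>
    lst_type \<A> \<R> \<Gamma> (TSub x M A B) l C \<Longrightarrow> lst_type \<A> \<R> \<Gamma> (TPi x A B) (LCons M l) C"
| conv_R': "lst_type \<A> \<R> \<Gamma> C l A \<Longrightarrow> has_type \<A> \<R> \<Gamma> B (TSort s) \<Longrightarrow> conv A B \<Longrightarrow>
    lst_type \<A> \<R> \<Gamma> C l B"
| conv_L: "lst_type \<A> \<R> \<Gamma> A l C \<Longrightarrow> has_type \<A> \<R> \<Gamma> B (TSort s) \<Longrightarrow> conv A B \<Longrightarrow>
    lst_type \<A> \<R> \<Gamma> B l C"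
| Cut1: "lst_type \<A> \<R> \<Gamma> C l' A \<Longrightarrow> lst_type \<A> \<R> \<Gamma> A l B \<Longrightarrow> lst_type \<A> \<R> \<Gamma> C (LApp l' l) B"
| Cut2: "has_type \<A> \<R> \<Gamma> P A \<Longrightarrow> lst_type \<A> \<R> (\<Gamma> @ [(x, A)] @ \<Delta>) B l C \<Longrightarrow>
    \<Gamma> @ sub_env x P A \<Delta> \<sqsubseteq> \<Delta>' \<Longrightarrow> wf_env \<A> \<R> \<Delta>' \<Longrightarrow>
    lst_type \<A> \<R> \<Delta>' (TSub x P A B) (LSub x P A l) (TSub x P A C)"
| Cut3: "has_type \<A> \<R> \<Gamma> M A \<Longrightarrow> lst_type \<A> \<R> \<Gamma> A l B \<Longrightarrow> has_type \<A> \<R> \<Gamma> (TCut M l) B"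
| Cut4: "has_type \<A> \<R> \<Gamma> P A \<Longrightarrow> has_type \<A> \<R> (\<Gamma> @ [(x, A)] @ \<Delta>) M C \<Longrightarrow>
    \<Gamma> @ sub_env x P A \<Delta> \<sqsubseteq> \<Delta>' \<Longrightarrow> wf_env \<A> \<R> \<Delta>' \<Longrightarrow>
    has_type \<A> \<R> \<Delta>' (TSub x P A M) (sub_type x P A C)"

end

theory Submission
  imports Defs "HOL-Library.Confluence"
begin

text \<open>
  Conversion is reduced to \<open>\<beta>\<close>-conversion of ordinary lambda terms: explicit substitutions are
  executed in an environment-style denotation, and reading the denotation back gives a convertible
  term. So \<open>\<Pi>\<close> is injective up to conversion because \<open>\<beta>\<close>-reduction is confluent, and conversion
  satisfies the substitution lemma. Typing is stable under \<open>\<sqsubseteq>\<close>, and every typed term or list can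
  be analysed by the last rule of its derivation that is not a conversion rule; this gives subject
  reduction for each rule in turn. The side condition \<open>C' = C\<close> for sorts in \<open>Cut4\<close> is harmless, as
  a sort that is typable before the cut is typable after it.
\<close>

section \<open>Lambda terms and confluence\<close>

text \<open>The obstacle is that no reduction rule moves a substitution past another one, yet typing
  a \<open>LCons\<close> under a substitution requires two of them to commute up to conversion. In a
  model where substitution is a change of environment this is an equation. The model forgets the
  annotation of a substitution. That is faithful: on a term without substitutions, the rules push a
  substitution to the leaves, where its annotation vanishes, so terms differing only there are
  convertible, typed or not. Two difficulties shape the typing part. The premise environments of a
  cut are only bounded by that of its conclusion, so inversion yields unknown \<Gamma> and \<Delta>.
  And the bound name in a derivation need not be the one at hand, so inversion is stated for a name
  fresh for the environment, and derivations are moved to it by swapping. The last induction follows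
  the reduction step, for all environments and types at once, so that its hypothesis applies in
  those unknown environments.\<close>

datatype 's lam =
    DVar nat
  | DSort 's
  | DPi "'s lam" "'s lam"
  | DLam "'s lam" "'s lam"
  | DApp "'s lam" "'s lam"

primrec lren :: "(nat \<Rightarrow> nat) \<Rightarrow> 's lam \<Rightarrow> 's lam" where
  "lren r (DVar n) = DVar (r n)"
| "lren r (DSort s) = DSort s"
| "lren r (DPi a b) = DPi (lren r a) (lren (case_nat 0 (Suc \<circ> r)) b)"
| "lren r (DLam a b) = DLam (lren r a) (lren (case_nat 0 (Suc \<circ> r)) b)"
| "lren r (DApp a b) = DApp (lren r a) (lren r b)"

text \<open>Substitution below a binder. Renaming is a recursion of its own so that this shift is
  available before \<open>lsub\<close> is defined.\<close>

definition up :: "(nat \<Rightarrow> 's lam) \<Rightarrow> nat \<Rightarrow> 's lam" where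
  "up \<sigma> = case_nat (DVar 0) (lren Suc \<circ> \<sigma>)"

lemma up_simps [simp]: "up \<sigma> 0 = DVar 0" "up \<sigma> (Suc n) = lren Suc (\<sigma> n)"
  by (simp_all add: up_def)

primrec lsub :: "(nat \<Rightarrow> 's lam) \<Rightarrow> 's lam \<Rightarrow> 's lam" where
  "lsub \<sigma> (DVar n) = \<sigma> n"
| "lsub \<sigma> (DSort s) = DSort s"
| "lsub \<sigma> (DPi a b) = DPi (lsub \<sigma> a) (lsub (up \<sigma>) b)"
| "lsub \<sigma> (DLam a b) = DLam (lsub \<sigma> a) (lsub (up \<sigma>) b)"
| "lsub \<sigma> (DApp a b) = DApp (lsub \<sigma> a) (lsub \<sigma> b)"

text \<open>The substitution of a contracted redex: the indices above 0 drop by one because their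
  binder disappears.\<close>

definition inst :: "'s lam \<Rightarrow> nat \<Rightarrow> 's lam" where
  "inst n = case_nat n DVar"

lemma inst_simps [simp]: "inst n 0 = n" "inst n (Suc k) = DVar k"
  by (simp_all add: inst_def)

lemma up_DVar_comp: "up (DVar \<circ> r) = DVar \<circ> case_nat 0 (Suc \<circ> r)"
  by (auto simp: fun_eq_iff split: nat.split simp: up_def)

lemma lren_eq_lsub: "lren r t = lsub (DVar \<circ> r) t"
  by (induction t arbitrary: r) (simp_all add: up_DVar_comp)

lemma up_DVar [simp]: "up DVar = DVar"
  by (auto simp: fun_eq_iff up_def split: nat.split)

lemma lsub_DVar [simp]: "lsub DVar t = t"
  by (induction t) simp_all

lemma up_comp: "up \<sigma> \<circ> case_nat 0 (Suc \<circ> r) = up (\<sigma> \<circ> r)"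
  by (auto simp: fun_eq_iff up_def split: nat.split)

lemma lsub_lren: "lsub \<sigma> (lren r t) = lsub (\<sigma> \<circ> r) t"
  by (induction t arbitrary: \<sigma> r) (simp_all only: lsub.simps lren.simps up_comp o_apply)

lemma case_nat_comp: "case_nat 0 (Suc \<circ> r) \<circ> case_nat 0 (Suc \<circ> r') = case_nat 0 (Suc \<circ> (r \<circ> r'))"
  by (auto simp: fun_eq_iff split: nat.split)

lemma lren_lren: "lren r (lren r' t) = lren (r \<circ> r') t"
  by (induction t arbitrary: r r') (simp_all only: lren.simps case_nat_comp o_apply)

lemma lren_up: "lren (case_nat 0 (Suc \<circ> r)) \<circ> up \<sigma> = up (lren r \<circ> \<sigma>)"
  by (auto simp: fun_eq_iff up_def lren_lren comp_def split: nat.split)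

lemma lren_lsub: "lren r (lsub \<sigma> t) = lsub (lren r \<circ> \<sigma>) t"
  by (induction t arbitrary: \<sigma> r) (simp_all only: lsub.simps lren.simps lren_up o_apply)

lemma lsub_up: "lsub (up \<tau>) \<circ> up \<sigma> = up (lsub \<tau> \<circ> \<sigma>)"
  by (auto simp: fun_eq_iff up_def lsub_lren lren_lsub comp_def split: nat.split)

lemma lsub_lsub: "lsub \<tau> (lsub \<sigma> t) = lsub (lsub \<tau> \<circ> \<sigma>) t"
  by (induction t arbitrary: \<sigma> \<tau>) (simp_all only: lsub.simps lsub_up o_apply)

lemma lsub_inst_lren_Suc [simp]: "lsub (inst n) (lren Suc t) = t"
proof -
  have "inst n \<circ> Suc = DVar" by (simp add: fun_eq_iff)
  then show ?thesis by (simp add: lsub_lren)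
qed

text \<open>The substitution lemma in the form in which substitutions and renamings pass through
  \<open>par_beta\<close>; both composite substitutions agree at index 0 and at every
  successor.\<close>

lemma lsub_up_inst: "lsub \<sigma> (lsub (inst n) t) = lsub (inst (lsub \<sigma> n)) (lsub (up \<sigma>) t)"
proof -
  have "lsub \<sigma> \<circ> inst n = lsub (inst (lsub \<sigma> n)) \<circ> up \<sigma>"
    by (auto simp: fun_eq_iff inst_def up_def lsub_lren comp_def split: nat.split)
  then show ?thesis by (simp add: lsub_lsub)
qed

section \<open>Parallel beta reduction and the Church-Rosser property\<close>

inductive par :: "'s lam \<Rightarrow> 's lam \<Rightarrow> bool" where
  par_var: "par (DVar n) (DVar n)"
| par_sort: "par (DSort s) (DSort s)"
| par_pi: "par a a' \<Longrightarrow> par b b' \<Longrightarrow> par (DPi a b) (DPi a' b')"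
| par_lam: "par a a' \<Longrightarrow> par b b' \<Longrightarrow> par (DLam a b) (DLam a' b')"
| par_app: "par a a' \<Longrightarrow> par b b' \<Longrightarrow> par (DApp a b) (DApp a' b')"
| par_beta: "par m m' \<Longrightarrow> par n n' \<Longrightarrow> par (DApp (DLam a m) n) (lsub (inst n') m')"

inductive_cases par_piE: "par (DPi a b) c"
inductive_cases par_lamE: "par (DLam a b) c"

lemma par_refl [simp]: "par t t"
  by (induction t) (auto intro: par.intros)

lemma par_lsub:
  "par t t' \<Longrightarrow> (\<And>i. par (\<sigma> i) (\<sigma>' i)) \<Longrightarrow> par (lsub \<sigma> t) (lsub \<sigma>' t')"
proof (induction arbitrary: \<sigma> \<sigma>' rule: par.induct)
  \<comment> \<open>Renaming comes first: \<open>up \<sigma>\<close> shifts the terms of \<sigma>,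
    and the shifted terms must still be related when the induction goes below a binder.\<close>
  have ren: "par (lren r t) (lren r t')" if "par t t'" for r and t t' :: "'s lam"
    using that
  proof (induction arbitrary: r rule: par.induct)
    case (par_beta m m' n n' a)
    let ?r = "case_nat 0 (Suc \<circ> r)"
    have "lren r (lsub (inst n') m') = lsub (inst (lren r n')) (lren ?r m')"
      by (simp add: lren_eq_lsub lsub_up_inst up_DVar_comp)
    then show ?case using par.par_beta[OF par_beta.IH(1)[of ?r] par_beta.IH(2)[of r]] by simp
  qed (auto intro: par.intros)
  have up: "par (up \<sigma> i) (up \<sigma>' i)" if "\<And>i. par (\<sigma> i) (\<sigma>' i)" for \<sigma> \<sigma>' :: "nat \<Rightarrow> 's lam" and i
    using that by (cases i) (auto intro: ren)
  {
    case (par_pi a a' b b')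
    then show ?case by (auto intro!: par.par_pi simp: up)
  next
    case (par_lam a a' b b')
    then show ?case by (auto intro!: par.par_lam simp: up)
  next
    case (par_beta m m' n n' a)
    then show ?case
      using par.par_beta[of "lsub (up \<sigma>) m" "lsub (up \<sigma>') m'" "lsub \<sigma> n" "lsub \<sigma>' n'"]
      by (auto simp: lsub_up_inst up)
  }
qed (auto intro: par.intros)

text \<open>Takahashi's complete development: all redexes present in the term are contracted at
  once.\<close>

fun cd :: "'s lam \<Rightarrow> 's lam" where
  "cd (DVar n) = DVar n"
| "cd (DSort s) = DSort s"
| "cd (DPi a b) = DPi (cd a) (cd b)"
| "cd (DLam a b) = DLam (cd a) (cd b)"
| "cd (DApp (DLam a m) n) = lsub (inst (cd n)) (cd m)"
| "cd (DApp a b) = DApp (cd a) (cd b)"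

text \<open>The triangle property. The critical case is a redex that the given step left
  uncontracted: inverting \<open>par\<close> on its abstraction yields the premises of
  \<open>par_beta\<close>.\<close>

lemma par_cd: "par t t' \<Longrightarrow> par t' (cd t)"
proof (induction rule: par.induct)
  case (par_app a a' b b')
  show ?case
  proof (cases "\<exists>c m. a = DLam c m")
    case True
    then obtain c m where a: "a = DLam c m" by blast
    with par_app.hyps(1) obtain c' m' where a': "a' = DLam c' m'" by (auto elim: par_lamE)
    with par_app.IH(1) a have "par m' (cd m)" by (auto elim: par_lamE)
    then show ?thesis using a a' par_app.IH(2) by (auto intro: par.par_beta)
  next
    case False
    then have "cd (DApp a b) = DApp (cd a) (cd b)" by (cases a) auto
    then show ?thesis using par_app by (auto intro: par.par_app)
  qed
next
  case (par_beta m m' n n' a)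
  have "par (inst n' i) (inst (cd n) i)" for i using par_beta by (cases i) auto
  then show ?case using par_beta by (auto intro: par_lsub)
qed (auto intro: par.intros)

abbreviation lam_eq :: "'s lam \<Rightarrow> 's lam \<Rightarrow> bool" (infix \<open>\<approx>\<close> 50) where
  "lam_eq \<equiv> equivclp par"

text \<open>Church-Rosser: by \<open>par_cd\<close>, two reducts of \<open>x\<close> meet in
  \<open>cd x\<close> after one step each, which is strong confluence.\<close>

lemma lam_eq_common_reduct: "a \<approx> b \<longleftrightarrow> (\<exists>c. par\<^sup>*\<^sup>* a c \<and> par\<^sup>*\<^sup>* b c)"
proof -
  have "strong_confluentp (par :: 's lam \<Rightarrow> _)"
  proof
    fix x y z :: "'s lam"
    assume "par x y" "par x z"
    then have "par\<^sup>*\<^sup>* y (cd x)" "par\<^sup>*\<^sup>* z (cd x)" "par z (cd x)" by (blast dest: par_cd)+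
    then show "\<exists>u. par\<^sup>*\<^sup>* y u \<and> par\<^sup>=\<^sup>= z u" by blast
  qed
  then have "equivclp (par :: 's lam \<Rightarrow> _) = par\<^sup>*\<^sup>* OO par\<inverse>\<inverse>\<^sup>*\<^sup>*"
    by (intro semiconfluentp_equivclp strong_confluentp_into_semiconfluentp)
  then show ?thesis by (auto simp: rtranclp_conversep relcompp_apply fun_eq_iff)
qed

lemma par_rtranclp_pi:
  "par\<^sup>*\<^sup>* (DPi a b) c \<Longrightarrow> \<exists>a' b'. c = DPi a' b' \<and> par\<^sup>*\<^sup>* a a' \<and> par\<^sup>*\<^sup>* b b'"
proof (induction rule: rtranclp_induct)
  case (step y z)
  then obtain a' b' where "y = DPi a' b'" "par\<^sup>*\<^sup>* a a'" "par\<^sup>*\<^sup>* b b'" by blast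
  with step(2) show ?case by (auto elim!: par_piE intro: rtranclp.rtrancl_into_rtrancl)
qed simp

text \<open>No redex has a product at its root, so the common reduct is again a product and is
  reached componentwise from both sides.\<close>

lemma lam_eq_pi:
  assumes "DPi a b \<approx> DPi a' b'"
  shows "a \<approx> a'" "b \<approx> b'"
proof -
  obtain c where c: "par\<^sup>*\<^sup>* (DPi a b) c" "par\<^sup>*\<^sup>* (DPi a' b') c"
    using assms unfolding lam_eq_common_reduct by blast
  obtain d e where "c = DPi d e" "par\<^sup>*\<^sup>* a d" "par\<^sup>*\<^sup>* b e" using par_rtranclp_pi[OF c(1)] by blast
  with par_rtranclp_pi[OF c(2)] show "a \<approx> a'" "b \<approx> b'" unfolding lam_eq_common_reduct by auto
qed

lemma equivclp_map:
  assumes "\<And>a b. r a b \<Longrightarrow> equivclp q (f a) (f b)" and "equivclp r a b"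
  shows "equivclp q (f a) (f b)"
  using assms(2)
proof (induction rule: equivclp_induct)
  case (step y z)
  then have "equivclp q (f y) (f z)" using assms(1) equivclp_sym[of q "f z" "f y"] by blast
  with step.IH show ?case by (rule equivclp_trans)
qed simp

lemma equivclp_map2:
  assumes "\<And>a a' b. r a a' \<Longrightarrow> equivclp q (f a b) (f a' b)"
    and "\<And>a b b'. r' b b' \<Longrightarrow> equivclp q (f a b) (f a b')"
    and "equivclp r a a'" "equivclp r' b b'"
  shows "equivclp q (f a b) (f a' b')"
proof -
  have "equivclp q (f a b) (f a' b)"
    by (rule equivclp_map[of r q "\<lambda>a. f a b", OF _ assms(3)]) (rule assms(1))
  also have "equivclp q (f a' b) (f a' b')"
    by (rule equivclp_map[of r' q "f a'", OF _ assms(4)]) (rule assms(2))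
  finally show ?thesis .
qed

lemma lam_eq_cong:
  assumes "a \<approx> a'" "b \<approx> b'"
  shows "DPi a b \<approx> DPi a' b'" "DLam a b \<approx> DLam a' b'" "DApp a b \<approx> DApp a' b'"
proof -
  show "DPi a b \<approx> DPi a' b'"
    by (rule equivclp_map2[OF _ _ assms]; rule r_into_equivclp) (auto intro: par_pi)
  show "DLam a b \<approx> DLam a' b'"
    by (rule equivclp_map2[OF _ _ assms]; rule r_into_equivclp) (auto intro: par_lam)
  show "DApp a b \<approx> DApp a' b'"
    by (rule equivclp_map2[OF _ _ assms]; rule r_into_equivclp) (auto intro: par_app)
qed

lemma lam_eq_lsub:
  assumes "a \<approx> a'"
  shows "lsub \<sigma> a \<approx> lsub \<sigma> a'"
  by (rule equivclp_map[OF _ assms]; rule r_into_equivclp) (auto intro: par_lsub)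

lemma lam_eq_lren: "a \<approx> a' \<Longrightarrow> lren r a \<approx> lren r a'"
  by (simp add: lren_eq_lsub lam_eq_lsub)

section \<open>Denotation of terms as lambda terms\<close>

abbreviation apps :: "'s lam \<Rightarrow> 's lam list \<Rightarrow> 's lam" where
  "apps \<equiv> foldl DApp"

text \<open>\<rho> interprets names and \<beta> interprets indices. Products and abstractions remain
  binders in the lambda term, so both environments are shifted below them. A substitution does not:
  its index 0 is bound to the meaning of \<open>N\<close> and nothing is shifted. Lists become
  argument spines.\<close>

primrec rden_trm :: "(var \<Rightarrow> 's lam) \<Rightarrow> (nat \<Rightarrow> 's lam) \<Rightarrow> 's rtrm \<Rightarrow> 's lam"
  and rden_lst :: "(var \<Rightarrow> 's lam) \<Rightarrow> (nat \<Rightarrow> 's lam) \<Rightarrow> 's rlst \<Rightarrow> 's lam list" where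
  "rden_trm \<rho> \<beta> (RPi A B) = DPi (rden_trm \<rho> \<beta> A) (rden_trm (lren Suc \<circ> \<rho>) (up \<beta>) B)"
| "rden_trm \<rho> \<beta> (RLam A M) = DLam (rden_trm \<rho> \<beta> A) (rden_trm (lren Suc \<circ> \<rho>) (up \<beta>) M)"
| "rden_trm \<rho> \<beta> (RSort s) = DSort s"
| "rden_trm \<rho> \<beta> (RVar h l) = apps (case h of Free x \<Rightarrow> \<rho> x | Bound i \<Rightarrow> \<beta> i) (rden_lst \<rho> \<beta> l)"
| "rden_trm \<rho> \<beta> (RCut M l) = apps (rden_trm \<rho> \<beta> M) (rden_lst \<rho> \<beta> l)"
| "rden_trm \<rho> \<beta> (RSub N A M) = rden_trm \<rho> (case_nat (rden_trm \<rho> \<beta> N) \<beta>) M"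
| "rden_lst \<rho> \<beta> RNil = []"
| "rden_lst \<rho> \<beta> (RCons M l) = rden_trm \<rho> \<beta> M # rden_lst \<rho> \<beta> l"
| "rden_lst \<rho> \<beta> (RApp l l') = rden_lst \<rho> \<beta> l @ rden_lst \<rho> \<beta> l'"
| "rden_lst \<rho> \<beta> (RSubL N A l) = rden_lst \<rho> (case_nat (rden_trm \<rho> \<beta> N) \<beta>) l"

text \<open>Capturing a name at index \<open>k\<close> moves its lookup from \<rho> to \<beta>. This
  turns the raw clauses into the name-based ones of \<open>den_simps\<close>.\<close>

lemma rden_close:
  fixes t :: "'s rtrm" and l :: "'s rlst"
  shows "rden_trm \<rho> \<beta> (close_trm k x t) = rden_trm (\<rho>(x := \<beta> k)) \<beta> t"
    "rden_lst \<rho>' \<beta>' (close_lst k' x l) = rden_lst (\<rho>'(x := \<beta>' k')) \<beta>' l"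
proof (induction t and l arbitrary: \<rho> \<beta> k and \<rho>' \<beta>' k')
  case (RVar h l)
  then show ?case by (cases h) auto
qed (simp_all add: fun_upd_comp)

lemma rden_lc:
  fixes t :: "'s rtrm" and l :: "'s rlst"
  shows "lc_trm k t \<Longrightarrow> (\<And>i. i < k \<Longrightarrow> \<beta> i = \<gamma> i) \<Longrightarrow> rden_trm \<rho> \<beta> t = rden_trm \<rho> \<gamma> t"
    "lc_lst k' l \<Longrightarrow> (\<And>i. i < k' \<Longrightarrow> \<beta>' i = \<gamma>' i) \<Longrightarrow> rden_lst \<rho>' \<beta>' l = rden_lst \<rho>' \<gamma>' l"
proof (induction t and l arbitrary: \<rho> \<beta> \<gamma> k and \<rho>' \<beta>' \<gamma>' k')
  case (RPi A B)
  have "rden_trm \<rho> \<beta> A = rden_trm \<rho> \<gamma> A"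
    by (rule RPi.IH(1)) (use RPi.prems in auto)
  moreover have "rden_trm (lren Suc \<circ> \<rho>) (up \<beta>) B = rden_trm (lren Suc \<circ> \<rho>) (up \<gamma>) B"
    by (rule RPi.IH(2)[of "Suc k"]) (use RPi.prems in \<open>auto simp: up_def split: nat.split\<close>)
  ultimately show ?case by simp
next
  case (RLam A B)
  have "rden_trm \<rho> \<beta> A = rden_trm \<rho> \<gamma> A"
    by (rule RLam.IH(1)) (use RLam.prems in auto)
  moreover have "rden_trm (lren Suc \<circ> \<rho>) (up \<beta>) B = rden_trm (lren Suc \<circ> \<rho>) (up \<gamma>) B"
    by (rule RLam.IH(2)[of "Suc k"]) (use RLam.prems in \<open>auto simp: up_def split: nat.split\<close>)
  ultimately show ?case by simp
next
  case (RVar h l)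
  have "rden_lst \<rho> \<beta> l = rden_lst \<rho> \<gamma> l"
    by (rule RVar.IH) (use RVar.prems in auto)
  then show ?case using RVar.prems by (cases h) auto
next
  case (RCut M l)
  have "rden_trm \<rho> \<beta> M = rden_trm \<rho> \<gamma> M" "rden_lst \<rho> \<beta> l = rden_lst \<rho> \<gamma> l"
    by (rule RCut.IH[of k]; use RCut.prems in auto)+
  then show ?case by simp
next
  case (RSub N A M)
  have *: "rden_trm \<rho> \<beta> N = rden_trm \<rho> \<gamma> N"
    by (rule RSub.IH(1)) (use RSub.prems in auto)
  show ?case unfolding rden_trm.simps *
    by (rule RSub.IH(3)[of "Suc k"]) (use RSub.prems in \<open>auto split: nat.split\<close>)
next
  case (RCons M l)
  have "rden_trm \<rho>' \<beta>' M = rden_trm \<rho>' \<gamma>' M" "rden_lst \<rho>' \<beta>' l = rden_lst \<rho>' \<gamma>' l"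
    by (rule RCons.IH[of k']; use RCons.prems in auto)+
  then show ?case by simp
next
  case (RApp l l')
  have "rden_lst \<rho>' \<beta>' l = rden_lst \<rho>' \<gamma>' l" "rden_lst \<rho>' \<beta>' l' = rden_lst \<rho>' \<gamma>' l'"
    by (rule RApp.IH[of k']; use RApp.prems in auto)+
  then show ?case by simp
next
  case (RSubL N A M)
  have *: "rden_trm \<rho>' \<beta>' N = rden_trm \<rho>' \<gamma>' N"
    by (rule RSubL.IH(1)) (use RSubL.prems in auto)
  show ?case unfolding rden_lst.simps *
    by (rule RSubL.IH(3)[of "Suc k'"]) (use RSubL.prems in \<open>auto split: nat.split\<close>)
qed simp_all

lemma rden_case_nat:
  "lc_trm 0 t \<Longrightarrow> rden_trm \<rho> (case_nat n DVar) t = rden_trm \<rho> DVar t"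
  "lc_lst 0 l \<Longrightarrow> rden_lst \<rho> (case_nat n DVar) l = rden_lst \<rho> DVar l"
  by (erule rden_lc; simp)+

lift_definition den_trm :: "(var \<Rightarrow> 's lam) \<Rightarrow> 's trm \<Rightarrow> 's lam" is "\<lambda>\<rho>. rden_trm \<rho> DVar" .
lift_definition den_lst :: "(var \<Rightarrow> 's lam) \<Rightarrow> 's lst \<Rightarrow> 's lam list" is "\<lambda>\<rho>. rden_lst \<rho> DVar" .

text \<open>The counterpart of \<open>up\<close> for environments indexed by names; an earlier
  meaning of \<open>x\<close> is shadowed.\<close>

definition benv :: "var \<Rightarrow> (var \<Rightarrow> 's lam) \<Rightarrow> var \<Rightarrow> 's lam" where
  "benv x \<rho> = (lren Suc \<circ> \<rho>)(x := DVar 0)"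

lemma benv_simps [simp]: "benv x \<rho> x = DVar 0" "y \<noteq> x \<Longrightarrow> benv x \<rho> y = lren Suc (\<rho> y)"
  by (simp_all add: benv_def)

lemma den_simps [simp]:
  "den_trm \<rho> (TPi x A B) = DPi (den_trm \<rho> A) (den_trm (benv x \<rho>) B)"
  "den_trm \<rho> (TLam x A M) = DLam (den_trm \<rho> A) (den_trm (benv x \<rho>) M)"
  "den_trm \<rho> (TSort s) = DSort s"
  "den_trm \<rho> (TVar x l) = apps (\<rho> x) (den_lst \<rho> l)"
  "den_trm \<rho> (TCut M l) = apps (den_trm \<rho> M) (den_lst \<rho> l)"
  "den_trm \<rho> (TSub x N A M) = den_trm (\<rho>(x := den_trm \<rho> N)) M"
  "den_lst \<rho> LNil = []"
  "den_lst \<rho> (LCons M l) = den_trm \<rho> M # den_lst \<rho> l"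
  "den_lst \<rho> (LApp l l') = den_lst \<rho> l @ den_lst \<rho> l'"
  "den_lst \<rho> (LSub x N A l) = den_lst (\<rho>(x := den_trm \<rho> N)) l"
  by (transfer; simp add: rden_close rden_case_nat benv_def)+

lemmas trm_induct = trm_lst_induct[OF finite.emptyI,
    case_names TPi TLam TSort TVar TCut TSub LNil LCons LApp LSub]

lemma den_cong:
  fixes M :: "'s trm" and l :: "'s lst"
  shows "(\<And>y. y \<in> fv_trm M \<Longrightarrow> \<rho> y = \<rho>' y) \<Longrightarrow> den_trm \<rho> M = den_trm \<rho>' M"
  "(\<And>y. y \<in> fv_lst l \<Longrightarrow> \<tau> y = \<tau>' y) \<Longrightarrow> den_lst \<tau> l = den_lst \<tau>' l"
proof (induction M and l arbitrary: \<rho> \<rho>' and \<tau> \<tau>' rule: trm_induct)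
  case (TPi x A B)
  have "den_trm (benv x \<rho>) B = den_trm (benv x \<rho>') B"
    by (rule TPi.IH) (use TPi.prems in \<open>auto simp: benv_def\<close>)
  moreover have "den_trm \<rho> A = den_trm \<rho>' A"
    by (rule TPi.IH) (use TPi.prems in auto)
  ultimately show ?case by simp
next
  case (TLam x A B)
  have "den_trm (benv x \<rho>) B = den_trm (benv x \<rho>') B"
    by (rule TLam.IH) (use TLam.prems in \<open>auto simp: benv_def\<close>)
  moreover have "den_trm \<rho> A = den_trm \<rho>' A"
    by (rule TLam.IH) (use TLam.prems in auto)
  ultimately show ?case by simp
next
  case (TSub x N A M)
  have *: "den_trm \<rho> N = den_trm \<rho>' N"
    by (rule TSub.IH) (use TSub.prems in auto)
  show ?case unfolding den_simps *
    by (rule TSub.IH) (use TSub.prems in auto)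
next
  case (LSub x N A M)
  have *: "den_trm \<tau> N = den_trm \<tau>' N"
    by (rule LSub.IH) (use LSub.prems in auto)
  show ?case unfolding den_simps *
    by (rule LSub.IH) (use LSub.prems in auto)
next
  case (TVar x l)
  have "den_lst \<rho> l = den_lst \<rho>' l"
    by (rule TVar.IH) (use TVar.prems in auto)
  moreover have "\<rho> x = \<rho>' x" using TVar.prems by simp
  ultimately show ?case by simp
next
  case (TCut M l)
  have "den_trm \<rho> M = den_trm \<rho>' M" "den_lst \<rho> l = den_lst \<rho>' l"
    by (rule TCut.IH; use TCut.prems in auto)+
  then show ?case by simp
next
  case (LCons M l)
  have "den_trm \<tau> M = den_trm \<tau>' M" "den_lst \<tau> l = den_lst \<tau>' l"
    by (rule LCons.IH; use LCons.prems in auto)+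
  then show ?case by simp
next
  case (LApp l l')
  have "den_lst \<tau> l = den_lst \<tau>' l" "den_lst \<tau> l' = den_lst \<tau>' l'"
    by (rule LApp.IH; use LApp.prems in auto)+
  then show ?case by simp
qed simp_all

lemma lsub_apps: "lsub \<sigma> (apps t ts) = apps (lsub \<sigma> t) (map (lsub \<sigma>) ts)"
  by (induction ts arbitrary: t) simp_all

lemma lsub_benv: "lsub (up \<sigma>) \<circ> benv x \<rho> = benv x (lsub \<sigma> \<circ> \<rho>)"
  by (auto simp: fun_eq_iff benv_def lsub_lren lren_lsub comp_def)

text \<open>Binders are handled by \<open>lsub_benv\<close>; an explicit substitution is a function
  update, and updates commute with composition.\<close>

lemma lsub_den:
  fixes M :: "'s trm" and l :: "'s lst"
  shows "lsub \<sigma> (den_trm \<rho> M) = den_trm (lsub \<sigma> \<circ> \<rho>) M"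
  "map (lsub \<sigma>') (den_lst \<rho>' l) = den_lst (lsub \<sigma>' \<circ> \<rho>') l"
  by (induction M and l arbitrary: \<sigma> \<rho> and \<sigma>' \<rho>' rule: trm_induct)
    (simp_all only: den_simps lsub.simps lsub_benv lsub_apps fun_upd_comp o_apply list.map map_append)

lemma lren_den: "lren r (den_trm \<rho> M) = den_trm (lren r \<circ> \<rho>) M"
proof -
  have "lren r \<circ> \<rho> = lsub (DVar \<circ> r) \<circ> \<rho>" by (simp add: fun_eq_iff lren_eq_lsub)
  then show ?thesis by (simp only: lren_eq_lsub[of r "den_trm \<rho> M"] lsub_den)
qed

lemma den_benv_fresh: "x \<notin> fv_trm M \<Longrightarrow> den_trm (benv x \<rho>) M = lren Suc (den_trm \<rho> M)"
  unfolding lren_den by (rule den_cong) (auto simp: benv_def)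

text \<open>Contracting a lambda redex amounts to reassigning the bound name. This matches
  \<open>par_beta\<close> with the clause for \<open>TSub\<close> in
  \<open>den_simps\<close>.\<close>

lemma lsub_inst_den:
  "lsub (inst n) (den_trm (benv x \<rho>) M) = den_trm (\<rho>(x := n)) M"
  "map (lsub (inst n)) (den_lst (benv x \<rho>) l) = den_lst (\<rho>(x := n)) l"
proof -
  have "lsub (inst n) \<circ> benv x \<rho> = \<rho>(x := n)" by (auto simp: fun_eq_iff benv_def)
  then show "lsub (inst n) (den_trm (benv x \<rho>) M) = den_trm (\<rho>(x := n)) M"
    "map (lsub (inst n)) (den_lst (benv x \<rho>) l) = den_lst (\<rho>(x := n)) l"
    by (simp_all only: lsub_den)
qed

lemma lam_eq_apps: "t \<approx> t' \<Longrightarrow> list_all2 lam_eq ts ts' \<Longrightarrow> apps t ts \<approx> apps t' ts'"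
proof (induction ts arbitrary: t t' ts')
  case (Cons a ts)
  then show ?case by (cases ts') (auto intro!: Cons.IH lam_eq_cong)
qed simp

lemma list_all2_lam_eq_refl [simp]: "list_all2 lam_eq ts ts"
  by (simp add: list_all2_refl)

lemma lam_eq_den:
  fixes M :: "'s trm" and l :: "'s lst"
  shows "(\<And>y. \<rho> y \<approx> \<rho>' y) \<Longrightarrow> den_trm \<rho> M \<approx> den_trm \<rho>' M"
  "(\<And>y. \<tau> y \<approx> \<tau>' y) \<Longrightarrow> list_all2 lam_eq (den_lst \<tau> l) (den_lst \<tau>' l)"
proof (induction M and l arbitrary: \<rho> \<rho>' and \<tau> \<tau>' rule: trm_induct)
  case (TPi x A B)
  have "den_trm (benv x \<rho>) B \<approx> den_trm (benv x \<rho>') B"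
    by (rule TPi.IH) (use TPi.prems in \<open>auto simp: benv_def lam_eq_lren\<close>)
  then show ?case using TPi by (auto intro!: lam_eq_cong)
next
  case (TLam x A B)
  have "den_trm (benv x \<rho>) B \<approx> den_trm (benv x \<rho>') B"
    by (rule TLam.IH) (use TLam.prems in \<open>auto simp: benv_def lam_eq_lren\<close>)
  then show ?case using TLam by (auto intro!: lam_eq_cong)
next
  case (TSub x N A M)
  have "den_trm \<rho> N \<approx> den_trm \<rho>' N" using TSub by auto
  then show ?case unfolding den_simps
    by (intro TSub.IH) (use TSub.prems in auto)
next
  case (LSub x N A M)
  have "den_trm \<tau> N \<approx> den_trm \<tau>' N" using LSub by auto
  then show ?case unfolding den_simps
    by (intro LSub.IH) (use LSub.prems in auto)
next
  case (TVar x l)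
  then show ?case by (simp add: lam_eq_apps)
next
  case (TCut M l)
  then show ?case by (simp add: lam_eq_apps)
next
  case (LApp l l')
  then show ?case by (simp add: list_all2_appendI)
qed simp_all

text \<open>Only \<open>beta\<close> costs a lambda step; the other head rules hold as equalities of
  denotations, and steps in a context follow by congruence. A step inside the substituted term
  changes the environment, which is the purpose of \<open>lam_eq_den\<close>.\<close>

lemma red_lam_eq:
  fixes M M' :: "'s trm" and l l' :: "'s lst"
  shows "red_trm M M' \<Longrightarrow> den_trm \<rho> M \<approx> den_trm \<rho> M'"
  "red_lst l l' \<Longrightarrow> list_all2 lam_eq (den_lst \<rho>' l) (den_lst \<rho>' l')"
proof (induction arbitrary: \<rho> and \<rho>' rule: red_trm_red_lst.inducts)
  \<comment> \<open>The capture condition on \<open>P\<close> enters here: below the binder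
    \<open>x\<close>, the meaning of \<open>P\<close> is just its shifted meaning.\<close>
  have benv_upd: "benv x (\<rho>(y := den_trm \<rho> P)) = (benv x \<rho>)(y := den_trm (benv x \<rho>) P)"
    if "x \<noteq> y" "x \<notin> fv_trm P" for x y \<rho> and P :: "'s trm"
    using that by (auto simp: fun_eq_iff benv_def den_benv_fresh[unfolded benv_def])
  {
    case (beta x A M N l)
    have "DApp (den_trm \<rho> (TLam x A M)) (den_trm \<rho> N) \<approx> den_trm \<rho> (TSub x N A M)"
      using par_beta[OF par_refl par_refl, of _ "den_trm (benv x \<rho>) M" "den_trm \<rho> N"]
      by (auto simp: lsub_inst_den)
    then show ?case by (simp add: lam_eq_apps)
  next
    case (sub_lam x y P G A M)
    then show ?case by (simp add: benv_upd)
  next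
    case (sub_pi x y P G A M)
    then show ?case by (simp add: benv_upd)
  next
    case ctx_sub1
    then show ?case by (simp add: lam_eq_den)
  next
    case ctx_subl1
    then show ?case by (simp add: lam_eq_den)
  }
qed (simp_all add: lam_eq_cong lam_eq_apps list_all2_appendI)

lemma conv_lam_eq: "conv M M' \<Longrightarrow> den_trm \<rho> M \<approx> den_trm \<rho> M'"
  by (erule equivclp_map[rotated]) (rule red_lam_eq)

section \<open>Readback and conversion\<close>

primrec hshift :: "head \<Rightarrow> head" where
  "hshift (Free x) = Free x"
| "hshift (Bound i) = Bound (Suc i)"

definition hup :: "(nat \<Rightarrow> head) \<Rightarrow> nat \<Rightarrow> head" where
  "hup h = case_nat (Bound 0) (hshift \<circ> h)"

lemma hup_simps [simp]: "hup h 0 = Bound 0" "hup h (Suc n) = hshift (h n)"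
  by (simp_all add: hup_def)

text \<open>Reading back into raw syntax avoids choosing a name at every binder. Names return in
  \<open>readback_simps\<close>, where any fresh one will do.\<close>

primrec rback :: "(nat \<Rightarrow> head) \<Rightarrow> 's lam \<Rightarrow> 's rtrm" where
  "rback h (DVar n) = RVar (h n) RNil"
| "rback h (DSort s) = RSort s"
| "rback h (DPi a b) = RPi (rback h a) (rback (hup h) b)"
| "rback h (DLam a b) = RLam (rback h a) (rback (hup h) b)"
| "rback h (DApp a b) = RCut (rback h a) (RCons (rback h b) RNil)"

primrec fvl :: "'s lam \<Rightarrow> nat set" where
  "fvl (DVar n) = {n}"
| "fvl (DSort s) = {}"
| "fvl (DPi a b) = fvl a \<union> Suc -` fvl b"
| "fvl (DLam a b) = fvl a \<union> Suc -` fvl b"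
| "fvl (DApp a b) = fvl a \<union> fvl b"

lemma lc_hshift: "lc_head k h \<Longrightarrow> lc_head (Suc k) (hshift h)"
  by (cases h) auto

lemma lc_rback: "(\<And>n. lc_head k (h n)) \<Longrightarrow> lc_trm k (rback h t)"
proof (induction t arbitrary: h k)
  have *: "lc_head (Suc k) (hup h n)" if "\<And>n. lc_head k (h n)" for h k n
    using that by (cases n) (auto simp: lc_hshift)
  {
    case (DPi a b) then show ?case using * by simp
  next
    case (DLam a b) then show ?case using * by simp
  }
qed auto

lemma close_rback:
  "(\<And>n. n \<in> fvl t \<Longrightarrow> close_head k x (h n) = h' n) \<Longrightarrow> close_trm k x (rback h t) = rback h' t"
proof (induction t arbitrary: h h' k)
  have under: "close_head (Suc k) x (hup h n) = hup h' n"
    if "\<And>n. n \<in> Suc -` S \<Longrightarrow> close_head k x (h n) = h' n" "n \<in> S" for h h' k n S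
  proof (cases n)
    case (Suc m)
    have "close_head (Suc k) x (hshift (h m)) = hshift (close_head k x (h m))" by (cases "h m") auto
    then show ?thesis using that Suc by auto
  qed simp
  {
    case (DPi a b)
    have "close_trm k x (rback h a) = rback h' a"
      by (rule DPi.IH) (use DPi.prems in auto)
    moreover have "close_trm (Suc k) x (rback (hup h) b) = rback (hup h') b"
      by (rule DPi.IH(2), rule under[of "fvl b"]) (use DPi.prems in auto)
    ultimately show ?case by simp
  next
    case (DLam a b)
    have "close_trm k x (rback h a) = rback h' a"
      by (rule DLam.IH) (use DLam.prems in auto)
    moreover have "close_trm (Suc k) x (rback (hup h) b) = rback (hup h') b"
      by (rule DLam.IH(2), rule under[of "fvl b"]) (use DLam.prems in auto)
    ultimately show ?case by simp
  next
    case (DApp a b)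
    have "close_trm k x (rback h a) = rback h' a" "close_trm k x (rback h b) = rback h' b"
      by (rule DApp.IH; use DApp.prems in auto)+
    then show ?case by simp
  }
qed auto

lift_definition readback :: "(nat \<Rightarrow> var) \<Rightarrow> 's lam \<Rightarrow> 's trm" is "\<lambda>\<nu>. rback (Free \<circ> \<nu>)"
  by (rule lc_rback) simp

lemma close_rback_case_nat:
  "x \<notin> \<nu> ` (Suc -` fvl b) \<Longrightarrow>
    close_trm 0 x (rback (Free \<circ> case_nat x \<nu>) b) = rback (hup (Free \<circ> \<nu>)) b"
  by (rule close_rback) (auto simp: hup_def image_iff split: nat.splits)

text \<open>The bound name only has to differ from the names that \<nu> gives to free indices of the
  body, since \<open>close_rback\<close> compares heads at those indices alone.\<close>

lemma readback_simps:
  "readback \<nu> (DVar n) = TVar (\<nu> n) LNil"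
  "readback \<nu> (DSort s) = TSort s"
  "x \<notin> \<nu> ` (Suc -` fvl b) \<Longrightarrow> readback \<nu> (DPi a b) = TPi x (readback \<nu> a) (readback (case_nat x \<nu>) b)"
  "x \<notin> \<nu> ` (Suc -` fvl b) \<Longrightarrow> readback \<nu> (DLam a b) = TLam x (readback \<nu> a) (readback (case_nat x \<nu>) b)"
  "readback \<nu> (DApp a b) = TCut (readback \<nu> a) (LCons (readback \<nu> b) LNil)"
  by (transfer; simp add: close_rback_case_nat)+

lemma finite_fvl: "finite (fvl t)"
proof (induction t)
  case (DPi a b) then show ?case by (simp add: finite_vimageI)
next
  case (DLam a b) then show ?case by (simp add: finite_vimageI)
qed auto

lemma finite_under_binder: "finite (\<nu> ` (Suc -` fvl t))"
  by (simp add: finite_fvl finite_vimageI)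

lemma obtain_fresh:
  assumes "finite (X :: nat set)"
  obtains x where "x \<notin> X"
  using ex_new_if_finite[OF infinite_UNIV_nat assms] by blast

lemma back_lren: "readback \<nu> (lren r t) = readback (\<nu> \<circ> r) t"
proof (induction t arbitrary: \<nu> r)
  have *: "case_nat x \<nu> \<circ> case_nat 0 (Suc \<circ> r) = case_nat x (\<nu> \<circ> r)" for x :: var and \<nu> r
    by (auto simp: fun_eq_iff split: nat.split)
  {
    case (DPi a b)
    obtain x where "x \<notin> \<nu> ` (Suc -` fvl (lren (case_nat 0 (Suc \<circ> r)) b)) \<union> (\<nu> \<circ> r) ` (Suc -` fvl b)"
      using obtain_fresh[OF finite_UnI[OF finite_under_binder finite_under_binder]] by blast
    then have x: "x \<notin> \<nu> ` (Suc -` fvl (lren (case_nat 0 (Suc \<circ> r)) b))" "x \<notin> (\<nu> \<circ> r) ` (Suc -` fvl b)"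
      by blast+
    show ?case
      by (simp only: lren.simps readback_simps(3)[OF x(1)] readback_simps(3)[OF x(2)] DPi.IH *)
  next
    case (DLam a b)
    obtain x where "x \<notin> \<nu> ` (Suc -` fvl (lren (case_nat 0 (Suc \<circ> r)) b)) \<union> (\<nu> \<circ> r) ` (Suc -` fvl b)"
      using obtain_fresh[OF finite_UnI[OF finite_under_binder finite_under_binder]] by blast
    then have x: "x \<notin> \<nu> ` (Suc -` fvl (lren (case_nat 0 (Suc \<circ> r)) b))" "x \<notin> (\<nu> \<circ> r) ` (Suc -` fvl b)"
      by blast+
    show ?case
      by (simp only: lren.simps readback_simps(4)[OF x(1)] readback_simps(4)[OF x(2)] DLam.IH *)
  }
qed (simp_all add: readback_simps)

section \<open>Congruence of conversion and execution of substitutions\<close>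

abbreviation conv_lst :: "'s lst \<Rightarrow> 's lst \<Rightarrow> bool" where
  "conv_lst \<equiv> equivclp red_lst"

lemma conv_TPi: "conv A A' \<Longrightarrow> conv B B' \<Longrightarrow> conv (TPi x A B) (TPi x A' B')"
  by (rule equivclp_map2[of red_trm red_trm _ red_trm])
    (auto intro!: r_into_equivclp intro: ctx_pi1 ctx_pi2)

lemma conv_TLam: "conv A A' \<Longrightarrow> conv M M' \<Longrightarrow> conv (TLam x A M) (TLam x A' M')"
  by (rule equivclp_map2[of red_trm red_trm _ red_trm])
    (auto intro!: r_into_equivclp intro: ctx_lam1 ctx_lam2)

lemma conv_TVar: "conv_lst l l' \<Longrightarrow> conv (TVar x l) (TVar x l')"
  by (rule equivclp_map[of red_lst]) (auto intro!: r_into_equivclp intro: ctx_var)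

lemma conv_TCut: "conv M M' \<Longrightarrow> conv_lst l l' \<Longrightarrow> conv (TCut M l) (TCut M' l')"
  by (rule equivclp_map2[of red_trm red_trm _ red_lst])
    (auto intro!: r_into_equivclp intro: ctx_cut1 ctx_cut2)

lemma conv_TSub:
  assumes "conv N N'" "conv A A'" "conv M M'"
  shows "conv (TSub x N A M) (TSub x N' A' M')"
proof -
  have "conv (TSub x N A M) (TSub x N' A M)"
    by (rule equivclp_map[OF _ assms(1)]) (auto intro!: r_into_equivclp intro: ctx_sub1)
  also have "conv \<dots> (TSub x N' A' M')"
    by (rule equivclp_map2[OF _ _ assms(2,3)])
      (auto intro!: r_into_equivclp intro: ctx_sub2 ctx_sub3)
  finally show ?thesis .
qed

lemma conv_LCons: "conv M M' \<Longrightarrow> conv_lst l l' \<Longrightarrow> conv_lst (LCons M l) (LCons M' l')"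
  by (rule equivclp_map2[of red_trm red_lst _ red_lst])
    (auto intro!: r_into_equivclp intro: ctx_cons1 ctx_cons2)

lemma conv_LApp: "conv_lst l l' \<Longrightarrow> conv_lst m m' \<Longrightarrow> conv_lst (LApp l m) (LApp l' m')"
  by (rule equivclp_map2[of red_lst red_lst _ red_lst])
    (auto intro!: r_into_equivclp intro: ctx_app1 ctx_app2)

lemma conv_LSub: "conv N N' \<Longrightarrow> conv_lst l l' \<Longrightarrow> conv_lst (LSub x N A l) (LSub x N' A l')"
  by (rule equivclp_map2[of red_trm red_lst _ red_lst])
    (auto intro!: r_into_equivclp intro: ctx_subl1 ctx_subl3)

text \<open>Going below a binder replaces \<open>\<sigma>\<close> by \<open>up \<sigma>\<close>, so the statement has to allow \<open>\<sigma>\<close> to shift the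
  other indices; \<open>\<nu>'\<close> and \<open>\<nu>\<close> name the indices before and after the substitution.\<close>

lemma conv_sub_back:
  assumes "\<And>i. i \<in> fvl t \<Longrightarrow>
    \<nu>' i = x \<and> conv P (readback \<nu> (\<sigma> i)) \<or> \<nu>' i \<noteq> x \<and> (\<exists>k. \<sigma> i = DVar k \<and> \<nu> k = \<nu>' i)"
  shows "conv (TSub x P A (readback \<nu>' t)) (readback \<nu> (lsub \<sigma> t))"
  using assms
proof (induction t arbitrary: \<nu> \<nu>' \<sigma>)
  have fresh: "\<exists>z. z \<noteq> x \<and> z \<notin> fv_trm P \<and> z \<notin> fv_trm A \<and> z \<notin> \<nu>' ` (Suc -` fvl b) \<and>
     z \<notin> \<nu> ` (Suc -` fvl (lsub (up \<sigma>) b))" for \<nu> \<nu>' \<sigma> and b :: "'a lam"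
  proof -
    have "finite ({x} \<union> fv_trm P \<union> fv_trm A \<union> \<nu>' ` (Suc -` fvl b) \<union> \<nu> ` (Suc -` fvl (lsub (up \<sigma>) b)))"
      by (intro finite_UnI finite_under_binder) simp_all
    then obtain z where "z \<notin> {x} \<union> fv_trm P \<union> fv_trm A \<union> \<nu>' ` (Suc -` fvl b) \<union>
        \<nu> ` (Suc -` fvl (lsub (up \<sigma>) b))"
      by (rule obtain_fresh)
    then show ?thesis by (intro exI[of _ z]) simp
  qed
  \<comment> \<open>Index 0 is untouched because its name \<open>z\<close> differs from
    \<open>x\<close>. At a successor both alternatives survive the shift, as
    \<open>case_nat z \<nu>\<close> cancels it on reading back.\<close>
  have under: "case_nat z \<nu>' i = x \<and> conv P (readback (case_nat z \<nu>) (up \<sigma> i)) \<or>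
      case_nat z \<nu>' i \<noteq> x \<and> (\<exists>k. up \<sigma> i = DVar k \<and> case_nat z \<nu> k = case_nat z \<nu>' i)"
    if "\<And>i. i \<in> Suc -` S \<Longrightarrow>
      \<nu>' i = x \<and> conv P (readback \<nu> (\<sigma> i)) \<or> \<nu>' i \<noteq> x \<and> (\<exists>k. \<sigma> i = DVar k \<and> \<nu> k = \<nu>' i)"
      and "z \<noteq> x" "i \<in> S" for z \<nu> \<nu>' \<sigma> i S
  proof (cases i)
    case 0
    then show ?thesis using that(2) by simp
  next
    case (Suc j)
    have "readback (case_nat z \<nu>) (lren Suc t) = readback \<nu> t" for t :: "'a lam"
      by (simp add: back_lren comp_def)
    moreover have "\<nu>' j = x \<and> conv P (readback \<nu> (\<sigma> j)) \<or>
        \<nu>' j \<noteq> x \<and> (\<exists>k. \<sigma> j = DVar k \<and> \<nu> k = \<nu>' j)"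
      by (rule that(1)) (use that(3) Suc in simp)
    ultimately show ?thesis using Suc by fastforce
  qed
  {
    case (DVar i)
    show ?case
    proof (cases "\<nu>' i = x")
      case True
      have "conv (TSub x P A (TVar x LNil)) (TCut P (LSub x P A LNil))"
        by (rule r_into_equivclp, rule sub_var_same)
      also have "conv \<dots> (TCut P LNil)"
        by (rule r_into_equivclp, rule ctx_cut2, rule sub_nil)
      also have "conv \<dots> P" by (rule r_into_equivclp, rule cut_nil)
      also have "conv P (readback \<nu> (\<sigma> i))" using DVar True by simp
      finally show ?thesis using True by (simp add: readback_simps)
    next
      case False
      have "conv (TSub x P A (TVar (\<nu>' i) LNil)) (TVar (\<nu>' i) (LSub x P A LNil))"
        by (rule r_into_equivclp, rule sub_var_other, rule False)
      also have "conv \<dots> (TVar (\<nu>' i) LNil)"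
        by (rule r_into_equivclp, rule ctx_var, rule sub_nil)
      finally show ?thesis using False DVar by (auto simp: readback_simps)
    qed
  next
    case (DSort s)
    show ?case by (simp add: readback_simps) (rule r_into_equivclp, rule sub_sort)
  next
    case (DPi a b)
    obtain z where z: "z \<noteq> x" "z \<notin> fv_trm P" "z \<notin> fv_trm A" "z \<notin> \<nu>' ` (Suc -` fvl b)"
      "z \<notin> \<nu> ` (Suc -` fvl (lsub (up \<sigma>) b))" using fresh by blast
    have "conv (TSub x P A (readback \<nu>' (DPi a b)))
        (TPi z (TSub x P A (readback \<nu>' a)) (TSub x P A (readback (case_nat z \<nu>') b)))"
      unfolding readback_simps(3)[OF z(4)] by (rule r_into_equivclp, rule sub_pi) (use z in auto)
    also have "conv \<dots> (TPi z (readback \<nu> (lsub \<sigma> a)) (readback (case_nat z \<nu>) (lsub (up \<sigma>) b)))"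
    proof (rule conv_TPi)
      show "conv (TSub x P A (readback \<nu>' a)) (readback \<nu> (lsub \<sigma> a))"
        by (rule DPi.IH(1), rule DPi.prems) simp
      show "conv (TSub x P A (readback (case_nat z \<nu>') b)) (readback (case_nat z \<nu>) (lsub (up \<sigma>) b))"
        by (rule DPi.IH(2), rule under[of "fvl b", OF _ z(1)], rule DPi.prems) simp_all
    qed
    finally show ?case using z by (simp add: readback_simps)
  next
    case (DLam a b)
    obtain z where z: "z \<noteq> x" "z \<notin> fv_trm P" "z \<notin> fv_trm A" "z \<notin> \<nu>' ` (Suc -` fvl b)"
      "z \<notin> \<nu> ` (Suc -` fvl (lsub (up \<sigma>) b))" using fresh by blast
    have "conv (TSub x P A (readback \<nu>' (DLam a b)))
        (TLam z (TSub x P A (readback \<nu>' a)) (TSub x P A (readback (case_nat z \<nu>') b)))"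
      unfolding readback_simps(4)[OF z(4)] by (rule r_into_equivclp, rule sub_lam) (use z in auto)
    also have "conv \<dots> (TLam z (readback \<nu> (lsub \<sigma> a)) (readback (case_nat z \<nu>) (lsub (up \<sigma>) b)))"
    proof (rule conv_TLam)
      show "conv (TSub x P A (readback \<nu>' a)) (readback \<nu> (lsub \<sigma> a))"
        by (rule DLam.IH(1), rule DLam.prems) simp
      show "conv (TSub x P A (readback (case_nat z \<nu>') b)) (readback (case_nat z \<nu>) (lsub (up \<sigma>) b))"
        by (rule DLam.IH(2), rule under[of "fvl b", OF _ z(1)], rule DLam.prems) simp_all
    qed
    finally show ?case using z by (simp add: readback_simps)
  next
    case (DApp a b)
    have "conv (TSub x P A (readback \<nu>' (DApp a b)))
        (TCut (TSub x P A (readback \<nu>' a)) (LSub x P A (LCons (readback \<nu>' b) LNil)))"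
      unfolding readback_simps by (rule r_into_equivclp, rule sub_cut)
    also have "conv \<dots>
        (TCut (TSub x P A (readback \<nu>' a)) (LCons (TSub x P A (readback \<nu>' b)) (LSub x P A LNil)))"
      by (rule r_into_equivclp, rule ctx_cut2, rule sub_cons)
    also have "conv \<dots> (TCut (TSub x P A (readback \<nu>' a)) (LCons (TSub x P A (readback \<nu>' b)) LNil))"
      by (rule r_into_equivclp, rule ctx_cut2, rule ctx_cons2, rule sub_nil)
    also have "conv \<dots> (TCut (readback \<nu> (lsub \<sigma> a)) (LCons (readback \<nu> (lsub \<sigma> b)) LNil))"
    proof (intro conv_TCut conv_LCons equivclp_refl)
      show "conv (TSub x P A (readback \<nu>' a)) (readback \<nu> (lsub \<sigma> a))"
        by (rule DApp.IH(1), rule DApp.prems) simp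
      show "conv (TSub x P A (readback \<nu>' b)) (readback \<nu> (lsub \<sigma> b))"
        by (rule DApp.IH(2), rule DApp.prems) simp
    qed
    finally show ?case by (simp add: readback_simps)
  }
qed

text \<open>The instance of \<open>conv_sub_back\<close> at the outermost level: freshness makes
  index 0 the only free index named \<open>x\<close>.\<close>

lemma conv_sub_readback_inst:
  assumes "x \<notin> \<nu> ` (Suc -` fvl t)" "conv P (readback \<nu> n)"
  shows "conv (TSub x P A (readback (case_nat x \<nu>) t)) (readback \<nu> (lsub (inst n) t))"
proof (rule conv_sub_back)
  fix i assume "i \<in> fvl t"
  with assms show "case_nat x \<nu> i = x \<and> conv P (readback \<nu> (inst n i)) \<or>
    case_nat x \<nu> i \<noteq> x \<and> (\<exists>k. inst n i = DVar k \<and> \<nu> k = case_nat x \<nu> i)"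
    by (cases i) auto
qed

text \<open>A contraction is simulated by \<open>beta\<close>, then \<open>cut_nil\<close>, then
  execution of the new substitution. The annotation of the abstraction survives the first two steps
  and vanishes in the third.\<close>

lemma par_conv_back: "par t t' \<Longrightarrow> conv (readback \<nu> t) (readback \<nu> t')"
proof (induction arbitrary: \<nu> rule: par.induct)
  {
    case (par_pi a a' b b')
    obtain x where "x \<notin> \<nu> ` (Suc -` fvl b) \<union> \<nu> ` (Suc -` fvl b')"
      using obtain_fresh[OF finite_UnI[OF finite_under_binder finite_under_binder]] by blast
    then show ?case using par_pi.IH by (auto simp: readback_simps(3)[of x] intro!: conv_TPi)
  next
    case (par_lam a a' b b')
    obtain x where "x \<notin> \<nu> ` (Suc -` fvl b) \<union> \<nu> ` (Suc -` fvl b')"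
      using obtain_fresh[OF finite_UnI[OF finite_under_binder finite_under_binder]] by blast
    then show ?case using par_lam.IH by (auto simp: readback_simps(4)[of x] intro!: conv_TLam)
  next
    case (par_app a a' b b')
    then show ?case by (simp add: readback_simps conv_TCut conv_LCons)
  next
    case (par_beta m m' n n' a)
    obtain x where x: "x \<notin> \<nu> ` (Suc -` fvl m) \<union> \<nu> ` (Suc -` fvl m')"
      using obtain_fresh[OF finite_UnI[OF finite_under_binder finite_under_binder]] by blast
    have "conv (readback \<nu> (DApp (DLam a m) n))
        (TCut (TLam x (readback \<nu> a) (readback (case_nat x \<nu>) m)) (LCons (readback \<nu> n) LNil))"
      using x by (simp add: readback_simps(4)[of x] readback_simps(5))
    also have "conv \<dots> (TCut (TSub x (readback \<nu> n) (readback \<nu> a) (readback (case_nat x \<nu>) m)) LNil)"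
      by (rule r_into_equivclp, rule beta)
    also have "conv \<dots> (TSub x (readback \<nu> n) (readback \<nu> a) (readback (case_nat x \<nu>) m))"
      by (rule r_into_equivclp, rule cut_nil)
    also have "conv \<dots> (TSub x (readback \<nu> n') (readback \<nu> a) (readback (case_nat x \<nu>) m'))"
      by (intro conv_TSub par_beta.IH equivclp_refl)
    also have "conv \<dots> (readback \<nu> (lsub (inst n') m'))"
      using x by (intro conv_sub_readback_inst) auto
    finally show ?case .
  }
qed (auto simp: readback_simps)

lemma lam_eq_conv_back: "t \<approx> t' \<Longrightarrow> conv (readback \<nu> t) (readback \<nu> t')"
  by (erule equivclp_map[rotated]) (rule par_conv_back)

definition readback_lst :: "(nat \<Rightarrow> var) \<Rightarrow> 's lam list \<Rightarrow> 's lst" where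
  "readback_lst \<nu> ts = foldr (\<lambda>t. LCons (readback \<nu> t)) ts LNil"

lemma readback_lst_simps [simp]:
  "readback_lst \<nu> [] = LNil" "readback_lst \<nu> (t # ts) = LCons (readback \<nu> t) (readback_lst \<nu> ts)"
  by (simp_all add: readback_lst_def)

lemma conv_readback_append:
  "conv_lst (LApp (readback_lst \<nu> ts) (readback_lst \<nu> us)) (readback_lst \<nu> (ts @ us))"
proof (induction ts)
  case Nil
  show ?case by simp (rule r_into_equivclp, rule app_nil_left)
next
  case (Cons t ts)
  have "conv_lst (LApp (LCons (readback \<nu> t) (readback_lst \<nu> ts)) (readback_lst \<nu> us))
    (LCons (readback \<nu> t) (LApp (readback_lst \<nu> ts) (readback_lst \<nu> us)))"
    by (rule r_into_equivclp, rule app_cons)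
  also have "conv_lst \<dots> (LCons (readback \<nu> t) (readback_lst \<nu> (ts @ us)))"
    by (intro conv_LCons equivclp_refl Cons.IH)
  finally show ?case by simp
qed

text \<open>Readback nests cuts with one-element lists where the source has a single list;
  \<open>cut_cut\<close> and the rules for \<open>LApp\<close> merge the nested cuts, and the chain
  is then read backwards.\<close>

lemma conv_readback_apps: "conv (TCut (readback \<nu> t) (readback_lst \<nu> ts)) (readback \<nu> (apps t ts))"
proof (induction ts arbitrary: t)
  case Nil
  show ?case by simp (rule r_into_equivclp, rule cut_nil)
next
  case (Cons u ts)
  let ?t = "readback \<nu> t" and ?u = "readback \<nu> u" and ?ts = "readback_lst \<nu> ts"
  have "conv (TCut (TCut ?t (LCons ?u LNil)) ?ts) (TCut ?t (LApp (LCons ?u LNil) ?ts))"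
    by (rule r_into_equivclp, rule cut_cut)
  also have "conv \<dots> (TCut ?t (LCons ?u (LApp LNil ?ts)))"
    by (rule r_into_equivclp, rule ctx_cut2, rule app_cons)
  also have "conv \<dots> (TCut ?t (LCons ?u ?ts))"
    by (rule r_into_equivclp, rule ctx_cut2, rule ctx_cons2, rule app_nil_left)
  finally have "conv (TCut ?t (LCons ?u ?ts)) (TCut (TCut ?t (LCons ?u LNil)) ?ts)"
    by (rule equivclp_sym)
  also have "conv \<dots> (readback \<nu> (apps (DApp t u) ts))"
    using Cons.IH[of "DApp t u"] by (simp add: readback_simps)
  finally show ?case by simp
qed

lemma conv_lsub_readback_inst:
  assumes "\<And>t. t \<in> set ts \<Longrightarrow> x \<notin> \<nu> ` (Suc -` fvl t)" "conv P (readback \<nu> n)"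
  shows "conv_lst (LSub x P A (readback_lst (case_nat x \<nu>) ts)) (readback_lst \<nu> (map (lsub (inst n)) ts))"
  using assms(1)
proof (induction ts)
  case Nil
  show ?case by simp (rule r_into_equivclp, rule sub_nil)
next
  case (Cons t ts)
  have "conv_lst (LSub x P A (readback_lst (case_nat x \<nu>) (t # ts)))
    (LCons (TSub x P A (readback (case_nat x \<nu>) t)) (LSub x P A (readback_lst (case_nat x \<nu>) ts)))"
    by simp (rule r_into_equivclp, rule sub_cons)
  also have "conv_lst \<dots> (LCons (readback \<nu> (lsub (inst n) t)) (readback_lst \<nu> (map (lsub (inst n)) ts)))"
    by (intro conv_LCons conv_sub_readback_inst Cons.IH assms(2)) (use Cons.prems in auto)
  finally show ?case by simp
qed

lemma fvl_lren: "fvl (lren r t) = r ` fvl t"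
proof (induction t arbitrary: r)
  have *: "Suc -` case_nat 0 (Suc \<circ> r) ` S = r ` Suc -` S" for r S
  proof (intro set_eqI iffI)
    fix n assume "n \<in> Suc -` case_nat 0 (Suc \<circ> r) ` S"
    then obtain i where i: "i \<in> S" "Suc n = case_nat 0 (Suc \<circ> r) i" by auto
    then obtain j where "i = Suc j" by (cases i) auto
    with i show "n \<in> r ` Suc -` S" by auto
  next
    fix n assume "n \<in> r ` Suc -` S"
    then obtain j where "Suc j \<in> S" "n = r j" by auto
    then show "n \<in> Suc -` case_nat 0 (Suc \<circ> r) ` S"
      by (auto intro!: image_eqI[of _ _ "Suc j"])
  qed
  {
    case (DPi a b) then show ?case by (simp add: * image_Un)
  next
    case (DLam a b) then show ?case by (simp add: * image_Un)
  }
qed auto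

lemma fvl_apps: "fvl (apps t ts) = fvl t \<union> (\<Union>u\<in>set ts. fvl u)"
  by (induction ts arbitrary: t) auto

text \<open>Lets freshness of a bound name for a readback body be decided from the environment and
  the free variables of the source.\<close>

lemma fvl_den:
  fixes M :: "'s trm" and l :: "'s lst"
  shows "fvl (den_trm \<rho> M) \<subseteq> (\<Union>y\<in>fv_trm M. fvl (\<rho> y))"
    "t \<in> set (den_lst \<tau> l) \<Longrightarrow> fvl t \<subseteq> (\<Union>y\<in>fv_lst l. fvl (\<tau> y))"
proof (induction M and l arbitrary: \<rho> and \<tau> t rule: trm_induct)
  have upd: "(\<Union>y\<in>S. fvl ((\<rho>(x := n)) y)) \<subseteq> fvl n \<union> (\<Union>y\<in>S - {x}. fvl (\<rho> y))"
    for S x n and \<rho> :: "var \<Rightarrow> 's lam"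
    by (auto split: if_splits)
  have under: "Suc -` fvl (den_trm (benv x \<rho>) B) \<subseteq> (\<Union>y\<in>fv_trm B - {x}. fvl (\<rho> y))"
    if "fvl (den_trm (benv x \<rho>) B) \<subseteq> (\<Union>y\<in>fv_trm B. fvl (benv x \<rho> y))" for x \<rho> and B :: "'s trm"
  proof
    fix n assume "n \<in> Suc -` fvl (den_trm (benv x \<rho>) B)"
    with that obtain y where y: "y \<in> fv_trm B" "Suc n \<in> fvl (benv x \<rho> y)" by blast
    then show "n \<in> (\<Union>y\<in>fv_trm B - {x}. fvl (\<rho> y))"
      by (cases "y = x") (auto simp: fvl_lren)
  qed
  {
    case (TPi x A B)
    show ?case unfolding den_simps fvl.simps fv_simps UN_Un
      by (rule Un_mono TPi.IH under)+
  next
    case (TLam x A B)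
    show ?case unfolding den_simps fvl.simps fv_simps UN_Un
      by (rule Un_mono TLam.IH under)+
  next
    case (TVar x l)
    show ?case unfolding den_simps fvl_apps fv_simps UN_insert
      by (rule Un_mono order_refl UN_least TVar.IH)+
  next
    case (TCut M l)
    show ?case unfolding den_simps fvl_apps fv_simps UN_Un
      by (rule Un_mono UN_least TCut.IH)+
  next
    case (TSub x N A M)
    show ?case
      using TSub.IH(1)[of \<rho>] subset_trans[OF TSub.IH(3)[of "\<rho>(x := den_trm \<rho> N)"] upd]
      unfolding den_simps fv_simps UN_Un by blast
  next
    case (LSub x N A l)
    show ?case
      using LSub.IH(1)[of \<tau>] LSub.prems
        subset_trans[OF LSub.IH(3)[of t "\<tau>(x := den_trm \<tau> N)"] upd]
      unfolding den_simps fv_simps UN_Un by blast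
  next
    case (LCons M l)
    from LCons.prems consider "t = den_trm \<tau> M" | "t \<in> set (den_lst \<tau> l)" by auto
    then show ?case
    proof cases
      case 1
      show ?thesis unfolding fv_simps UN_Un 1 by (rule le_supI1 LCons.IH)+
    next
      case 2
      show ?thesis unfolding fv_simps UN_Un by (rule le_supI2 LCons.IH 2)+
    qed
  next
    case (LApp l l')
    from LApp.prems consider "t \<in> set (den_lst \<tau> l)" | "t \<in> set (den_lst \<tau> l')" by auto
    then show ?case
    proof cases
      case 1
      show ?thesis unfolding fv_simps UN_Un by (rule le_supI1 LApp.IH(1) 1)+
    next
      case 2
      show ?thesis unfolding fv_simps UN_Un by (rule le_supI2 LApp.IH(2) 2)+
    qed
  }
qed simp_all

text \<open>On \<open>S\<close>, the naming \<nu> undoes the interpretation \<rho>, so that reading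
  back returns every variable to itself.\<close>

definition rep_env :: "(nat \<Rightarrow> var) \<Rightarrow> (var \<Rightarrow> 's lam) \<Rightarrow> var set \<Rightarrow> bool" where
  "rep_env \<nu> \<rho> S \<longleftrightarrow> (\<forall>y\<in>S. \<exists>i. \<rho> y = DVar i \<and> \<nu> i = y)"

lemma rep_env_benv: "rep_env \<nu> \<rho> (S - {x}) \<Longrightarrow> rep_env (case_nat x \<nu>) (benv x \<rho>) S"
  unfolding rep_env_def
proof
  fix y assume *: "\<forall>y\<in>S - {x}. \<exists>i. \<rho> y = DVar i \<and> \<nu> i = y" "y \<in> S"
  show "\<exists>i. benv x \<rho> y = DVar i \<and> case_nat x \<nu> i = y"
  proof (cases "y = x")
    case True
    then show ?thesis by (intro exI[of _ 0]) simp
  next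
    case False
    with * obtain i where "\<rho> y = DVar i" "\<nu> i = y" by blast
    with False show ?thesis by (intro exI[of _ "Suc i"]) simp
  qed
qed

text \<open>A nonzero free index of \<open>t\<close> stems from a variable of \<open>S\<close> other
  than \<open>x\<close>, and \<nu> names it by that variable.\<close>

lemma rep_env_fresh:
  assumes "rep_env \<nu> \<rho> (S - {x})" "fvl t \<subseteq> (\<Union>y\<in>S. fvl (benv x \<rho> y))"
  shows "x \<notin> \<nu> ` (Suc -` fvl t)"
proof
  assume "x \<in> \<nu> ` (Suc -` fvl t)"
  then obtain n where n: "x = \<nu> n" "Suc n \<in> fvl t" by blast
  with assms(2) obtain y where y: "y \<in> S" "Suc n \<in> fvl (benv x \<rho> y)" by blast
  then have "y \<noteq> x" "n \<in> fvl (\<rho> y)" by (cases "y = x"; auto simp: fvl_lren)+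
  moreover from this assms(1) y obtain i where "\<rho> y = DVar i" "\<nu> i = y"
    unfolding rep_env_def by blast
  ultimately show False using n by simp
qed

text \<open>The body of a substitution is treated as if it stood below a binder: it becomes a
  readback, which contains no substitutions, and \<open>conv_sub_readback_inst\<close> can execute
  the outer one. This is how nested substitutions are resolved without a rule that permutes
  them.\<close>

lemma conv_readback_den:
  fixes M :: "'s trm" and l :: "'s lst"
  shows "rep_env \<nu> \<rho> (fv_trm M) \<Longrightarrow> conv M (readback \<nu> (den_trm \<rho> M))"
    "rep_env \<nu>' \<tau> (fv_lst l) \<Longrightarrow> conv_lst l (readback_lst \<nu>' (den_lst \<tau> l))"
proof (induction M and l arbitrary: \<nu> \<rho> and \<nu>' \<tau> rule: trm_induct)
  case (TPi x A B)
  have *: "rep_env \<nu> \<rho> (fv_trm A)" "rep_env \<nu> \<rho> (fv_trm B - {x})"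
    using TPi.prems by (auto simp: rep_env_def)
  have "conv (TPi x A B)
      (TPi x (readback \<nu> (den_trm \<rho> A)) (readback (case_nat x \<nu>) (den_trm (benv x \<rho>) B)))"
    by (intro conv_TPi TPi.IH rep_env_benv *)
  then show ?case
    using rep_env_fresh[OF *(2) fvl_den(1)] by (simp add: readback_simps)
next
  case (TLam x A B)
  have *: "rep_env \<nu> \<rho> (fv_trm A)" "rep_env \<nu> \<rho> (fv_trm B - {x})"
    using TLam.prems by (auto simp: rep_env_def)
  have "conv (TLam x A B)
      (TLam x (readback \<nu> (den_trm \<rho> A)) (readback (case_nat x \<nu>) (den_trm (benv x \<rho>) B)))"
    by (intro conv_TLam TLam.IH rep_env_benv *)
  then show ?case
    using rep_env_fresh[OF *(2) fvl_den(1)] by (simp add: readback_simps)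
next
  case (TSort s)
  then show ?case by (simp add: readback_simps)
next
  case (TVar x l)
  then obtain i where i: "\<rho> x = DVar i" "\<nu> i = x" "rep_env \<nu> \<rho> (fv_lst l)"
    by (auto simp: rep_env_def)
  let ?l = "readback_lst \<nu> (den_lst \<rho> l)"
  have "conv (TCut (TVar x LNil) ?l) (TVar x (LApp LNil ?l))"
    by (rule r_into_equivclp, rule cut_var)
  also have "conv \<dots> (TVar x ?l)"
    by (rule r_into_equivclp, rule ctx_var, rule app_nil_left)
  also have "conv \<dots> (TVar x l)"
    by (rule conv_TVar, rule equivclp_sym, rule TVar.IH, rule i)
  finally have "conv (TVar x l) (TCut (TVar x LNil) ?l)" by (rule equivclp_sym)
  also have "conv \<dots> (readback \<nu> (apps (DVar i) (den_lst \<rho> l)))"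
    using conv_readback_apps[of \<nu> "DVar i"] i by (simp add: readback_simps)
  finally show ?case by (simp add: i)
next
  case (TCut M l)
  have "conv (TCut M l) (TCut (readback \<nu> (den_trm \<rho> M)) (readback_lst \<nu> (den_lst \<rho> l)))"
    by (intro conv_TCut TCut.IH) (use TCut.prems in \<open>auto simp: rep_env_def\<close>)
  also have "conv \<dots> (readback \<nu> (apps (den_trm \<rho> M) (den_lst \<rho> l)))" by (rule conv_readback_apps)
  finally show ?case by simp
next
  case (TSub x N A M)
  have *: "rep_env \<nu> \<rho> (fv_trm N)" "rep_env \<nu> \<rho> (fv_trm M - {x})"
    using TSub.prems by (auto simp: rep_env_def)
  let ?n = "den_trm \<rho> N" and ?m = "den_trm (benv x \<rho>) M"
  have "conv (TSub x N A M) (TSub x (readback \<nu> ?n) A (readback (case_nat x \<nu>) ?m))"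
    by (intro conv_TSub TSub.IH rep_env_benv * equivclp_refl)
  also have "conv \<dots> (readback \<nu> (lsub (inst ?n) ?m))"
    by (intro conv_sub_readback_inst rep_env_fresh[OF *(2) fvl_den(1)] equivclp_refl)
  finally show ?case by (simp add: lsub_inst_den)
next
  case LNil
  then show ?case by simp
next
  case (LCons M l)
  show ?case
    by simp (intro conv_LCons LCons.IH; use LCons.prems in \<open>auto simp: rep_env_def\<close>)
next
  case (LApp l m)
  have "conv_lst (LApp l m) (LApp (readback_lst \<nu>' (den_lst \<tau> l)) (readback_lst \<nu>' (den_lst \<tau> m)))"
    by (intro conv_LApp LApp.IH) (use LApp.prems in \<open>auto simp: rep_env_def\<close>)
  also have "conv_lst \<dots> (readback_lst \<nu>' (den_lst \<tau> l @ den_lst \<tau> m))" by (rule conv_readback_append)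
  finally show ?case by simp
next
  case (LSub x N A l)
  have *: "rep_env \<nu>' \<tau> (fv_trm N)" "rep_env \<nu>' \<tau> (fv_lst l - {x})"
    using LSub.prems by (auto simp: rep_env_def)
  let ?n = "den_trm \<tau> N" and ?m = "den_lst (benv x \<tau>) l"
  have "conv_lst (LSub x N A l) (LSub x (readback \<nu>' ?n) A (readback_lst (case_nat x \<nu>') ?m))"
    by (intro conv_LSub LSub.IH rep_env_benv *)
  also have "conv_lst \<dots> (readback_lst \<nu>' (map (lsub (inst ?n)) ?m))"
    by (intro conv_lsub_readback_inst rep_env_fresh[OF *(2) fvl_den(2)] equivclp_refl)
  finally show ?case by (simp add: lsub_inst_den)
qed

text \<open>Names and indices are both natural numbers, so \<open>DVar\<close> as environment and
  \<open>id\<close> as naming represent every variable at once; each term is then convertible to the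
  readback of its denotation.\<close>

lemma conv_iff: "conv M M' \<longleftrightarrow> den_trm DVar M \<approx> den_trm DVar M'"
proof
  have *: "conv N (readback id (den_trm DVar N))" for N :: "'a trm"
    by (rule conv_readback_den) (simp add: rep_env_def)
  assume "den_trm DVar M \<approx> den_trm DVar M'"
  then have "conv (readback id (den_trm DVar M)) (readback id (den_trm DVar M'))" by (rule lam_eq_conv_back)
  with * have "conv M (readback id (den_trm DVar M'))" by (rule equivclp_trans)
  with * show "conv M M'" by (metis equivclp_trans equivclp_sym)
qed (rule conv_lam_eq)

lemma conv_pi:
  assumes "conv (TPi x A B) (TPi x A' B')"
  shows "conv A A'" "conv B B'"
proof -
  have "DPi (den_trm DVar A) (den_trm (benv x DVar) B) \<approx> DPi (den_trm DVar A') (den_trm (benv x DVar) B')"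
    using assms by (simp add: conv_iff)
  note * = lam_eq_pi[OF this]
  from *(1) show "conv A A'" by (simp add: conv_iff)
  \<comment> \<open>The equation obtained for the codomains holds below the binder; putting the name
    \<open>x\<close> back for index 0 returns it to the environment \<open>DVar\<close>.\<close>
  have "lsub (inst (DVar x)) (den_trm (benv x DVar) C) = den_trm DVar C" for C :: "'a trm"
    by (simp add: lsub_inst_den)
  with lam_eq_lsub[OF *(2)] show "conv B B'" by (metis conv_iff)
qed

lemma conv_sub_fresh: "x \<notin> fv_trm M \<Longrightarrow> conv (TSub x P A M) M"
proof -
  assume "x \<notin> fv_trm M"
  then have "den_trm (DVar(x := den_trm DVar P)) M = den_trm DVar M" by (intro den_cong) auto
  then show ?thesis by (simp add: conv_iff)
qed

text \<open>The substitution lemma. Both sides denote \<open>D\<close> in the same environment: two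
  distinct names are updated in either order, and the meaning of \<open>P\<close> is independent of
  \<open>x\<close>. The annotation \<open>A'\<close> is free because the denotation forgets
  it.\<close>

lemma conv_sub_sub:
  assumes "x \<noteq> y" "x \<notin> fv_trm P"
  shows "conv (TSub y P G (TSub x M A D)) (TSub x (TSub y P G M) A' (TSub y P G D))"
proof -
  have "den_trm (DVar(x := n)) P = den_trm DVar P" for n
    using assms(2) by (intro den_cong) auto
  then show ?thesis using assms(1) by (simp add: conv_iff fun_upd_twist)
qed

section \<open>Equivariance\<close>

text \<open>The action on names behind \<open>swap_head\<close>. A swap is a bijection, hence it
  respects freshness and distinctness of names; a plain renaming could identify two of them.\<close>

definition sw :: "var \<Rightarrow> var \<Rightarrow> var \<Rightarrow> var" where
  "sw a b z = (if z = a then b else if z = b then a else z)"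

lemma sw_sw [simp]: "sw a b (sw a b z) = z"
  by (auto simp: sw_def)

lemma sw_inject [simp]: "sw a b x = sw a b y \<longleftrightarrow> x = y"
  by (auto simp: sw_def)

lemma sw_simps [simp]: "sw a b a = b" "sw a b b = a" "z \<noteq> a \<Longrightarrow> z \<noteq> b \<Longrightarrow> sw a b z = z"
  by (auto simp: sw_def)

lemma sw_image_iff [simp]: "sw a b x \<in> sw a b ` S \<longleftrightarrow> x \<in> S"
  by (auto simp: image_iff)

lemma close_head_sw: "close_head k (sw a b x) (swap_head a b h) = swap_head a b (close_head k x h)"
  by (cases h) (auto simp: sw_def)

lemma close_sw:
  fixes t :: "'s rtrm" and l :: "'s rlst"
  shows "close_trm k (sw a b x) (rswap_trm a b t) = rswap_trm a b (close_trm k x t)"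
    "close_lst k' (sw a b x) (rswap_lst a b l) = rswap_lst a b (close_lst k' x l)"
  by (induction t and l arbitrary: k and k') (simp_all add: close_head_sw)

lemma swap_simps [simp]:
  "swap_trm a b (TPi x A B) = TPi (sw a b x) (swap_trm a b A) (swap_trm a b B)"
  "swap_trm a b (TLam x A M) = TLam (sw a b x) (swap_trm a b A) (swap_trm a b M)"
  "swap_trm a b (TSort s) = TSort s"
  "swap_trm a b (TVar x l) = TVar (sw a b x) (swap_lst a b l)"
  "swap_trm a b (TCut M l) = TCut (swap_trm a b M) (swap_lst a b l)"
  "swap_trm a b (TSub x N A M) = TSub (sw a b x) (swap_trm a b N) (swap_trm a b A) (swap_trm a b M)"
  "swap_lst a b LNil = LNil"
  "swap_lst a b (LCons M l) = LCons (swap_trm a b M) (swap_lst a b l)"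
  "swap_lst a b (LApp l l') = LApp (swap_lst a b l) (swap_lst a b l')"
  "swap_lst a b (LSub x N A l) = LSub (sw a b x) (swap_trm a b N) (swap_trm a b A) (swap_lst a b l)"
  by (transfer; simp add: close_sw; simp add: sw_def)+

lemma swap_swap [simp]:
  fixes M :: "'s trm" and l :: "'s lst"
  shows "swap_trm a b (swap_trm a b M) = M" "swap_lst a b (swap_lst a b l) = l"
  by (induction M and l rule: trm_induct) simp_all

lemma fv_swap [simp]:
  fixes M :: "'s trm" and l :: "'s lst"
  shows "fv_trm (swap_trm a b M) = sw a b ` fv_trm M" "fv_lst (swap_lst a b l) = sw a b ` fv_lst l"
  by (induction M and l rule: trm_induct) (simp_all add: image_Un image_set_diff inj_def)

lemma swap_fresh:
  fixes M :: "'s trm" and l :: "'s lst"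
  shows "a \<notin> fv_trm M \<Longrightarrow> b \<notin> fv_trm M \<Longrightarrow> swap_trm a b M = M"
    "a \<notin> fv_lst l \<Longrightarrow> b \<notin> fv_lst l \<Longrightarrow> swap_lst a b l = l"
  by (induction M and l rule: trm_lst_induct[where X = "{a, b}"]) auto

lemma red_swap:
  fixes M M' :: "'s trm" and l l' :: "'s lst"
  shows "red_trm M M' \<Longrightarrow> red_trm (swap_trm a b M) (swap_trm a b M')"
    "red_lst l l' \<Longrightarrow> red_lst (swap_lst a b l) (swap_lst a b l')"
  by (induction rule: red_trm_red_lst.inducts) (simp_all add: red_trm_red_lst.intros)

lemma conv_swap: "conv M M' \<Longrightarrow> conv (swap_trm a b M) (swap_trm a b M')"
  by (erule equivclp_map[rotated]) (rule r_into_equivclp, rule red_swap)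

definition sw_env :: "var \<Rightarrow> var \<Rightarrow> 's env \<Rightarrow> 's env" where
  "sw_env a b \<Gamma> = map (\<lambda>(x, A). (sw a b x, swap_trm a b A)) \<Gamma>"

lemma sw_env_simps [simp]:
  "sw_env a b [] = []"
  "sw_env a b ((x, A) # \<Gamma>) = (sw a b x, swap_trm a b A) # sw_env a b \<Gamma>"
  "sw_env a b (\<Gamma> @ \<Delta>) = sw_env a b \<Gamma> @ sw_env a b \<Delta>"
  "sw_env a b (sw_env a b \<Gamma>) = \<Gamma>"
  by (auto simp: sw_env_def comp_def case_prod_unfold)

lemma in_sw_env: "(x, A) \<in> set \<Gamma> \<Longrightarrow> (sw a b x, swap_trm a b A) \<in> set (sw_env a b \<Gamma>)"
  by (force simp: sw_env_def)

lemma in_sw_envE: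
  assumes "(x, A) \<in> set (sw_env a b \<Gamma>)"
  obtains y B where "x = sw a b y" "A = swap_trm a b B" "(y, B) \<in> set \<Gamma>"
  using assms by (auto simp: sw_env_def)

lemma env_dom_simps [simp]:
  "env_dom [] = {}" "env_dom ((x, A) # \<Gamma>) = insert x (env_dom \<Gamma>)"
  "env_dom (\<Gamma> @ \<Delta>) = env_dom \<Gamma> \<union> env_dom \<Delta>" "finite (env_dom \<Gamma>)"
  by (auto simp: env_dom_def)

lemma env_dom_sub_env [simp]: "env_dom (sub_env x P A \<Gamma>) = env_dom \<Gamma>"
  by (induction \<Gamma>) (simp_all add: sub_env_def split: prod.split)

lemma env_dom_sw_env [simp]: "env_dom (sw_env a b \<Gamma>) = sw a b ` env_dom \<Gamma>"
  by (induction \<Gamma>) auto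

lemma env_domI: "(x, A) \<in> set \<Gamma> \<Longrightarrow> x \<in> env_dom \<Gamma>"
  by (force simp: env_dom_def)

lemma sw_sub_env: "sw_env a b (sub_env x P A \<Delta>) =
    sub_env (sw a b x) (swap_trm a b P) (swap_trm a b A) (sw_env a b \<Delta>)"
  by (simp add: sw_env_def sub_env_def case_prod_unfold)

lemma swap_range_TSort: "swap_trm a b C \<in> range TSort \<longleftrightarrow> C \<in> range TSort"
proof
  assume "swap_trm a b C \<in> range TSort"
  then obtain s where "swap_trm a b C = TSort s" by blast
  then have "swap_trm a b (swap_trm a b C) = TSort s" by (simp del: swap_swap)
  then show "C \<in> range TSort" by simp
qed auto

lemma sw_sub_type: "swap_trm a b (sub_type x P A C) =
    sub_type (sw a b x) (swap_trm a b P) (swap_trm a b A) (swap_trm a b C)"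
  by (simp add: sub_type_def swap_range_TSort)

lemma sw_sub_environment:
  assumes "\<Gamma> \<sqsubseteq> \<Delta>"
  shows "sw_env a b \<Gamma> \<sqsubseteq> sw_env a b \<Delta>"
  unfolding sub_environment_def
proof (intro allI impI)
  fix x A assume "(x, A) \<in> set (sw_env a b \<Gamma>)"
  then obtain y B where y: "x = sw a b y" "A = swap_trm a b B" "(y, B) \<in> set \<Gamma>" by (rule in_sw_envE)
  then obtain C where "(y, C) \<in> set \<Delta>" "conv B C" using assms unfolding sub_environment_def by blast
  with y show "\<exists>B. (x, B) \<in> set (sw_env a b \<Delta>) \<and> conv A B"
    by (blast intro: in_sw_env conv_swap)
qed

text \<open>Justifies replacing the bound names chosen by a derivation: swapping acts on every
  ingredient of a rule, including \<sqsubseteq> and the case distinction in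
  \<open>sub_type\<close>.\<close>

lemma typing_swap:
  fixes \<Gamma> :: "'s env" and M A :: "'s trm" and l :: "'s lst"
  shows "wf_env \<A> \<R> \<Gamma> \<Longrightarrow> wf_env \<A> \<R> (sw_env a b \<Gamma>)"
    "has_type \<A> \<R> \<Gamma> M A \<Longrightarrow> has_type \<A> \<R> (sw_env a b \<Gamma>) (swap_trm a b M) (swap_trm a b A)"
    "lst_type \<A> \<R> \<Gamma> B l C \<Longrightarrow>
      lst_type \<A> \<R> (sw_env a b \<Gamma>) (swap_trm a b B) (swap_lst a b l) (swap_trm a b C)"
proof (induction rule: wf_env_has_type_lst_type.inducts)
  case empty
  then show ?case by (simp add: wf_env_has_type_lst_type.empty)
next
  case (extend \<Gamma> A s x)
  then show ?case by (auto intro: wf_env_has_type_lst_type.extend)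
next
  case (sorted \<Gamma> s s')
  then show ?case by (auto intro: wf_env_has_type_lst_type.sorted)
next
  case (Pi_wf \<Gamma> A s1 x B s2 s3)
  then show ?case by (auto intro: wf_env_has_type_lst_type.Pi_wf)
next
  case (Pi_R \<Gamma> x A B s M)
  then show ?case by (auto intro: wf_env_has_type_lst_type.Pi_R)
next
  case (select \<Gamma> A l B x)
  then show ?case by (auto intro: wf_env_has_type_lst_type.select in_sw_env)
next
  case ("axiom" \<Gamma> A s)
  then show ?case by (auto intro: wf_env_has_type_lst_type.axiom)
next
  case (conv_R \<Gamma> M A B s)
  then show ?case by (auto intro: wf_env_has_type_lst_type.conv_R conv_swap)
next
  case (Pi_L \<Gamma> x A B s M l C)
  then show ?case by (auto intro: wf_env_has_type_lst_type.Pi_L)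
next
  case (conv_R' \<Gamma> C l A B s)
  then show ?case by (auto intro: wf_env_has_type_lst_type.conv_R' conv_swap)
next
  case (conv_L \<Gamma> A l C B s)
  then show ?case by (auto intro: wf_env_has_type_lst_type.conv_L conv_swap)
next
  case (Cut1 \<Gamma> C l' A l B)
  then show ?case by (auto intro: wf_env_has_type_lst_type.Cut1)
next
  case (Cut2 \<Gamma> P A x \<Delta> B l C \<Delta>')
  then show ?case
    using sw_sub_environment[OF Cut2.hyps(1), of a b]
    by (auto intro!: wf_env_has_type_lst_type.Cut2 simp: sw_sub_env)
next
  case (Cut3 \<Gamma> M A l B)
  then show ?case by (auto intro: wf_env_has_type_lst_type.Cut3)
next
  case (Cut4 \<Gamma> P A x \<Delta> M C \<Delta>')
  then show ?case
    using sw_sub_environment[OF Cut4.hyps(1), of a b]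
    by (auto intro!: wf_env_has_type_lst_type.Cut4 simp: sw_sub_env sw_sub_type)
qed


section \<open>Environments and free variables\<close>

lemma wf_of:
  fixes \<Gamma> :: "'s env" and M A :: "'s trm" and l :: "'s lst"
  shows "wf_env \<A> \<R> \<Gamma> \<Longrightarrow> True"
    "has_type \<A> \<R> \<Gamma> M A \<Longrightarrow> wf_env \<A> \<R> \<Gamma>"
    "lst_type \<A> \<R> \<Gamma> B l C \<Longrightarrow> wf_env \<A> \<R> \<Gamma>"
  by (induction rule: wf_env_has_type_lst_type.inducts) auto

lemma wf_snocE:
  assumes "wf_env \<A> \<R> (\<Gamma> @ [(x, A)])"
  obtains s where "has_type \<A> \<R> \<Gamma> A (TSort s)" "x \<notin> env_dom \<Gamma>"
  using assms by (cases rule: wf_env.cases) auto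

lemma wf_prefix: "wf_env \<A> \<R> (\<Gamma> @ \<Delta>) \<Longrightarrow> wf_env \<A> \<R> \<Gamma>"
proof (induction \<Delta> rule: rev_induct)
  case (snoc d \<Delta>)
  obtain x A where "d = (x, A)" by (cases d)
  with snoc.prems have "wf_env \<A> \<R> ((\<Gamma> @ \<Delta>) @ [(x, A)])" by simp
  then obtain s where "has_type \<A> \<R> (\<Gamma> @ \<Delta>) A (TSort s)" by (rule wf_snocE)
  then show ?case by (intro snoc.IH wf_of(2))
qed simp

lemma wf_middleE:
  assumes "wf_env \<A> \<R> (\<Gamma> @ [(x, A)] @ \<Delta>)"
  obtains s where "has_type \<A> \<R> \<Gamma> A (TSort s)" "x \<notin> env_dom \<Gamma>"
proof -
  have "wf_env \<A> \<R> (\<Gamma> @ [(x, A)])"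
    using assms wf_prefix[of \<A> \<R> "\<Gamma> @ [(x, A)]" \<Delta>] by simp
  then show thesis by (rule wf_snocE) (rule that)
qed

lemma wf_distinct: "wf_env \<A> \<R> \<Gamma> \<Longrightarrow> distinct (map fst \<Gamma>)"
proof (induction \<Gamma> rule: rev_induct)
  case (snoc d \<Gamma>)
  obtain x A where d: "d = (x, A)" by (cases d)
  from snoc.prems have "wf_env \<A> \<R> \<Gamma>" by (rule wf_prefix)
  moreover from snoc.prems[unfolded d] have "x \<notin> env_dom \<Gamma>" by (rule wf_snocE)
  ultimately show ?case using snoc.IH d by (auto simp: env_dom_def)
qed simp

lemma sub_environment_dom: "\<Gamma> \<sqsubseteq> \<Delta> \<Longrightarrow> env_dom \<Gamma> \<subseteq> env_dom \<Delta>"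
  unfolding sub_environment_def env_dom_def by force

text \<open>All three parts speak about the declared types because \<open>extend\<close> has only a
  typing premise: the claim about \<Gamma> has to come out of the typing of the new type.\<close>

lemma typing_fv:
  fixes \<Gamma> :: "'s env" and M A :: "'s trm" and l :: "'s lst"
  shows "wf_env \<A> \<R> \<Gamma> \<Longrightarrow> \<forall>(x, A) \<in> set \<Gamma>. fv_trm A \<subseteq> env_dom \<Gamma>"
    "has_type \<A> \<R> \<Gamma> M A \<Longrightarrow> (\<forall>(x, A) \<in> set \<Gamma>. fv_trm A \<subseteq> env_dom \<Gamma>) \<and>
      fv_trm M \<subseteq> env_dom \<Gamma> \<and> fv_trm A \<subseteq> env_dom \<Gamma>"
    "lst_type \<A> \<R> \<Gamma> B l C \<Longrightarrow> (\<forall>(x, A) \<in> set \<Gamma>. fv_trm A \<subseteq> env_dom \<Gamma>) \<and>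
      fv_trm B \<subseteq> env_dom \<Gamma> \<and> fv_lst l \<subseteq> env_dom \<Gamma> \<and> fv_trm C \<subseteq> env_dom \<Gamma>"
proof (induction rule: wf_env_has_type_lst_type.inducts)
  case (Cut2 \<Gamma> P A x \<Delta> B l C \<Delta>')
  have "env_dom \<Gamma> \<union> env_dom \<Delta> \<subseteq> env_dom \<Delta>'" using sub_environment_dom[OF Cut2.hyps(1)] by simp
  with Cut2.IH show ?case by auto
  next
  case (Cut4 \<Gamma> P A x \<Delta> M C \<Delta>')
  have "env_dom \<Gamma> \<union> env_dom \<Delta> \<subseteq> env_dom \<Delta>'" using sub_environment_dom[OF Cut4.hyps(1)] by simp
  with Cut4.IH show ?case by (auto simp: sub_type_def)
qed (auto simp: env_domI)

lemma env_fv: "wf_env \<A> \<R> \<Gamma> \<Longrightarrow> (x, A) \<in> set \<Gamma> \<Longrightarrow> fv_trm A \<subseteq> env_dom \<Gamma>"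
  by (drule typing_fv(1)) auto

lemma sub_environment_trans: "\<Gamma> \<sqsubseteq> \<Delta> \<Longrightarrow> \<Delta> \<sqsubseteq> \<Theta> \<Longrightarrow> \<Gamma> \<sqsubseteq> \<Theta>"
  unfolding sub_environment_def by (meson equivclp_trans)

lemma sw_env_fresh:
  assumes "wf_env \<A> \<R> \<Gamma>" "a \<notin> env_dom \<Gamma>" "b \<notin> env_dom \<Gamma>"
  shows "sw_env a b \<Gamma> = \<Gamma>"
  unfolding sw_env_def
proof (rule map_idI)
  fix d assume d: "d \<in> set \<Gamma>"
  obtain x A where xA: "d = (x, A)" by (cases d)
  with d have "x \<in> env_dom \<Gamma>" "fv_trm A \<subseteq> env_dom \<Gamma>"
    using typing_fv(1)[OF assms(1)] by (auto intro: env_domI)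
  then have "sw a b x = x" "swap_trm a b A = A"
    using assms by (auto simp: sw_def intro!: swap_fresh)
  then show "(case d of (x, A) \<Rightarrow> (sw a b x, swap_trm a b A)) = d" using xA by simp
qed


section \<open>Generation\<close>

lemma distinct_trm [simp]:
  "TPi x A B \<noteq> TLam x' A' M'" "TPi x A B \<noteq> TSort s" "TPi x A B \<noteq> TVar y l" "TPi x A B \<noteq> TCut M l"
  "TPi x A B \<noteq> TSub y N A' M" "TLam x A M \<noteq> TSort s" "TLam x A M \<noteq> TVar y l" "TLam x A M \<noteq> TCut M' l"
  "TLam x A M \<noteq> TSub y N A' M'" "TSort s \<noteq> TVar y l" "TSort s \<noteq> TCut M l" "TSort s \<noteq> TSub y N A M"
  "TVar y l \<noteq> TCut M l'" "TVar y l \<noteq> TSub x N A M" "TCut M l \<noteq> TSub x N A M'"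
  by (transfer; simp)+

lemmas distinct_trm' [simp] = distinct_trm[symmetric]

lemma distinct_lst [simp]:
  "LNil \<noteq> LCons M l" "LNil \<noteq> LApp l1 l2" "LNil \<noteq> LSub x N A l" "LCons M l \<noteq> LApp l1 l2"
  "LCons M l \<noteq> LSub x N A l'" "LApp l1 l2 \<noteq> LSub x N A l"
  by (transfer; simp)+

lemmas distinct_lst' [simp] = distinct_lst[symmetric]

lemma rfv_close_eq:
  "close_trm k x t = close_trm k y t' \<Longrightarrow> x \<notin> rfv_trm t' - {y}"
  "close_lst k x l = close_lst k y l' \<Longrightarrow> x \<notin> rfv_lst l' - {y}"
  by (metis Diff_iff insertI1 rfv_close(1)) (metis Diff_iff insertI1 rfv_close(2))

lemma alpha_fresh:
  "TPi x A B = TPi y A' B' \<Longrightarrow> x \<notin> fv_trm B' - {y}"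
  "TLam x A B = TLam y A' B' \<Longrightarrow> x \<notin> fv_trm B' - {y}"
  "TSub x N A B = TSub y N' A' B' \<Longrightarrow> x \<notin> fv_trm B' - {y}"
  "LSub x N A l = LSub y N' A' l' \<Longrightarrow> x \<notin> fv_lst l' - {y}"
  by (transfer, unfold rtrm.inject rlst.inject, elim conjE, erule rfv_close_eq)+

text \<open>The freshness condition of \<open>alpha_rename\<close> is implied by the equation
  itself: closing at \<open>x\<close> removes \<open>x\<close>, so it cannot be free in the equal
  closing at \<open>y\<close>.\<close>

lemma alpha_eq:
  "TPi x A B = TPi y A' B' \<Longrightarrow> A = A' \<and> B = swap_trm y x B'"
  "TLam x A B = TLam y A' B' \<Longrightarrow> A = A' \<and> B = swap_trm y x B'"
  "TSub x N A B = TSub y N' A' B' \<Longrightarrow> N = N' \<and> A = A' \<and> B = swap_trm y x B'"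
  "LSub x N A l = LSub y N' A' l' \<Longrightarrow> N = N' \<and> A = A' \<and> l = swap_lst y x l'"
proof -
  show "A = A' \<and> B = swap_trm y x B'" if "TPi x A B = TPi y A' B'"
    using alpha_rename(1)[OF alpha_fresh(1)[OF that], of A'] that by simp
  show "A = A' \<and> B = swap_trm y x B'" if "TLam x A B = TLam y A' B'"
    using alpha_rename(2)[OF alpha_fresh(2)[OF that], of A'] that by simp
  show "N = N' \<and> A = A' \<and> B = swap_trm y x B'" if "TSub x N A B = TSub y N' A' B'"
    using alpha_rename(3)[OF alpha_fresh(3)[OF that], of N' A'] that by simp
  show "N = N' \<and> A = A' \<and> l = swap_lst y x l'" if "LSub x N A l = LSub y N' A' l'"
    using alpha_rename(4)[OF alpha_fresh(4)[OF that], of N' A'] that by simp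
qed

text \<open>Typing by a last rule other than a conversion rule.\<close>

inductive trm_gen :: "('s \<times> 's) set \<Rightarrow> ('s \<times> 's \<times> 's) set \<Rightarrow> 's env \<Rightarrow> 's trm \<Rightarrow> 's trm \<Rightarrow> bool"
  for \<A> \<R> where
  "wf_env \<A> \<R> \<Gamma> \<Longrightarrow> (s, s') \<in> \<A> \<Longrightarrow> trm_gen \<A> \<R> \<Gamma> (TSort s) (TSort s')"
| "has_type \<A> \<R> \<Gamma> A (TSort s1) \<Longrightarrow> has_type \<A> \<R> (\<Gamma> @ [(x, A)]) B (TSort s2) \<Longrightarrow>
    (s1, s2, s3) \<in> \<R> \<Longrightarrow> trm_gen \<A> \<R> \<Gamma> (TPi x A B) (TSort s3)"
| "has_type \<A> \<R> \<Gamma> (TPi x A B) (TSort s) \<Longrightarrow> has_type \<A> \<R> (\<Gamma> @ [(x, A)]) M B \<Longrightarrow>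
    trm_gen \<A> \<R> \<Gamma> (TLam x A M) (TPi x A B)"
| "lst_type \<A> \<R> \<Gamma> A l B \<Longrightarrow> (x, A) \<in> set \<Gamma> \<Longrightarrow> trm_gen \<A> \<R> \<Gamma> (TVar x l) B"
| "has_type \<A> \<R> \<Gamma> M A \<Longrightarrow> lst_type \<A> \<R> \<Gamma> A l B \<Longrightarrow> trm_gen \<A> \<R> \<Gamma> (TCut M l) B"
| "has_type \<A> \<R> \<Gamma> P A \<Longrightarrow> has_type \<A> \<R> (\<Gamma> @ [(x, A)] @ \<Delta>) M C \<Longrightarrow>
    \<Gamma> @ sub_env x P A \<Delta> \<sqsubseteq> \<Delta>' \<Longrightarrow> wf_env \<A> \<R> \<Delta>' \<Longrightarrow>
    trm_gen \<A> \<R> \<Delta>' (TSub x P A M) (sub_type x P A C)"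

inductive lst_gen :: "('s \<times> 's) set \<Rightarrow> ('s \<times> 's \<times> 's) set \<Rightarrow>
    's env \<Rightarrow> 's trm \<Rightarrow> 's lst \<Rightarrow> 's trm \<Rightarrow> bool"
  for \<A> \<R> where
  "has_type \<A> \<R> \<Gamma> A (TSort s) \<Longrightarrow> lst_gen \<A> \<R> \<Gamma> A LNil A"
| "has_type \<A> \<R> \<Gamma> (TPi x A B) (TSort s) \<Longrightarrow> has_type \<A> \<R> \<Gamma> M A \<Longrightarrow>
    lst_type \<A> \<R> \<Gamma> (TSub x M A B) l C \<Longrightarrow> lst_gen \<A> \<R> \<Gamma> (TPi x A B) (LCons M l) C"
| "lst_type \<A> \<R> \<Gamma> C l' A \<Longrightarrow> lst_type \<A> \<R> \<Gamma> A l B \<Longrightarrow> lst_gen \<A> \<R> \<Gamma> C (LApp l' l) B"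
| "has_type \<A> \<R> \<Gamma> P A \<Longrightarrow> lst_type \<A> \<R> (\<Gamma> @ [(x, A)] @ \<Delta>) B l C \<Longrightarrow>
    \<Gamma> @ sub_env x P A \<Delta> \<sqsubseteq> \<Delta>' \<Longrightarrow> wf_env \<A> \<R> \<Delta>' \<Longrightarrow>
    lst_gen \<A> \<R> \<Delta>' (TSub x P A B) (LSub x P A l) (TSub x P A C)"

inductive_cases trm_gen_sortE: "trm_gen \<A> \<R> \<Gamma> (TSort s) T"
inductive_cases trm_gen_PiE: "trm_gen \<A> \<R> \<Gamma> (TPi x A B) T"
inductive_cases trm_gen_LamE: "trm_gen \<A> \<R> \<Gamma> (TLam x A B) T"
inductive_cases trm_gen_VarE: "trm_gen \<A> \<R> \<Gamma> (TVar x l) T"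
inductive_cases trm_gen_CutE: "trm_gen \<A> \<R> \<Gamma> (TCut M l) T"
inductive_cases trm_gen_SubE: "trm_gen \<A> \<R> \<Gamma> (TSub x P A M) T"
inductive_cases lst_gen_NilE: "lst_gen \<A> \<R> \<Gamma> B LNil C"
inductive_cases lst_gen_ConsE: "lst_gen \<A> \<R> \<Gamma> B (LCons M l) C"
inductive_cases lst_gen_AppE: "lst_gen \<A> \<R> \<Gamma> B (LApp l l') C"
inductive_cases lst_gen_SubE: "lst_gen \<A> \<R> \<Gamma> B (LSub x P A l) C"

text \<open>A type may be replaced by a convertible one only if the latter has a sort; this fails for
  a top sort, whence the case of equality.\<close>

definition tconv :: "('s \<times> 's) set \<Rightarrow> ('s \<times> 's \<times> 's) set \<Rightarrow> 's env \<Rightarrow> 's trm \<Rightarrow> 's trm \<Rightarrow> bool" where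
  "tconv \<A> \<R> \<Gamma> A B \<longleftrightarrow> A = B \<or> conv A B \<and> (\<exists>s. has_type \<A> \<R> \<Gamma> B (TSort s))"

lemma tconv_conv: "tconv \<A> \<R> \<Gamma> A B \<Longrightarrow> conv A B"
  by (auto simp: tconv_def)

lemma tconv_trans:
  "tconv \<A> \<R> \<Gamma> A B \<Longrightarrow> conv B C \<Longrightarrow> has_type \<A> \<R> \<Gamma> C (TSort s) \<Longrightarrow> tconv \<A> \<R> \<Gamma> A C"
  unfolding tconv_def by (meson equivclp_trans)

lemma tconv_refl [simp]: "tconv \<A> \<R> \<Gamma> A A"
  by (simp add: tconv_def)

lemma has_type_tconv: "has_type \<A> \<R> \<Gamma> M A \<Longrightarrow> tconv \<A> \<R> \<Gamma> A B \<Longrightarrow> has_type \<A> \<R> \<Gamma> M B"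
  unfolding tconv_def by (elim disjE conjE exE) (simp, rule conv_R)

lemma lst_type_tconv:
  assumes "lst_type \<A> \<R> \<Gamma> A l C" "tconv \<A> \<R> \<Gamma> A B" "tconv \<A> \<R> \<Gamma> C D"
  shows "lst_type \<A> \<R> \<Gamma> B l D"
proof -
  have "lst_type \<A> \<R> \<Gamma> B l C"
    using assms(2,1) unfolding tconv_def by (elim disjE conjE exE) (simp, rule conv_L)
  with assms(3) show ?thesis
    unfolding tconv_def by (elim disjE conjE exE) (simp, rule conv_R')
qed

text \<open>Each rule other than a conversion rule provides its own witness, with equality as
  \<open>tconv\<close>. A chain of conversions collapses to one, and only its last type has to be
  sorted.\<close>

lemma generation:
  fixes \<Gamma> :: "'s env" and M A :: "'s trm" and l :: "'s lst"
  shows "wf_env \<A> \<R> \<Gamma> \<Longrightarrow> True"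
    "has_type \<A> \<R> \<Gamma> M A \<Longrightarrow> \<exists>A'. trm_gen \<A> \<R> \<Gamma> M A' \<and> tconv \<A> \<R> \<Gamma> A' A"
    "lst_type \<A> \<R> \<Gamma> B l C \<Longrightarrow>
      \<exists>B' C'. lst_gen \<A> \<R> \<Gamma> B' l C' \<and> tconv \<A> \<R> \<Gamma> B' B \<and> tconv \<A> \<R> \<Gamma> C' C"
proof (induction rule: wf_env_has_type_lst_type.inducts)
  case (conv_R \<Gamma> M A B s)
  then show ?case by (blast intro: tconv_trans)
next
  case (conv_R' \<Gamma> C l A B s)
  then show ?case by (blast intro: tconv_trans)
next
  case (conv_L \<Gamma> A l C B s)
  then show ?case by (blast intro: tconv_trans)
qed (rule TrueI
    | (rule exI, rule conjI[OF _ tconv_refl], rule trm_gen.intros; assumption)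
    | (rule exI, rule exI, rule conjI[OF _ conjI[OF tconv_refl tconv_refl]],
        rule lst_gen.intros; assumption))+

section \<open>Inversion of typing for a chosen fresh bound name\<close>

lemma gen_sort:
  "has_type \<A> \<R> \<Gamma> (TSort s) T \<Longrightarrow> \<exists>s'. (s, s') \<in> \<A> \<and> tconv \<A> \<R> \<Gamma> (TSort s') T"
  by (drule generation(2)) (auto elim: trm_gen_sortE)

lemma gen_Var:
  "has_type \<A> \<R> \<Gamma> (TVar x l) T \<Longrightarrow> \<exists>A. (x, A) \<in> set \<Gamma> \<and> lst_type \<A> \<R> \<Gamma> A l T"
  by (drule generation(2)) (auto elim!: trm_gen_VarE intro: lst_type_tconv tconv_refl)

lemma gen_Cut:
  "has_type \<A> \<R> \<Gamma> (TCut M l) T \<Longrightarrow> \<exists>A. has_type \<A> \<R> \<Gamma> M A \<and> lst_type \<A> \<R> \<Gamma> A l T"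
  by (drule generation(2)) (auto elim!: trm_gen_CutE intro: lst_type_tconv tconv_refl)

lemma gen_App:
  "lst_type \<A> \<R> \<Gamma> B (LApp l l') C \<Longrightarrow> \<exists>A. lst_type \<A> \<R> \<Gamma> B l A \<and> lst_type \<A> \<R> \<Gamma> A l' C"
  by (drule generation(3)) (auto elim!: lst_gen_AppE intro: lst_type_tconv tconv_refl)

text \<open>Both names are fresh for \<Gamma>, hence for \<open>A\<close>, so swapping them fixes
  the environment and only renames the last declaration.\<close>

lemma fresh_binder:
  assumes "has_type \<A> \<R> (\<Gamma> @ [(y, A)]) M B" "x \<notin> env_dom \<Gamma>"
  shows "has_type \<A> \<R> (\<Gamma> @ [(x, A)]) (swap_trm y x M) (swap_trm y x B)"
proof -
  obtain s where A: "has_type \<A> \<R> \<Gamma> A (TSort s)" "y \<notin> env_dom \<Gamma>"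
    using wf_of(2)[OF assms(1)] by (rule wf_snocE)
  have "sw_env y x \<Gamma> = \<Gamma>" by (rule sw_env_fresh[OF wf_of(2)[OF A(1)] A(2) assms(2)])
  moreover have "swap_trm y x A = A"
    using typing_fv(2)[OF A(1)] A(2) assms(2) by (intro swap_fresh) auto
  ultimately show ?thesis using typing_swap(2)[OF assms(1), of y x] by simp
qed

lemma gen_Pi:
  assumes "has_type \<A> \<R> \<Gamma> (TPi x A B) T" "x \<notin> env_dom \<Gamma>"
  shows "\<exists>s1 s2 s3. has_type \<A> \<R> \<Gamma> A (TSort s1) \<and> has_type \<A> \<R> (\<Gamma> @ [(x, A)]) B (TSort s2) \<and>
    (s1, s2, s3) \<in> \<R> \<and> tconv \<A> \<R> \<Gamma> (TSort s3) T"
proof -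
  obtain T' where T': "trm_gen \<A> \<R> \<Gamma> (TPi x A B) T'" "tconv \<A> \<R> \<Gamma> T' T"
    using generation(2)[OF assms(1)] by blast
  from T'(1) obtain y A' B' s1 s2 s3 where eq: "TPi x A B = TPi y A' B'" and *:
    "T' = TSort s3" "has_type \<A> \<R> \<Gamma> A' (TSort s1)" "has_type \<A> \<R> (\<Gamma> @ [(y, A')]) B' (TSort s2)"
    "(s1, s2, s3) \<in> \<R>" by (rule trm_gen_PiE)
  have "has_type \<A> \<R> (\<Gamma> @ [(x, A)]) B (TSort s2)"
    using fresh_binder[OF *(3) assms(2)] alpha_eq(1)[OF eq] by simp
  then show ?thesis using * T'(2) alpha_eq(1)[OF eq] by blast
qed

lemma gen_Lam:
  assumes "has_type \<A> \<R> \<Gamma> (TLam x A M) T" "x \<notin> env_dom \<Gamma>"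
  shows "\<exists>B s. has_type \<A> \<R> \<Gamma> (TPi x A B) (TSort s) \<and> has_type \<A> \<R> (\<Gamma> @ [(x, A)]) M B \<and>
    tconv \<A> \<R> \<Gamma> (TPi x A B) T"
proof -
  obtain T' where T': "trm_gen \<A> \<R> \<Gamma> (TLam x A M) T'" "tconv \<A> \<R> \<Gamma> T' T"
    using generation(2)[OF assms(1)] by blast
  from T'(1) obtain y A' B' M' s where eq: "TLam x A M = TLam y A' M'" and *:
    "T' = TPi y A' B'" "has_type \<A> \<R> \<Gamma> (TPi y A' B') (TSort s)" "has_type \<A> \<R> (\<Gamma> @ [(y, A')]) M' B'"
    by (rule trm_gen_LamE)
  have "has_type \<A> \<R> (\<Gamma> @ [(x, A)]) M (swap_trm y x B')"
    using fresh_binder[OF *(3) assms(2)] alpha_eq(2)[OF eq] by simp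
  moreover have "x \<notin> fv_trm B' - {y}" using typing_fv(2)[OF *(3)] assms(2) by auto
  then have "TPi y A' B' = TPi x A (swap_trm y x B')"
    using alpha_rename(1) alpha_eq(2)[OF eq] by metis
  ultimately show ?thesis using * T'(2) by metis
qed

lemma sub_env_rename:
  assumes "\<And>z B. (z, B) \<in> set \<Delta> \<Longrightarrow> z \<noteq> x \<and> z \<noteq> y \<and> y \<notin> fv_trm B"
  shows "sub_env x P A \<Delta> = sub_env y P A (sw_env x y \<Delta>)"
  unfolding sub_env_def sw_env_def
  using assms by (auto intro: alpha_rename(3))

text \<open>As \<open>x\<close> is declared only once, swapping fixes \<Gamma> and \<open>A\<close>
  and keeps the names declared in \<Delta>. The types in \<Delta> may mention \<open>x\<close>, but
  under the substitution for it their swapping is mere \<alpha>-conversion.\<close>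

lemma fresh_cut:
  assumes "wf_env \<A> \<R> (\<Gamma> @ [(x, A)] @ \<Delta>)" "y \<notin> env_dom \<Gamma>" "y \<notin> env_dom \<Delta>" "x \<noteq> y"
  shows "sw_env x y (\<Gamma> @ [(x, A)] @ \<Delta>) = \<Gamma> @ [(y, A)] @ sw_env x y \<Delta>"
    "sub_env x P G \<Delta> = sub_env y P G (sw_env x y \<Delta>)"
proof -
  obtain s where A: "has_type \<A> \<R> \<Gamma> A (TSort s)" "x \<notin> env_dom \<Gamma>"
    using assms(1) by (rule wf_middleE)
  have "sw_env x y \<Gamma> = \<Gamma>" by (rule sw_env_fresh[OF wf_of(2)[OF A(1)] A(2) assms(2)])
  moreover have "swap_trm x y A = A"
    using typing_fv(2)[OF A(1)] A(2) assms(2) by (intro swap_fresh) auto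
  ultimately show "sw_env x y (\<Gamma> @ [(x, A)] @ \<Delta>) = \<Gamma> @ [(y, A)] @ sw_env x y \<Delta>" by simp
  show "sub_env x P G \<Delta> = sub_env y P G (sw_env x y \<Delta>)"
  proof (rule sub_env_rename)
    fix z B assume zB: "(z, B) \<in> set \<Delta>"
    then have "z \<in> fst ` set \<Delta>" by force
    then have "z \<noteq> x" using wf_distinct[OF assms(1)] by auto
    moreover have "fv_trm B \<subseteq> env_dom (\<Gamma> @ [(x, A)] @ \<Delta>)"
      by (rule env_fv[OF assms(1), of z]) (simp add: zB)
    ultimately show "z \<noteq> x \<and> z \<noteq> y \<and> y \<notin> fv_trm B"
      using assms zB by (auto dest: env_domI)
  qed
qed

text \<open>The domains of \<Gamma> and \<Delta> lie inside that of \<open>\<Gamma>'\<close>, so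
  \<open>y\<close> is fresh for the premises and the derivation can be moved from its own name
  \<open>x\<close> to \<open>y\<close>.\<close>

lemma gen_Sub:
  assumes "has_type \<A> \<R> \<Gamma>' (TSub y P G M) T" "y \<notin> env_dom \<Gamma>'"
  shows "\<exists>\<Gamma> \<Delta> C. has_type \<A> \<R> \<Gamma> P G \<and> has_type \<A> \<R> (\<Gamma> @ [(y, G)] @ \<Delta>) M C \<and>
    \<Gamma> @ sub_env y P G \<Delta> \<sqsubseteq> \<Gamma>' \<and> wf_env \<A> \<R> \<Gamma>' \<and> tconv \<A> \<R> \<Gamma>' (sub_type y P G C) T"
proof -
  obtain T' where T': "trm_gen \<A> \<R> \<Gamma>' (TSub y P G M) T'" "tconv \<A> \<R> \<Gamma>' T' T"
    using generation(2)[OF assms(1)] by blast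
  from T'(1) obtain x P' G' M' \<Gamma> \<Delta> C where eq: "TSub y P G M = TSub x P' G' M'" and *:
    "T' = sub_type x P' G' C" "has_type \<A> \<R> \<Gamma> P' G'" "has_type \<A> \<R> (\<Gamma> @ [(x, G')] @ \<Delta>) M' C"
    "\<Gamma> @ sub_env x P' G' \<Delta> \<sqsubseteq> \<Gamma>'" "wf_env \<A> \<R> \<Gamma>'"
    unfolding append_Cons append_Nil by (rule trm_gen_SubE)
  note eqs = alpha_eq(3)[OF eq]
  show ?thesis
  proof (cases "x = y")
    case True
    then show ?thesis using * T'(2) eq by auto
  next
    case False
    have y: "y \<notin> env_dom \<Gamma>" "y \<notin> env_dom \<Delta>"
      using sub_environment_dom[OF *(4)] assms(2) by auto
    note fc = fresh_cut[OF wf_of(2)[OF *(3)] y False]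
    have "has_type \<A> \<R> (\<Gamma> @ [(y, G)] @ sw_env x y \<Delta>) M (swap_trm x y C)"
      using typing_swap(2)[OF *(3), of x y, unfolded fc] eqs by simp
    moreover have "sub_type x P' G' C = sub_type y P G (swap_trm x y C)"
    proof -
      have "y \<notin> fv_trm C - {x}" using typing_fv(2)[OF *(3)] y by auto
      with eqs have "TSub x P' G' C = TSub y P G (swap_trm x y C)" by (simp add: alpha_rename(3))
      moreover have "swap_trm x y C = C" if "C \<in> range TSort" using that by auto
      ultimately show ?thesis unfolding sub_type_def by (simp add: swap_range_TSort)
    qed
    ultimately show ?thesis using * T'(2) eqs fc(2)[of P G] by metis
  qed
qed

lemma gen_LSub:
  assumes "lst_type \<A> \<R> \<Gamma>' B (LSub y P G l) C" "y \<notin> env_dom \<Gamma>'"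
  shows "\<exists>\<Gamma> \<Delta> B' C'. has_type \<A> \<R> \<Gamma> P G \<and> lst_type \<A> \<R> (\<Gamma> @ [(y, G)] @ \<Delta>) B' l C' \<and>
    \<Gamma> @ sub_env y P G \<Delta> \<sqsubseteq> \<Gamma>' \<and> wf_env \<A> \<R> \<Gamma>' \<and>
    tconv \<A> \<R> \<Gamma>' (TSub y P G B') B \<and> tconv \<A> \<R> \<Gamma>' (TSub y P G C') C"
proof -
  obtain B0 C0 where T': "lst_gen \<A> \<R> \<Gamma>' B0 (LSub y P G l) C0"
    "tconv \<A> \<R> \<Gamma>' B0 B" "tconv \<A> \<R> \<Gamma>' C0 C"
    using generation(3)[OF assms(1)] by blast
  from T'(1) obtain x P' G' l' \<Gamma> \<Delta> B' C' where
    *: "B0 = TSub x P' G' B'" and eq: "LSub y P G l = LSub x P' G' l'" and **: "C0 = TSub x P' G' C'"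
    "has_type \<A> \<R> \<Gamma> P' G'" "lst_type \<A> \<R> (\<Gamma> @ [(x, G')] @ \<Delta>) B' l' C'"
    "\<Gamma> @ sub_env x P' G' \<Delta> \<sqsubseteq> \<Gamma>'" "wf_env \<A> \<R> \<Gamma>'"
    unfolding append_Cons append_Nil by (rule lst_gen_SubE)
  note * = * **
  note eqs = alpha_eq(4)[OF eq]
  show ?thesis
  proof (cases "x = y")
    case True
    then show ?thesis using * T'(2,3) eq by auto
  next
    case False
    have y: "y \<notin> env_dom \<Gamma>" "y \<notin> env_dom \<Delta>"
      using sub_environment_dom[OF *(5)] assms(2) by auto
    note fc = fresh_cut[OF wf_of(3)[OF *(4)] y False]
    have "lst_type \<A> \<R> (\<Gamma> @ [(y, G)] @ sw_env x y \<Delta>) (swap_trm x y B') l (swap_trm x y C')"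
      using typing_swap(3)[OF *(4), of x y, unfolded fc] eqs by simp
    moreover have "y \<notin> fv_trm B' - {x}" "y \<notin> fv_trm C' - {x}" using typing_fv(3)[OF *(4)] y by auto
    then have "TSub x P' G' B' = TSub y P G (swap_trm x y B')"
      "TSub x P' G' C' = TSub y P G (swap_trm x y C')"
      using eqs by (simp_all add: alpha_rename(3))
    ultimately show ?thesis using * T'(2,3) eqs fc(2)[of P G] by metis
  qed
qed

text \<open>The rule \<open>axiom\<close> has the same type on both sides; afterwards each side is
  converted independently.\<close>

lemma gen_Nil:
  assumes "lst_type \<A> \<R> \<Gamma> B LNil C"
  shows "conv B C"
proof -
  obtain B0 where "tconv \<A> \<R> \<Gamma> B0 B" "tconv \<A> \<R> \<Gamma> B0 C"
    using generation(3)[OF assms] by (auto elim: lst_gen_NilE)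
  then show ?thesis using tconv_conv equivclp_sym equivclp_trans by metis
qed

lemma gen_Cons:
  assumes "lst_type \<A> \<R> \<Gamma> T (LCons M l) C" "x \<notin> env_dom \<Gamma>"
  shows "\<exists>A D s. has_type \<A> \<R> \<Gamma> (TPi x A D) (TSort s) \<and> has_type \<A> \<R> \<Gamma> M A \<and>
    lst_type \<A> \<R> \<Gamma> (TSub x M A D) l C \<and> tconv \<A> \<R> \<Gamma> (TPi x A D) T"
proof -
  obtain T' C' where T': "lst_gen \<A> \<R> \<Gamma> T' (LCons M l) C'" "tconv \<A> \<R> \<Gamma> T' T" "tconv \<A> \<R> \<Gamma> C' C"
    using generation(3)[OF assms(1)] by blast
  from T'(1) obtain y A D s where *: "T' = TPi y A D" "has_type \<A> \<R> \<Gamma> (TPi y A D) (TSort s)"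
    "has_type \<A> \<R> \<Gamma> M A" "lst_type \<A> \<R> \<Gamma> (TSub y M A D) l C'"
    by (auto elim: lst_gen_ConsE)
  have "x \<notin> fv_trm D - {y}" using typing_fv(2)[OF *(2)] assms(2) by auto
  then have eqs: "TPi y A D = TPi x A (swap_trm y x D)" "TSub y M A D = TSub x M A (swap_trm y x D)"
    by (simp_all only: alpha_rename not_False_eq_True)
  from *(4) T'(3) have "lst_type \<A> \<R> \<Gamma> (TSub y M A D) l C" using lst_type_tconv tconv_refl by blast
  with * T'(2) show ?thesis unfolding eqs by blast
qed


section \<open>Weakening\<close>

text \<open>Instantiated first with inclusion, which makes all types of an environment typable in it, and
  then with \<open>\<sqsubseteq>\<close>, where the declared type has to be converted.\<close>

lemma weakening_gen:
  fixes r :: "'s env \<Rightarrow> 's env \<Rightarrow> bool" and M A :: "'s trm" and l :: "'s lst"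
  assumes sub: "\<And>\<Gamma> \<Delta>. r \<Gamma> \<Delta> \<Longrightarrow> \<Gamma> \<sqsubseteq> \<Delta>"
    and eqv: "\<And>a b \<Gamma> \<Delta>. r \<Gamma> \<Delta> \<Longrightarrow> r (sw_env a b \<Gamma>) (sw_env a b \<Delta>)"
    and ext: "\<And>\<Gamma> \<Delta> x A. r \<Gamma> \<Delta> \<Longrightarrow> r (\<Gamma> @ [(x, A)]) (\<Delta> @ [(x, A)])"
    and var: "\<And>\<Gamma> \<Delta> x A. r \<Gamma> \<Delta> \<Longrightarrow> wf_env \<A> \<R> \<Delta> \<Longrightarrow> (x, A) \<in> set \<Gamma> \<Longrightarrow>
      \<exists>B. (x, B) \<in> set \<Delta> \<and> tconv \<A> \<R> \<Delta> A B"
  shows "wf_env \<A> \<R> \<Gamma> \<Longrightarrow> True"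
    "has_type \<A> \<R> \<Gamma> M A \<Longrightarrow> r \<Gamma> \<Delta> \<Longrightarrow> wf_env \<A> \<R> \<Delta> \<Longrightarrow> has_type \<A> \<R> \<Delta> M A"
    "lst_type \<A> \<R> \<Gamma> B l C \<Longrightarrow> r \<Gamma> \<Delta>' \<Longrightarrow> wf_env \<A> \<R> \<Delta>' \<Longrightarrow> lst_type \<A> \<R> \<Delta>' B l C"
proof (induction arbitrary: and \<Delta> and \<Delta>' rule: wf_env_has_type_lst_type.inducts)
  \<comment> \<open>The induction hypothesis concerns the binder \<open>x\<close>, which may already
    be declared in \<Delta>. It is therefore applied to the swapped environment, where
    \<open>x\<close> is the fresh name and the old declaration of \<open>x\<close>, if any, is
    called \<open>y\<close>; swapping the result restores \<Delta>.\<close>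
  have under: "has_type \<A> \<R> (\<Delta> @ [(y, A)]) (swap_trm x y M) (swap_trm x y B)"
    if *: "r \<Gamma> \<Delta>" "has_type \<A> \<R> \<Delta> A (TSort s)" "has_type \<A> \<R> (\<Gamma> @ [(x, A)]) M B"
      "y \<notin> env_dom \<Delta>"
      "\<And>\<Delta>. r (\<Gamma> @ [(x, A)]) \<Delta> \<Longrightarrow> wf_env \<A> \<R> \<Delta> \<Longrightarrow> has_type \<A> \<R> \<Delta> M B"
    for \<Gamma> \<Delta> :: "'s env" and x y A M B s
  proof -
    have y: "y \<notin> env_dom \<Gamma>" using sub_environment_dom[OF sub[OF *(1)]] *(4) by blast
    obtain s' where A: "has_type \<A> \<R> \<Gamma> A (TSort s')" "x \<notin> env_dom \<Gamma>"
      using wf_of(2)[OF *(3)] by (rule wf_snocE)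
    have \<Gamma>: "sw_env x y \<Gamma> = \<Gamma>" by (rule sw_env_fresh[OF wf_of(2)[OF A(1)] A(2) y])
    have swA: "swap_trm x y A = A"
      using typing_fv(2)[OF A(1)] A(2) y by (intro swap_fresh) auto
    let ?\<Delta> = "sw_env x y (\<Delta> @ [(y, A)])"
    have "r (\<Gamma> @ [(x, A)]) ?\<Delta>"
      using eqv[OF ext[OF *(1), of y A], of x y] \<Gamma> swA by simp
    moreover have "wf_env \<A> \<R> ?\<Delta>"
      by (rule typing_swap(1), rule extend[OF *(2,4)])
    ultimately have "has_type \<A> \<R> ?\<Delta> M B" by (rule *(5))
    from typing_swap(2)[OF this, of x y] show ?thesis by simp
  qed
  have fresh: "\<exists>y. y \<notin> env_dom \<Delta> \<and> y \<notin> fv_trm M \<and> y \<notin> fv_trm B" for \<Delta> and M B :: "'s trm"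
    using obtain_fresh[of "env_dom \<Delta> \<union> fv_trm M \<union> fv_trm B"] by auto
  {
    case (Pi_wf \<Gamma> A s1 x B s2 s3)
    obtain y where y: "y \<notin> env_dom \<Delta>" "y \<notin> fv_trm B" using fresh by blast
    have A: "has_type \<A> \<R> \<Delta> A (TSort s1)" by (rule Pi_wf.IH(2)[OF Pi_wf.prems])
    have "has_type \<A> \<R> (\<Delta> @ [(y, A)]) (swap_trm x y B) (swap_trm x y (TSort s2))"
      by (rule under[OF Pi_wf.prems(1) A Pi_wf.IH(3) y(1)]) (rule Pi_wf.IH(4))
    then have "has_type \<A> \<R> \<Delta> (TPi y A (swap_trm x y B)) (TSort s3)"
      using A Pi_wf.IH(5) by (auto intro: wf_env_has_type_lst_type.Pi_wf)
    moreover have "TPi x A B = TPi y A (swap_trm x y B)" by (rule alpha_rename(1)) (use y in auto)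
    ultimately show ?case by simp
  next
    case (Pi_R \<Gamma> x A B s M)
    obtain y where y: "y \<notin> env_dom \<Delta>" "y \<notin> fv_trm B" "y \<notin> fv_trm M" using fresh by blast
    have Pi: "has_type \<A> \<R> \<Delta> (TPi x A B) (TSort s)" by (rule Pi_R.IH(2)[OF Pi_R.prems])
    moreover have eqs: "TPi x A B = TPi y A (swap_trm x y B)" "TLam x A M = TLam y A (swap_trm x y M)"
      by (rule alpha_rename, use y in auto)+
    \<comment> \<open>The sort of \<open>A\<close> is not a premise of \<open>Pi_R\<close>;
      inverting the weakened product supplies it in \<Delta>, where \<open>under\<close> asks for
      it.\<close>
    ultimately obtain s1 where A: "has_type \<A> \<R> \<Delta> A (TSort s1)" using gen_Pi y(1) by metis
    have "has_type \<A> \<R> (\<Delta> @ [(y, A)]) (swap_trm x y M) (swap_trm x y B)"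
      by (rule under[OF Pi_R.prems(1) A Pi_R.IH(3) y(1)]) (rule Pi_R.IH(4))
    with Pi show ?case unfolding eqs by (rule wf_env_has_type_lst_type.Pi_R)
  next
    case (select \<Gamma> A l B x)
    obtain A' where A': "(x, A') \<in> set \<Delta>" "tconv \<A> \<R> \<Delta> A A'"
      using var[OF select.prems select.hyps(1)] by blast
    have "lst_type \<A> \<R> \<Delta> A l B" by (rule select.IH(2)[OF select.prems])
    then have "lst_type \<A> \<R> \<Delta> A' l B" by (rule lst_type_tconv[OF _ A'(2) tconv_refl])
    then show ?case using A'(1) by (rule wf_env_has_type_lst_type.select)
  next
    case (sorted \<Gamma> s s')
    then show ?case by (auto intro: wf_env_has_type_lst_type.sorted)
  next
    case ("axiom" \<Gamma> A s)
    show ?case by (rule wf_env_has_type_lst_type.axiom, rule axiom.IH(2)[OF axiom.prems])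
  next
    case (conv_R \<Gamma> M A B s)
    show ?case by (rule wf_env_has_type_lst_type.conv_R[OF conv_R.IH(2)[OF conv_R.prems]
      conv_R.IH(4)[OF conv_R.prems] conv_R.hyps(1)])
  next
    case (Pi_L \<Gamma> x A B s M l C)
    show ?case by (rule wf_env_has_type_lst_type.Pi_L[OF Pi_L.IH(2)[OF Pi_L.prems]
      Pi_L.IH(4)[OF Pi_L.prems] Pi_L.IH(6)[OF Pi_L.prems]])
  next
    case (conv_R' \<Gamma> C l A B s)
    show ?case by (rule wf_env_has_type_lst_type.conv_R'[OF conv_R'.IH(2)[OF conv_R'.prems]
      conv_R'.IH(4)[OF conv_R'.prems] conv_R'.hyps(1)])
  next
    case (conv_L \<Gamma> A l C B s)
    show ?case by (rule wf_env_has_type_lst_type.conv_L[OF conv_L.IH(2)[OF conv_L.prems]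
      conv_L.IH(4)[OF conv_L.prems] conv_L.hyps(1)])
  next
    case (Cut1 \<Gamma> C l' A l B)
    show ?case
      by (rule wf_env_has_type_lst_type.Cut1[OF Cut1.IH(2)[OF Cut1.prems] Cut1.IH(4)[OF Cut1.prems]])
  next
    \<comment> \<open>A cut carries its own weakening: transitivity of \<sqsubseteq> absorbs the new
      environment, and the premises are reused as they stand.\<close>
    case (Cut2 \<Gamma> P A x \<Delta>0 B l C \<Delta>1)
    show ?case
      by (rule wf_env_has_type_lst_type.Cut2[OF Cut2.IH(1,3)
        sub_environment_trans[OF Cut2.hyps(1) sub[OF Cut2.prems(1)]] Cut2.prems(2)])
  next
    case (Cut3 \<Gamma> M A l B)
    show ?case
      by (rule wf_env_has_type_lst_type.Cut3[OF Cut3.IH(2)[OF Cut3.prems] Cut3.IH(4)[OF Cut3.prems]])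
  next
    case (Cut4 \<Gamma> P A x \<Delta>0 M C \<Delta>1)
    show ?case
      by (rule wf_env_has_type_lst_type.Cut4[OF Cut4.IH(1,3)
        sub_environment_trans[OF Cut4.hyps(1) sub[OF Cut4.prems(1)]] Cut4.prems(2)])
  }
qed simp_all

lemma weakening_subset:
  assumes "set \<Gamma> \<subseteq> set \<Delta>" "wf_env \<A> \<R> \<Delta>"
  shows "has_type \<A> \<R> \<Gamma> M A \<Longrightarrow> has_type \<A> \<R> \<Delta> M A"
  by (rule weakening_gen(2)[where r = "\<lambda>\<Gamma> \<Delta>. set \<Gamma> \<subseteq> set \<Delta>", OF _ _ _ _ _ assms])
    (auto simp: sub_environment_def sw_env_def)

lemma wf_env_typed:
  "wf_env \<A> \<R> \<Gamma> \<Longrightarrow> (x, A) \<in> set \<Gamma> \<Longrightarrow> \<exists>s. has_type \<A> \<R> \<Gamma> A (TSort s)"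
proof -
  assume wf: "wf_env \<A> \<R> \<Gamma>" and "(x, A) \<in> set \<Gamma>"
  then obtain \<Gamma>1 \<Gamma>2 where \<Gamma>: "\<Gamma> = \<Gamma>1 @ [(x, A)] @ \<Gamma>2" by (auto dest: split_list)
  from wf[unfolded \<Gamma>] obtain s where "has_type \<A> \<R> \<Gamma>1 A (TSort s)" by (rule wf_middleE)
  then have "has_type \<A> \<R> \<Gamma> A (TSort s)" by (rule weakening_subset[rotated 2]) (use wf \<Gamma> in auto)
  then show ?thesis ..
qed

lemma weakening:
  assumes "\<Gamma> \<sqsubseteq> \<Delta>" "wf_env \<A> \<R> \<Delta>"
  shows "has_type \<A> \<R> \<Gamma> M A \<Longrightarrow> has_type \<A> \<R> \<Delta> M A"
    "lst_type \<A> \<R> \<Gamma> B l C \<Longrightarrow> lst_type \<A> \<R> \<Delta> B l C"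
proof -
  have ext: "\<Gamma> @ [(x, A)] \<sqsubseteq> \<Delta> @ [(x, A)]" if "\<Gamma> \<sqsubseteq> \<Delta>" for \<Gamma> \<Delta> :: "'b env" and x A
    using that unfolding sub_environment_def by auto
  have var: "\<exists>B. (x, B) \<in> set \<Delta> \<and> tconv \<A> \<R> \<Delta> A B"
    if "\<Gamma> \<sqsubseteq> \<Delta>" "wf_env \<A> \<R> \<Delta>" "(x, A) \<in> set \<Gamma>" for \<Gamma> \<Delta> x A
    using that wf_env_typed unfolding sub_environment_def tconv_def by metis
  show "has_type \<A> \<R> \<Gamma> M A \<Longrightarrow> has_type \<A> \<R> \<Delta> M A"
    by (rule weakening_gen(2)[where r = "(\<sqsubseteq>)", OF _ sw_sub_environment ext var _ assms])
  show "lst_type \<A> \<R> \<Gamma> B l C \<Longrightarrow> lst_type \<A> \<R> \<Delta> B l C"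
    by (rule weakening_gen(3)[where r = "(\<sqsubseteq>)", OF _ sw_sub_environment ext var _ assms])
qed

text \<open>A term may have a top sort as type, hence the alternative. The types of a list always
  have sorts: \<open>axiom\<close>, \<open>Pi_L\<close> and the conversion rules demand them, and
  cuts preserve them because \<open>Cut4\<close> leaves the sort of a type unchanged.\<close>

lemma type_correctness:
  fixes \<Gamma> :: "'s env" and M A :: "'s trm" and l :: "'s lst"
  shows "wf_env \<A> \<R> \<Gamma> \<Longrightarrow> True"
    "has_type \<A> \<R> \<Gamma> M A \<Longrightarrow> A \<in> range TSort \<or> (\<exists>s. has_type \<A> \<R> \<Gamma> A (TSort s))"
    "lst_type \<A> \<R> \<Gamma> B l C \<Longrightarrow> (\<exists>s. has_type \<A> \<R> \<Gamma> B (TSort s)) \<and> (\<exists>s. has_type \<A> \<R> \<Gamma> C (TSort s))"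
proof (induction rule: wf_env_has_type_lst_type.inducts)
  have Cut4_sort: "has_type \<A> \<R> \<Delta>' (TSub x P A M) (TSort s)"
    if "has_type \<A> \<R> \<Gamma> P A" "has_type \<A> \<R> (\<Gamma> @ [(x, A)] @ \<Delta>) M (TSort s)"
      "\<Gamma> @ sub_env x P A \<Delta> \<sqsubseteq> \<Delta>'" "wf_env \<A> \<R> \<Delta>'" for \<Gamma> \<Delta> \<Delta>' :: "'s env" and P A M x s
    using wf_env_has_type_lst_type.Cut4[OF that] by (simp add: sub_type_def)
  {
    case (Cut2 \<Gamma> P A x \<Delta> B l C \<Delta>')
    then show ?case by (blast intro: Cut4_sort)
  next
    case (Cut4 \<Gamma> P A x \<Delta> M C \<Delta>')
    show ?case
    proof (cases "C \<in> range TSort")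
      case True
      then show ?thesis by (simp add: sub_type_def)
    next
      case False
      with Cut4.IH obtain s where "has_type \<A> \<R> (\<Gamma> @ [(x, A)] @ \<Delta>) C (TSort s)" by blast
      from Cut4_sort[OF Cut4.IH(1) this Cut4.hyps(1) Cut4.IH(5)] False show ?thesis
        by (auto simp: sub_type_def)
    qed
  }
qed auto

section \<open>Typing under a cut\<close>

text \<open>The premises common to \<open>Cut2\<close> and \<open>Cut4\<close>: everything except
  the typing of the expression under the substitution.\<close>

definition cut_ctx :: "('s \<times> 's) set \<Rightarrow> ('s \<times> 's \<times> 's) set \<Rightarrow>
    's env \<Rightarrow> var \<Rightarrow> 's trm \<Rightarrow> 's trm \<Rightarrow> 's env \<Rightarrow> 's env \<Rightarrow> bool" where
  "cut_ctx \<A> \<R> \<Gamma> y P G \<Delta> \<Gamma>' \<longleftrightarrow>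
    has_type \<A> \<R> \<Gamma> P G \<and> \<Gamma> @ sub_env y P G \<Delta> \<sqsubseteq> \<Gamma>' \<and> wf_env \<A> \<R> \<Gamma>'"

lemma cut_trm:
  "cut_ctx \<A> \<R> \<Gamma> y P G \<Delta> \<Gamma>' \<Longrightarrow> has_type \<A> \<R> (\<Gamma> @ [(y, G)] @ \<Delta>) M C \<Longrightarrow>
    has_type \<A> \<R> \<Gamma>' (TSub y P G M) (sub_type y P G C)"
  unfolding cut_ctx_def by (blast intro: Cut4)

lemma cut_lst:
  "cut_ctx \<A> \<R> \<Gamma> y P G \<Delta> \<Gamma>' \<Longrightarrow> lst_type \<A> \<R> (\<Gamma> @ [(y, G)] @ \<Delta>) B l C \<Longrightarrow>
    lst_type \<A> \<R> \<Gamma>' (TSub y P G B) (LSub y P G l) (TSub y P G C)"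
  unfolding cut_ctx_def by (blast intro: Cut2)

lemma sub_type_sort [simp]: "sub_type y P G (TSort s) = TSort s"
  by (simp add: sub_type_def)

lemma sub_type_Pi [simp]: "sub_type y P G (TPi x A B) = TSub y P G (TPi x A B)"
  by (auto simp: sub_type_def)

lemma cut_sort:
  "cut_ctx \<A> \<R> \<Gamma> y P G \<Delta> \<Gamma>' \<Longrightarrow> has_type \<A> \<R> (\<Gamma> @ [(y, G)] @ \<Delta>) M (TSort s) \<Longrightarrow>
    has_type \<A> \<R> \<Gamma>' (TSub y P G M) (TSort s)"
  by (drule (1) cut_trm) simp

lemma conv_sub_type: "conv (TSub y P G C) (sub_type y P G C)"
  unfolding sub_type_def by (auto intro: sub_sort)

text \<open>If \<open>C\<close> is a sort, its typing comes from an axiom of the PTSC, which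
  \<open>sorted\<close> reuses in \<open>\<Gamma>'\<close>; otherwise \<open>Cut4\<close> types the
  substituted type directly.\<close>

lemma sub_type_typed:
  assumes "cut_ctx \<A> \<R> \<Gamma> y P G \<Delta> \<Gamma>'" "has_type \<A> \<R> (\<Gamma> @ [(y, G)] @ \<Delta>) C (TSort s)"
  shows "\<exists>s. has_type \<A> \<R> \<Gamma>' (sub_type y P G C) (TSort s)"
proof (cases "C \<in> range TSort")
  case True
  then obtain s0 where C: "C = TSort s0" by blast
  obtain s' where "(s0, s') \<in> \<A>" using gen_sort[OF assms(2)[unfolded C]] by blast
  with assms(1) have "has_type \<A> \<R> \<Gamma>' (TSort s0) (TSort s')"
    unfolding cut_ctx_def by (intro sorted) auto
  then show ?thesis using C by auto
next
  case False
  then show ?thesis using cut_sort[OF assms] by (auto simp: sub_type_def)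
qed

text \<open>Carries a conversion of types made before a cut over to the type that
  \<open>Cut4\<close> assigns after it.\<close>

lemma cut_tconv:
  assumes "cut_ctx \<A> \<R> \<Gamma> y P G \<Delta> \<Gamma>'" "tconv \<A> \<R> (\<Gamma> @ [(y, G)] @ \<Delta>) B C"
  shows "tconv \<A> \<R> \<Gamma>' (sub_type y P G B) (sub_type y P G C)"
  using assms(2) unfolding tconv_def
proof (elim disjE conjE exE)
  fix s assume BC: "conv B C" and "has_type \<A> \<R> (\<Gamma> @ [(y, G)] @ \<Delta>) C (TSort s)"
  then obtain s' where "has_type \<A> \<R> \<Gamma>' (sub_type y P G C) (TSort s')"
    using sub_type_typed[OF assms(1)] by blast
  moreover have "conv (sub_type y P G B) (sub_type y P G C)"
  proof -
    have "conv (sub_type y P G B) (TSub y P G B)" by (rule equivclp_sym, rule conv_sub_type)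
    also have "conv \<dots> (TSub y P G C)" by (intro conv_TSub BC equivclp_refl)
    also have "conv \<dots> (sub_type y P G C)" by (rule conv_sub_type)
    finally show ?thesis .
  qed
  ultimately show "sub_type y P G B = sub_type y P G C \<or>
    conv (sub_type y P G B) (sub_type y P G C) \<and> (\<exists>s. has_type \<A> \<R> \<Gamma>' (sub_type y P G C) (TSort s))"
    by blast
qed simp

text \<open>The sort of \<open>C\<close> rules out a top sort. Both forms of the type of a cut then
  have sorts themselves and can be exchanged by conversion in either direction.\<close>

lemma tconv_sub_type:
  assumes "cut_ctx \<A> \<R> \<Gamma> y P G \<Delta> \<Gamma>'" "has_type \<A> \<R> (\<Gamma> @ [(y, G)] @ \<Delta>) C (TSort s)"
  shows "tconv \<A> \<R> \<Gamma>' (TSub y P G C) (sub_type y P G C)" "tconv \<A> \<R> \<Gamma>' (sub_type y P G C) (TSub y P G C)"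
  using sub_type_typed[OF assms] cut_sort[OF assms] conv_sub_type[of y P G C]
    equivclp_sym[OF conv_sub_type[of y P G C]]
  unfolding tconv_def by blast+

lemma tconv_TSub:
  assumes "cut_ctx \<A> \<R> \<Gamma> y P G \<Delta> \<Gamma>'" "conv B C" "has_type \<A> \<R> (\<Gamma> @ [(y, G)] @ \<Delta>) C (TSort s)"
  shows "tconv \<A> \<R> \<Gamma>' (TSub y P G B) (TSub y P G C)"
  using cut_sort[OF assms(1,3)] conv_TSub[OF equivclp_refl equivclp_refl assms(2), of y P G]
  unfolding tconv_def by blast

lemma cut_typed:
  assumes "cut_ctx \<A> \<R> \<Gamma> y P G \<Delta> \<Gamma>'" "has_type \<A> \<R> (\<Gamma> @ [(y, G)] @ \<Delta>) M C"
    "has_type \<A> \<R> (\<Gamma> @ [(y, G)] @ \<Delta>) C (TSort s)"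
  shows "has_type \<A> \<R> \<Gamma>' (TSub y P G M) (TSub y P G C)"
  using cut_trm[OF assms(1,2)] tconv_sub_type(2)[OF assms(1,3)] by (rule has_type_tconv)

lemma cut_ctx_dom:
  assumes "cut_ctx \<A> \<R> \<Gamma> y P G \<Delta> \<Gamma>'"
  shows "env_dom \<Gamma> \<subseteq> env_dom \<Gamma>'" "env_dom \<Delta> \<subseteq> env_dom \<Gamma>'"
    "fv_trm P \<subseteq> env_dom \<Gamma>'" "fv_trm G \<subseteq> env_dom \<Gamma>'"
proof -
  show *: "env_dom \<Gamma> \<subseteq> env_dom \<Gamma>'" "env_dom \<Delta> \<subseteq> env_dom \<Gamma>'"
    using assms sub_environment_dom[of "\<Gamma> @ sub_env y P G \<Delta>" \<Gamma>'] unfolding cut_ctx_def by auto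
  show "fv_trm P \<subseteq> env_dom \<Gamma>'" "fv_trm G \<subseteq> env_dom \<Gamma>'"
    using assms typing_fv(2)[of \<A> \<R> \<Gamma> P G] * unfolding cut_ctx_def by blast+
qed

lemma cut_ctx_weaken: "cut_ctx \<A> \<R> \<Gamma> y P G \<Delta> \<Gamma>' \<Longrightarrow> has_type \<A> \<R> \<Gamma> M A \<Longrightarrow> has_type \<A> \<R> \<Gamma>' M A"
  by (rule weakening(1)[of \<Gamma>]) (auto simp: cut_ctx_def sub_environment_def)

lemma sub_environment_refl [simp]: "\<Gamma> \<sqsubseteq> \<Gamma>"
  unfolding sub_environment_def by auto

lemma cut_ctx_here: "has_type \<A> \<R> \<Gamma> P G \<Longrightarrow> cut_ctx \<A> \<R> \<Gamma> y P G [] \<Gamma>"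
  unfolding cut_ctx_def sub_env_def by (auto dest: wf_of(2))

lemma cut_ctx_snoc:
  assumes "cut_ctx \<A> \<R> \<Gamma> y P G \<Delta> \<Gamma>'" "has_type \<A> \<R> (\<Gamma> @ [(y, G)] @ \<Delta>) A (TSort s)" "x \<notin> env_dom \<Gamma>'"
  shows "cut_ctx \<A> \<R> \<Gamma> y P G (\<Delta> @ [(x, A)]) (\<Gamma>' @ [(x, TSub y P G A)])"
proof -
  have "wf_env \<A> \<R> (\<Gamma>' @ [(x, TSub y P G A)])" by (rule extend[OF cut_sort[OF assms(1,2)] assms(3)])
  then show ?thesis
    using assms(1) unfolding cut_ctx_def sub_environment_def sub_env_def by fastforce
qed

text \<open>Collects what is required to move a cut below a binder: \<open>Cut4\<close> types domain
  and codomain separately, and \<open>Pi_wf\<close> reassembles them. The capture conditions of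
  \<open>sub_pi\<close> hold since \<open>x\<close> is fresh for \<open>\<Gamma>'\<close>, which
  declares all free variables of \<open>P\<close> and \<open>G\<close>.\<close>

lemma cut_Pi:
  assumes cut: "cut_ctx \<A> \<R> \<Gamma> y P G \<Delta> \<Gamma>'" and x: "x \<notin> env_dom \<Gamma>'" "x \<noteq> y"
    and Pi: "has_type \<A> \<R> (\<Gamma> @ [(y, G)] @ \<Delta>) (TPi x A B) C"
  obtains s1 s2 s3 where
    "has_type \<A> \<R> (\<Gamma> @ [(y, G)] @ \<Delta>) A (TSort s1)"
    "has_type \<A> \<R> (\<Gamma> @ [(y, G)] @ \<Delta> @ [(x, A)]) B (TSort s2)"
    "tconv \<A> \<R> (\<Gamma> @ [(y, G)] @ \<Delta>) (TSort s3) C"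
    "cut_ctx \<A> \<R> \<Gamma> y P G (\<Delta> @ [(x, A)]) (\<Gamma>' @ [(x, TSub y P G A)])"
    "has_type \<A> \<R> (\<Gamma>' @ [(x, TSub y P G A)]) (TSub y P G B) (TSort s2)"
    "has_type \<A> \<R> \<Gamma>' (TPi x (TSub y P G A) (TSub y P G B)) (TSort s3)"
    "conv (TSub y P G (TPi x A B)) (TPi x (TSub y P G A) (TSub y P G B))"
proof -
  have "x \<notin> env_dom (\<Gamma> @ [(y, G)] @ \<Delta>)" using cut_ctx_dom[OF cut] x by auto
  from gen_Pi[OF Pi this] obtain s1 s2 s3 where *:
    "has_type \<A> \<R> (\<Gamma> @ [(y, G)] @ \<Delta>) A (TSort s1)"
    "has_type \<A> \<R> (\<Gamma> @ [(y, G)] @ \<Delta> @ [(x, A)]) B (TSort s2)"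
    "(s1, s2, s3) \<in> \<R>" "tconv \<A> \<R> (\<Gamma> @ [(y, G)] @ \<Delta>) (TSort s3) C" by auto
  note cut' = cut_ctx_snoc[OF cut *(1) x(1)]
  note B = cut_sort[OF cut' *(2)]
  note Pi' = Pi_wf[OF cut_sort[OF cut *(1)] B *(3)]
  have "red_trm (TSub y P G (TPi x A B)) (TPi x (TSub y P G A) (TSub y P G B))"
    by (rule sub_pi) (use x cut_ctx_dom[OF cut] in auto)
  then have "conv (TSub y P G (TPi x A B)) (TPi x (TSub y P G A) (TSub y P G B))"
    by (rule r_into_equivclp)
  from that[OF *(1,2,4) cut' B Pi' this] show thesis .
qed

lemma gen_cut:
  assumes "has_type \<A> \<R> \<Gamma>' (TSub y P G M) T" "y \<notin> env_dom \<Gamma>'"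
  obtains \<Gamma> \<Delta> C where "cut_ctx \<A> \<R> \<Gamma> y P G \<Delta> \<Gamma>'" "has_type \<A> \<R> (\<Gamma> @ [(y, G)] @ \<Delta>) M C"
    "tconv \<A> \<R> \<Gamma>' (sub_type y P G C) T"
  using gen_Sub[OF assms] unfolding cut_ctx_def by blast

lemma gen_cut_lst:
  assumes "lst_type \<A> \<R> \<Gamma>' B (LSub y P G l) C" "y \<notin> env_dom \<Gamma>'"
  obtains \<Gamma> \<Delta> B' C' sB sC where "cut_ctx \<A> \<R> \<Gamma> y P G \<Delta> \<Gamma>'"
    "lst_type \<A> \<R> (\<Gamma> @ [(y, G)] @ \<Delta>) B' l C'"
    "has_type \<A> \<R> (\<Gamma> @ [(y, G)] @ \<Delta>) B' (TSort sB)" "has_type \<A> \<R> (\<Gamma> @ [(y, G)] @ \<Delta>) C' (TSort sC)"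
    "tconv \<A> \<R> \<Gamma>' (TSub y P G B') B" "tconv \<A> \<R> \<Gamma>' (TSub y P G C') C"
proof -
  from gen_LSub[OF assms] obtain \<Gamma> \<Delta> B' C' where *: "cut_ctx \<A> \<R> \<Gamma> y P G \<Delta> \<Gamma>'"
    "lst_type \<A> \<R> (\<Gamma> @ [(y, G)] @ \<Delta>) B' l C'"
    "tconv \<A> \<R> \<Gamma>' (TSub y P G B') B" "tconv \<A> \<R> \<Gamma>' (TSub y P G C') C"
    unfolding cut_ctx_def by blast
  with type_correctness(3)[OF *(2)] that show thesis by blast
qed


section \<open>Subject reduction for the head rules\<close>

text \<open>The domain of the abstraction and the type at which \<open>N\<close> was checked are
  related only through \<open>C\<close>. Injectivity of \<open>TPi\<close> retypes \<open>N\<close>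
  at \<open>A\<close> and makes the type expected by \<open>l\<close> convertible to the type of the
  new substitution.\<close>

lemma sr_beta:
  assumes "has_type \<A> \<R> \<Gamma> (TCut (TLam x A M) (LCons N l)) T" "x \<notin> env_dom \<Gamma>"
  shows "has_type \<A> \<R> \<Gamma> (TCut (TSub x N A M) l) T"
proof -
  obtain C where C: "has_type \<A> \<R> \<Gamma> (TLam x A M) C" "lst_type \<A> \<R> \<Gamma> C (LCons N l) T"
    using gen_Cut[OF assms(1)] by blast
  obtain B s where B: "has_type \<A> \<R> \<Gamma> (TPi x A B) (TSort s)" "has_type \<A> \<R> (\<Gamma> @ [(x, A)]) M B"
    "tconv \<A> \<R> \<Gamma> (TPi x A B) C" using gen_Lam[OF C(1) assms(2)] by blast
  obtain A' D where D: "has_type \<A> \<R> \<Gamma> N A'" "lst_type \<A> \<R> \<Gamma> (TSub x N A' D) l T"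
    "tconv \<A> \<R> \<Gamma> (TPi x A' D) C" using gen_Cons[OF C(2) assms(2)] by blast
  have "conv (TPi x A B) (TPi x A' D)"
    by (rule equivclp_trans[OF tconv_conv[OF B(3)] equivclp_sym[OF tconv_conv[OF D(3)]]])
  note AB = conv_pi[OF this]
  obtain s1 s2 where A: "has_type \<A> \<R> \<Gamma> A (TSort s1)" "has_type \<A> \<R> (\<Gamma> @ [(x, A)]) B (TSort s2)"
    using gen_Pi[OF B(1) assms(2)] by blast
  have N: "has_type \<A> \<R> \<Gamma> N A" by (rule conv_R[OF D(1) A(1) equivclp_sym[OF AB(1)]])
  note cut = cut_ctx_here[OF N, of x]
  have "has_type \<A> \<R> \<Gamma> (TSub x N A M) (TSub x N A B)"
    by (rule cut_typed[OF cut]) (use B A in auto)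
  moreover have "has_type \<A> \<R> \<Gamma> (TSub x N A B) (TSort s2)"
    by (rule cut_sort[OF cut]) (use A in auto)
  then have "lst_type \<A> \<R> \<Gamma> (TSub x N A B) l T"
    by (rule conv_L[OF D(2)]) (intro conv_TSub equivclp_refl AB[THEN equivclp_sym])
  ultimately show ?thesis by (rule Cut3)
qed

lemma sr_sub_lam:
  assumes "has_type \<A> \<R> \<Gamma>' (TSub y P G (TLam x A M)) T" "y \<notin> env_dom \<Gamma>'" "x \<notin> env_dom \<Gamma>'" "x \<noteq> y"
  shows "has_type \<A> \<R> \<Gamma>' (TLam x (TSub y P G A) (TSub y P G M)) T"
proof -
  obtain \<Gamma> \<Delta> C where cut: "cut_ctx \<A> \<R> \<Gamma> y P G \<Delta> \<Gamma>'"
    and M: "has_type \<A> \<R> (\<Gamma> @ [(y, G)] @ \<Delta>) (TLam x A M) C"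
    and T: "tconv \<A> \<R> \<Gamma>' (sub_type y P G C) T" using assms(1,2) by (rule gen_cut)
  have "x \<notin> env_dom (\<Gamma> @ [(y, G)] @ \<Delta>)" using cut_ctx_dom[OF cut] assms by auto
  from gen_Lam[OF M this] obtain B s where B: "has_type \<A> \<R> (\<Gamma> @ [(y, G)] @ \<Delta>) (TPi x A B) (TSort s)"
    "has_type \<A> \<R> (\<Gamma> @ [(y, G)] @ \<Delta> @ [(x, A)]) M B"
    "tconv \<A> \<R> (\<Gamma> @ [(y, G)] @ \<Delta>) (TPi x A B) C" by auto
  obtain s2 s3 where *: "has_type \<A> \<R> (\<Gamma> @ [(y, G)] @ \<Delta> @ [(x, A)]) B (TSort s2)"
    "cut_ctx \<A> \<R> \<Gamma> y P G (\<Delta> @ [(x, A)]) (\<Gamma>' @ [(x, TSub y P G A)])"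
    "has_type \<A> \<R> \<Gamma>' (TPi x (TSub y P G A) (TSub y P G B)) (TSort s3)"
    "conv (TSub y P G (TPi x A B)) (TPi x (TSub y P G A) (TSub y P G B))"
    using cut_Pi[OF cut assms(3,4) B(1)] by metis
  have "has_type \<A> \<R> \<Gamma>' (TLam x (TSub y P G A) (TSub y P G M)) (TPi x (TSub y P G A) (TSub y P G B))"
    by (rule Pi_R[OF *(3) cut_typed[OF *(2) B(2) *(1)]])
  then have "has_type \<A> \<R> \<Gamma>' (TLam x (TSub y P G A) (TSub y P G M)) (TSub y P G (TPi x A B))"
    by (rule conv_R[OF _ cut_sort[OF cut B(1)] equivclp_sym[OF *(4)]])
  then show ?thesis
    by (rule has_type_tconv[OF has_type_tconv[OF _ cut_tconv[OF cut B(3), unfolded sub_type_Pi]] T])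
qed

lemma sr_sub_pi:
  assumes "has_type \<A> \<R> \<Gamma>' (TSub y P G (TPi x A B)) T" "y \<notin> env_dom \<Gamma>'" "x \<notin> env_dom \<Gamma>'" "x \<noteq> y"
  shows "has_type \<A> \<R> \<Gamma>' (TPi x (TSub y P G A) (TSub y P G B)) T"
proof -
  obtain \<Gamma> \<Delta> C where cut: "cut_ctx \<A> \<R> \<Gamma> y P G \<Delta> \<Gamma>'"
    and M: "has_type \<A> \<R> (\<Gamma> @ [(y, G)] @ \<Delta>) (TPi x A B) C"
    and T: "tconv \<A> \<R> \<Gamma>' (sub_type y P G C) T" using assms(1,2) by (rule gen_cut)
  obtain s3 where *: "tconv \<A> \<R> (\<Gamma> @ [(y, G)] @ \<Delta>) (TSort s3) C"
    "has_type \<A> \<R> \<Gamma>' (TPi x (TSub y P G A) (TSub y P G B)) (TSort s3)"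
    using cut_Pi[OF cut assms(3,4) M] by metis
  show ?thesis
    by (rule has_type_tconv[OF has_type_tconv[OF *(2) cut_tconv[OF cut *(1), unfolded sub_type_sort]] T])
qed

text \<open>Here the exception in \<open>Cut4\<close> pays off: \<open>sub_type\<close> leaves the
  sort \<open>s'\<close> alone, so \<open>sorted\<close> gives the right type even if
  \<open>s'\<close> is a top sort.\<close>

lemma sr_sub_sort:
  assumes "has_type \<A> \<R> \<Gamma>' (TSub y P G (TSort s)) T" "y \<notin> env_dom \<Gamma>'"
  shows "has_type \<A> \<R> \<Gamma>' (TSort s) T"
proof -
  obtain \<Gamma> \<Delta> C where cut: "cut_ctx \<A> \<R> \<Gamma> y P G \<Delta> \<Gamma>'"
    and M: "has_type \<A> \<R> (\<Gamma> @ [(y, G)] @ \<Delta>) (TSort s) C"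
    and T: "tconv \<A> \<R> \<Gamma>' (sub_type y P G C) T" using assms by (rule gen_cut)
  obtain s' where s': "(s, s') \<in> \<A>" "tconv \<A> \<R> (\<Gamma> @ [(y, G)] @ \<Delta>) (TSort s') C"
    using gen_sort[OF M] by blast
  have "has_type \<A> \<R> \<Gamma>' (TSort s) (TSort s')"
    using cut s'(1) unfolding cut_ctx_def by (intro sorted) auto
  then show ?thesis
    by (rule has_type_tconv[OF has_type_tconv[OF _ cut_tconv[OF cut s'(2), unfolded sub_type_sort]] T])
qed

text \<open>As \<open>y\<close> is declared once, the list starts from \<open>G\<close>. Since
  \<open>y\<close> is not free in \<open>G\<close>, substituting for it there is undone by
  conversion, and \<open>P\<close> weakens to \<open>\<Gamma>'\<close> at the same type.\<close>

lemma sr_sub_var_same: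
  assumes "has_type \<A> \<R> \<Gamma>' (TSub y P G (TVar y l)) T" "y \<notin> env_dom \<Gamma>'"
  shows "has_type \<A> \<R> \<Gamma>' (TCut P (LSub y P G l)) T"
proof -
  obtain \<Gamma> \<Delta> C where cut: "cut_ctx \<A> \<R> \<Gamma> y P G \<Delta> \<Gamma>'"
    and M: "has_type \<A> \<R> (\<Gamma> @ [(y, G)] @ \<Delta>) (TVar y l) C"
    and T: "tconv \<A> \<R> \<Gamma>' (sub_type y P G C) T" using assms by (rule gen_cut)
  obtain D where D: "(y, D) \<in> set (\<Gamma> @ [(y, G)] @ \<Delta>)" "lst_type \<A> \<R> (\<Gamma> @ [(y, G)] @ \<Delta>) D l C"
    using gen_Var[OF M] by blast
  have "D = G"
    using eq_key_imp_eq_value[OF wf_distinct[OF wf_of(2)[OF M]] D(1)] by simp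
  obtain s where G: "has_type \<A> \<R> \<Gamma> G (TSort s)" "y \<notin> env_dom \<Gamma>"
    using wf_of(2)[OF M] by (rule wf_middleE)
  obtain s' where C: "has_type \<A> \<R> (\<Gamma> @ [(y, G)] @ \<Delta>) C (TSort s')"
    using type_correctness(3)[OF D(2)] by blast
  have "y \<notin> fv_trm G" using typing_fv(2)[OF G(1)] G(2) by auto
  then have "lst_type \<A> \<R> \<Gamma>' G (LSub y P G l) (TSub y P G C)"
    by (rule conv_L[OF cut_lst[OF cut D(2)[unfolded \<open>D = G\<close>]] cut_ctx_weaken[OF cut G(1)] conv_sub_fresh])
  moreover have "has_type \<A> \<R> \<Gamma>' P G"
    using cut cut_ctx_weaken[OF cut] unfolding cut_ctx_def by blast
  ultimately have "has_type \<A> \<R> \<Gamma>' (TCut P (LSub y P G l)) (TSub y P G C)" by (rule Cut3[rotated])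
  then show ?thesis by (rule has_type_tconv[OF has_type_tconv[OF _ tconv_sub_type(1)[OF cut C]] T])
qed

lemma sr_sub_var_other:
  assumes "has_type \<A> \<R> \<Gamma>' (TSub y P G (TVar x l)) T" "y \<notin> env_dom \<Gamma>'" "x \<noteq> y"
  shows "has_type \<A> \<R> \<Gamma>' (TVar x (LSub y P G l)) T"
proof -
  obtain \<Gamma> \<Delta> C where cut: "cut_ctx \<A> \<R> \<Gamma> y P G \<Delta> \<Gamma>'"
    and M: "has_type \<A> \<R> (\<Gamma> @ [(y, G)] @ \<Delta>) (TVar x l) C"
    and T: "tconv \<A> \<R> \<Gamma>' (sub_type y P G C) T" using assms(1,2) by (rule gen_cut)
  obtain D where D: "(x, D) \<in> set (\<Gamma> @ [(y, G)] @ \<Delta>)" "lst_type \<A> \<R> (\<Gamma> @ [(y, G)] @ \<Delta>) D l C"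
    using gen_Var[OF M] by blast
  obtain s' where C: "has_type \<A> \<R> (\<Gamma> @ [(y, G)] @ \<Delta>) C (TSort s')"
    using type_correctness(3)[OF D(2)] by blast
  have env: "\<Gamma> @ sub_env y P G \<Delta> \<sqsubseteq> \<Gamma>'" "wf_env \<A> \<R> \<Gamma>'" using cut by (auto simp: cut_ctx_def)
  \<comment> \<open>A type declared in \<Gamma> cannot mention \<open>y\<close>, so its substituted
    form converts back to it; a type declared in \<Delta> already occurs substituted in
    \<open>sub_env y P G \<Delta>\<close>.\<close>
  have "\<exists>D'. (x, D') \<in> set \<Gamma>' \<and> conv (TSub y P G D) D'"
  proof (cases "(x, D) \<in> set \<Gamma>")
    case True
    then have "(x, D) \<in> set (\<Gamma> @ sub_env y P G \<Delta>)" by simp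
    then obtain D' where D': "(x, D') \<in> set \<Gamma>'" "conv D D'"
      using env unfolding sub_environment_def by blast
    have "fv_trm D \<subseteq> env_dom \<Gamma>"
      using env_fv[OF wf_prefix[OF wf_of(2)[OF M]] True] .
    then have "y \<notin> fv_trm D" using cut_ctx_dom(1)[OF cut] assms(2) by blast
    from equivclp_trans[OF conv_sub_fresh[OF this] D'(2)] D'(1) show ?thesis by blast
  next
    case False
    with D(1) assms(3) have "(x, D) \<in> set \<Delta>" by simp
    then have "(x, TSub y P G D) \<in> set (\<Gamma> @ sub_env y P G \<Delta>)" unfolding sub_env_def by force
    then show ?thesis using env unfolding sub_environment_def by blast
  qed
  then obtain D' where D': "(x, D') \<in> set \<Gamma>'" "conv (TSub y P G D) D'" by blast
  obtain s where "has_type \<A> \<R> \<Gamma>' D' (TSort s)" using wf_env_typed[OF env(2) D'(1)] by blast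
  from conv_L[OF cut_lst[OF cut D(2)] this D'(2)]
  have "has_type \<A> \<R> \<Gamma>' (TVar x (LSub y P G l)) (TSub y P G C)" using D'(1) by (rule select)
  then show ?thesis by (rule has_type_tconv[OF has_type_tconv[OF _ tconv_sub_type(1)[OF cut C]] T])
qed

lemma sr_sub_cut:
  assumes "has_type \<A> \<R> \<Gamma>' (TSub y P G (TCut M l)) T" "y \<notin> env_dom \<Gamma>'"
  shows "has_type \<A> \<R> \<Gamma>' (TCut (TSub y P G M) (LSub y P G l)) T"
proof -
  obtain \<Gamma> \<Delta> C where cut: "cut_ctx \<A> \<R> \<Gamma> y P G \<Delta> \<Gamma>'"
    and M: "has_type \<A> \<R> (\<Gamma> @ [(y, G)] @ \<Delta>) (TCut M l) C"
    and T: "tconv \<A> \<R> \<Gamma>' (sub_type y P G C) T" using assms by (rule gen_cut)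
  obtain A where A: "has_type \<A> \<R> (\<Gamma> @ [(y, G)] @ \<Delta>) M A" "lst_type \<A> \<R> (\<Gamma> @ [(y, G)] @ \<Delta>) A l C"
    using gen_Cut[OF M] by blast
  obtain s s' where s: "has_type \<A> \<R> (\<Gamma> @ [(y, G)] @ \<Delta>) A (TSort s)"
    "has_type \<A> \<R> (\<Gamma> @ [(y, G)] @ \<Delta>) C (TSort s')"
    using type_correctness(3)[OF A(2)] by blast
  have "has_type \<A> \<R> \<Gamma>' (TCut (TSub y P G M) (LSub y P G l)) (TSub y P G C)"
    by (rule Cut3[OF cut_typed[OF cut A(1) s(1)] cut_lst[OF cut A(2)]])
  then show ?thesis by (rule has_type_tconv[OF has_type_tconv[OF _ tconv_sub_type(1)[OF cut s(2)]] T])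
qed

lemma sr_sub_nil:
  assumes "lst_type \<A> \<R> \<Gamma>' B (LSub y P G LNil) C" "y \<notin> env_dom \<Gamma>'"
  shows "lst_type \<A> \<R> \<Gamma>' B LNil C"
proof -
  obtain \<Gamma> \<Delta> B' C' sB sC where cut: "cut_ctx \<A> \<R> \<Gamma> y P G \<Delta> \<Gamma>'"
    and l: "lst_type \<A> \<R> (\<Gamma> @ [(y, G)] @ \<Delta>) B' LNil C'"
    and s: "has_type \<A> \<R> (\<Gamma> @ [(y, G)] @ \<Delta>) B' (TSort sB)"
      "has_type \<A> \<R> (\<Gamma> @ [(y, G)] @ \<Delta>) C' (TSort sC)"
    and T: "tconv \<A> \<R> \<Gamma>' (TSub y P G B') B" "tconv \<A> \<R> \<Gamma>' (TSub y P G C') C"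
    using assms by (rule gen_cut_lst)
  have "lst_type \<A> \<R> \<Gamma>' (TSub y P G B') LNil (TSub y P G B')"
    by (rule axiom[OF cut_sort[OF cut s(1)]])
  then have "lst_type \<A> \<R> \<Gamma>' (TSub y P G B') LNil (TSub y P G C')"
    by (rule lst_type_tconv[OF _ tconv_refl tconv_TSub[OF cut gen_Nil[OF l] s(2)]])
  then show ?thesis by (rule lst_type_tconv[OF _ T])
qed

lemma sr_sub_app:
  assumes "lst_type \<A> \<R> \<Gamma>' B (LSub y P G (LApp l l')) C" "y \<notin> env_dom \<Gamma>'"
  shows "lst_type \<A> \<R> \<Gamma>' B (LApp (LSub y P G l) (LSub y P G l')) C"
proof -
  obtain \<Gamma> \<Delta> B' C' sB sC where cut: "cut_ctx \<A> \<R> \<Gamma> y P G \<Delta> \<Gamma>'"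
    and l: "lst_type \<A> \<R> (\<Gamma> @ [(y, G)] @ \<Delta>) B' (LApp l l') C'"
    and s: "has_type \<A> \<R> (\<Gamma> @ [(y, G)] @ \<Delta>) B' (TSort sB)"
      "has_type \<A> \<R> (\<Gamma> @ [(y, G)] @ \<Delta>) C' (TSort sC)"
    and T: "tconv \<A> \<R> \<Gamma>' (TSub y P G B') B" "tconv \<A> \<R> \<Gamma>' (TSub y P G C') C"
    using assms by (rule gen_cut_lst)
  obtain A where A: "lst_type \<A> \<R> (\<Gamma> @ [(y, G)] @ \<Delta>) B' l A" "lst_type \<A> \<R> (\<Gamma> @ [(y, G)] @ \<Delta>) A l' C'"
    using gen_App[OF l] by blast
  from Cut1[OF cut_lst[OF cut A(1)] cut_lst[OF cut A(2)]] T show ?thesis by (rule lst_type_tconv)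
qed

text \<open>The place where substitutions must commute: \<open>Cut2\<close> types the tail at
  \<open>TSub y P G (TSub x M A D)\<close>, whereas \<open>Pi_L\<close> expects the substitution for
  \<open>x\<close> outermost. \<open>conv_sub_sub\<close> bridges the two, and the target has a sort
  by a cut on the substituted codomain.\<close>

lemma sr_sub_cons:
  assumes "lst_type \<A> \<R> \<Gamma>' B (LSub y P G (LCons M l)) C" "y \<notin> env_dom \<Gamma>'"
  shows "lst_type \<A> \<R> \<Gamma>' B (LCons (TSub y P G M) (LSub y P G l)) C"
proof -
  obtain \<Gamma> \<Delta> B' C' sB sC where cut: "cut_ctx \<A> \<R> \<Gamma> y P G \<Delta> \<Gamma>'"
    and l: "lst_type \<A> \<R> (\<Gamma> @ [(y, G)] @ \<Delta>) B' (LCons M l) C'"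
    and s: "has_type \<A> \<R> (\<Gamma> @ [(y, G)] @ \<Delta>) B' (TSort sB)"
      "has_type \<A> \<R> (\<Gamma> @ [(y, G)] @ \<Delta>) C' (TSort sC)"
    and T: "tconv \<A> \<R> \<Gamma>' (TSub y P G B') B" "tconv \<A> \<R> \<Gamma>' (TSub y P G C') C"
    using assms by (rule gen_cut_lst)
  have "finite (insert y (env_dom \<Gamma>'))" by simp
  then obtain x where "x \<notin> insert y (env_dom \<Gamma>')" by (rule obtain_fresh)
  then have x: "x \<notin> env_dom \<Gamma>'" "x \<noteq> y" by auto
  have "x \<notin> env_dom (\<Gamma> @ [(y, G)] @ \<Delta>)" using cut_ctx_dom[OF cut] x by auto
  from gen_Cons[OF l this] obtain A D s where D: "has_type \<A> \<R> (\<Gamma> @ [(y, G)] @ \<Delta>) (TPi x A D) (TSort s)"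
    "has_type \<A> \<R> (\<Gamma> @ [(y, G)] @ \<Delta>) M A" "lst_type \<A> \<R> (\<Gamma> @ [(y, G)] @ \<Delta>) (TSub x M A D) l C'"
    "tconv \<A> \<R> (\<Gamma> @ [(y, G)] @ \<Delta>) (TPi x A D) B'" by blast
  obtain s1 s2 s3 where *: "has_type \<A> \<R> (\<Gamma> @ [(y, G)] @ \<Delta>) A (TSort s1)"
    "has_type \<A> \<R> (\<Gamma>' @ [(x, TSub y P G A)]) (TSub y P G D) (TSort s2)"
    "has_type \<A> \<R> \<Gamma>' (TPi x (TSub y P G A) (TSub y P G D)) (TSort s3)"
    "conv (TSub y P G (TPi x A D)) (TPi x (TSub y P G A) (TSub y P G D))"
    using cut_Pi[OF cut x D(1)] by metis
  have M: "has_type \<A> \<R> \<Gamma>' (TSub y P G M) (TSub y P G A)" by (rule cut_typed[OF cut D(2) *(1)])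
  have "x \<notin> fv_trm P" using cut_ctx_dom[OF cut] x by blast
  then have conv: "conv (TSub y P G (TSub x M A D)) (TSub x (TSub y P G M) (TSub y P G A) (TSub y P G D))"
    by (rule conv_sub_sub[OF x(2)])
  have "has_type \<A> \<R> \<Gamma>' (TSub x (TSub y P G M) (TSub y P G A) (TSub y P G D)) (TSort s2)"
    by (rule cut_sort[OF cut_ctx_here[OF M]]) (use *(2) in simp)
  from conv_L[OF cut_lst[OF cut D(3)] this conv]
  have "lst_type \<A> \<R> \<Gamma>' (TPi x (TSub y P G A) (TSub y P G D))
      (LCons (TSub y P G M) (LSub y P G l)) (TSub y P G C')"
    by (rule Pi_L[OF *(3) M])
  moreover have "conv (TPi x (TSub y P G A) (TSub y P G D)) (TSub y P G B')"
    by (rule equivclp_trans[OF equivclp_sym[OF *(4)]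
      conv_TSub[OF equivclp_refl equivclp_refl tconv_conv[OF D(4)]]])
  ultimately have "lst_type \<A> \<R> \<Gamma>' (TSub y P G B') (LCons (TSub y P G M) (LSub y P G l)) (TSub y P G C')"
    by (rule conv_L[OF _ cut_sort[OF cut s(1)]])
  then show ?thesis by (rule lst_type_tconv[OF _ T])
qed

lemma sr_cut_nil:
  assumes "has_type \<A> \<R> \<Gamma> (TCut M LNil) T"
  shows "has_type \<A> \<R> \<Gamma> M T"
proof -
  obtain A where A: "has_type \<A> \<R> \<Gamma> M A" "lst_type \<A> \<R> \<Gamma> A LNil T" using gen_Cut[OF assms] by blast
  obtain s where "has_type \<A> \<R> \<Gamma> T (TSort s)" using type_correctness(3)[OF A(2)] by blast
  from conv_R[OF A(1) this gen_Nil[OF A(2)]] show ?thesis .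
qed

lemma sr_app_cons:
  assumes "lst_type \<A> \<R> \<Gamma> B (LApp (LCons M l') l) C"
  shows "lst_type \<A> \<R> \<Gamma> B (LCons M (LApp l' l)) C"
proof -
  obtain A where A: "lst_type \<A> \<R> \<Gamma> B (LCons M l') A" "lst_type \<A> \<R> \<Gamma> A l C"
    using gen_App[OF assms] by blast
  obtain x where x: "x \<notin> env_dom \<Gamma>" using obtain_fresh[of "env_dom \<Gamma>"] by auto
  from gen_Cons[OF A(1) x] obtain D E s where D: "has_type \<A> \<R> \<Gamma> (TPi x D E) (TSort s)"
    "has_type \<A> \<R> \<Gamma> M D"
    "lst_type \<A> \<R> \<Gamma> (TSub x M D E) l' A" "tconv \<A> \<R> \<Gamma> (TPi x D E) B" by blast
  have "lst_type \<A> \<R> \<Gamma> (TPi x D E) (LCons M (LApp l' l)) C"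
    by (rule Pi_L[OF D(1,2) Cut1[OF D(3) A(2)]])
  then show ?thesis by (rule lst_type_tconv[OF _ D(4) tconv_refl])
qed

lemma sr_app_nil_left:
  assumes "lst_type \<A> \<R> \<Gamma> B (LApp LNil l) C"
  shows "lst_type \<A> \<R> \<Gamma> B l C"
proof -
  obtain A where A: "lst_type \<A> \<R> \<Gamma> B LNil A" "lst_type \<A> \<R> \<Gamma> A l C" using gen_App[OF assms] by blast
  obtain s where "has_type \<A> \<R> \<Gamma> B (TSort s)" using type_correctness(3)[OF A(1)] by blast
  from conv_L[OF A(2) this equivclp_sym[OF gen_Nil[OF A(1)]]] show ?thesis .
qed

lemma sr_app_nil_right:
  assumes "lst_type \<A> \<R> \<Gamma> B (LApp l LNil) C"
  shows "lst_type \<A> \<R> \<Gamma> B l C"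
proof -
  obtain A where A: "lst_type \<A> \<R> \<Gamma> B l A" "lst_type \<A> \<R> \<Gamma> A LNil C" using gen_App[OF assms] by blast
  obtain s where "has_type \<A> \<R> \<Gamma> C (TSort s)" using type_correctness(3)[OF A(2)] by blast
  from conv_R'[OF A(1) this gen_Nil[OF A(2)]] show ?thesis .
qed

section \<open>Subject reduction under contexts\<close>

lemma has_type_snoc_conv:
  assumes "has_type \<A> \<R> (\<Gamma> @ [(x, A)]) M B" "has_type \<A> \<R> \<Gamma> A' (TSort s)" "conv A A'"
  shows "has_type \<A> \<R> (\<Gamma> @ [(x, A')]) M B"
proof (rule weakening(1)[OF _ _ assms(1)])
  show "\<Gamma> @ [(x, A)] \<sqsubseteq> \<Gamma> @ [(x, A')]" using assms(3) unfolding sub_environment_def by auto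
  have "x \<notin> env_dom \<Gamma>" using wf_of(2)[OF assms(1)] by (rule wf_snocE)
  with assms(2) show "wf_env \<A> \<R> (\<Gamma> @ [(x, A')])" by (rule extend)
qed

text \<open>Each later type is retyped by weakening along \<sqsubseteq>, whose target is well formed
  by the induction hypothesis.\<close>

lemma wf_env_conv:
  assumes "has_type \<A> \<R> \<Gamma> A' (TSort s)" "conv A A'" "wf_env \<A> \<R> (\<Gamma> @ [(x, A)] @ \<Delta>)"
  shows "wf_env \<A> \<R> (\<Gamma> @ [(x, A')] @ \<Delta>)"
  using assms(3)
proof (induction \<Delta> rule: rev_induct)
  case Nil
  then have "x \<notin> env_dom \<Gamma>" by (auto elim: wf_snocE)
  with assms(1) show ?case by (auto intro: extend)
next
  case (snoc d \<Delta>)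
  obtain y B where d: "d = (y, B)" by (cases d)
  with snoc.prems have wf: "wf_env \<A> \<R> ((\<Gamma> @ [(x, A)] @ \<Delta>) @ [(y, B)])" by simp
  then obtain s' where B: "has_type \<A> \<R> (\<Gamma> @ [(x, A)] @ \<Delta>) B (TSort s')"
    and y: "y \<notin> env_dom (\<Gamma> @ [(x, A)] @ \<Delta>)" by (rule wf_snocE)
  have "\<Gamma> @ [(x, A)] @ \<Delta> \<sqsubseteq> \<Gamma> @ [(x, A')] @ \<Delta>" using assms(2) unfolding sub_environment_def by auto
  from weakening(1)[OF this snoc.IH[OF wf_of(2)[OF B]] B]
  have "has_type \<A> \<R> (\<Gamma> @ [(x, A')] @ \<Delta>) B (TSort s')" .
  then have "wf_env \<A> \<R> ((\<Gamma> @ [(x, A')] @ \<Delta>) @ [(y, B)])" by (rule extend) (use y in simp)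
  then show ?case by (simp add: d)
qed

lemma cut_ctx_conv:
  assumes "cut_ctx \<A> \<R> \<Gamma> y P G \<Delta> \<Gamma>'" "has_type \<A> \<R> \<Gamma> P' G'" "conv P P'" "conv G G'"
  shows "cut_ctx \<A> \<R> \<Gamma> y P' G' \<Delta> \<Gamma>'"
proof -
  have "\<Gamma> @ sub_env y P' G' \<Delta> \<sqsubseteq> \<Gamma> @ sub_env y P G \<Delta>"
    unfolding sub_environment_def
  proof (intro allI impI)
    fix x A assume "(x, A) \<in> set (\<Gamma> @ sub_env y P' G' \<Delta>)"
    then consider "(x, A) \<in> set \<Gamma>" | B where "(x, B) \<in> set \<Delta>" "A = TSub y P' G' B"
      by (auto simp: sub_env_def)
    then show "\<exists>B. (x, B) \<in> set (\<Gamma> @ sub_env y P G \<Delta>) \<and> conv A B"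
    proof cases
      case 1
      then show ?thesis by auto
    next
      case 2
      have "conv A (TSub y P G B)"
        unfolding 2 by (intro conv_TSub equivclp_refl assms(3,4)[THEN equivclp_sym])
      moreover have "(x, TSub y P G B) \<in> set (\<Gamma> @ sub_env y P G \<Delta>)"
        using 2 unfolding sub_env_def by force
      ultimately show ?thesis by blast
    qed
  qed
  then show ?thesis
    using assms(1,2) sub_environment_trans unfolding cut_ctx_def by blast
qed

text \<open>The type of a cut mentions \<open>P\<close> and \<open>G\<close> and changes along with
  them. It converts back to the original, which is sorted by the original cut; a sort as type stays
  literally the same.\<close>

lemma sub_type_conv_annot:
  assumes "cut_ctx \<A> \<R> \<Gamma> y P G \<Delta> \<Gamma>'" "has_type \<A> \<R> (\<Gamma> @ [(y, G)] @ \<Delta>) M C"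
    "conv P P'" "conv G G'"
  shows "tconv \<A> \<R> \<Gamma>' (sub_type y P' G' C) (sub_type y P G C)"
proof (cases "C \<in> range TSort")
  case True
  then show ?thesis by auto
next
  case False
  with type_correctness(2)[OF assms(2)] obtain s where
    "has_type \<A> \<R> (\<Gamma> @ [(y, G)] @ \<Delta>) C (TSort s)" by blast
  from cut_sort[OF assms(1) this] have "has_type \<A> \<R> \<Gamma>' (TSub y P G C) (TSort s)" .
  moreover have "conv (TSub y P' G' C) (TSub y P G C)"
    by (intro conv_TSub equivclp_refl assms(3,4)[THEN equivclp_sym])
  ultimately show ?thesis using False unfolding tconv_def sub_type_def by auto
qed

text \<open>Quantifying over environment and type makes the relation invariant under swapping and
  applicable to the premises found by inversion.\<close>

definition sr_trm :: "('s \<times> 's) set \<Rightarrow> ('s \<times> 's \<times> 's) set \<Rightarrow> 's trm \<Rightarrow> 's trm \<Rightarrow> bool" where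
  "sr_trm \<A> \<R> M M' \<longleftrightarrow> (\<forall>\<Gamma> A. has_type \<A> \<R> \<Gamma> M A \<longrightarrow> has_type \<A> \<R> \<Gamma> M' A)"

definition sr_lst :: "('s \<times> 's) set \<Rightarrow> ('s \<times> 's \<times> 's) set \<Rightarrow> 's lst \<Rightarrow> 's lst \<Rightarrow> bool" where
  "sr_lst \<A> \<R> l l' \<longleftrightarrow> (\<forall>\<Gamma> B C. lst_type \<A> \<R> \<Gamma> B l C \<longrightarrow> lst_type \<A> \<R> \<Gamma> B l' C)"

lemma sr_trmI: "(\<And>\<Gamma> A. has_type \<A> \<R> \<Gamma> M A \<Longrightarrow> has_type \<A> \<R> \<Gamma> M' A) \<Longrightarrow> sr_trm \<A> \<R> M M'"
  by (simp add: sr_trm_def)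

lemma sr_lstI: "(\<And>\<Gamma> B C. lst_type \<A> \<R> \<Gamma> B l C \<Longrightarrow> lst_type \<A> \<R> \<Gamma> B l' C) \<Longrightarrow> sr_lst \<A> \<R> l l'"
  by (simp add: sr_lst_def)

lemma sr_trmD: "sr_trm \<A> \<R> M M' \<Longrightarrow> has_type \<A> \<R> \<Gamma> M A \<Longrightarrow> has_type \<A> \<R> \<Gamma> M' A"
  by (simp add: sr_trm_def)

lemma sr_lstD: "sr_lst \<A> \<R> l l' \<Longrightarrow> lst_type \<A> \<R> \<Gamma> B l C \<Longrightarrow> lst_type \<A> \<R> \<Gamma> B l' C"
  by (simp add: sr_lst_def)

text \<open>After a binder is renamed, the induction hypothesis is required for the swapped body. A
  swap is an involution, so typing can be moved to the original body and back.\<close>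

lemma sr_swap:
  "sr_trm \<A> \<R> M M' \<Longrightarrow> sr_trm \<A> \<R> (swap_trm a b M) (swap_trm a b M')"
  "sr_lst \<A> \<R> l l' \<Longrightarrow> sr_lst \<A> \<R> (swap_lst a b l) (swap_lst a b l')"
proof -
  assume sr: "sr_trm \<A> \<R> M M'"
  show "sr_trm \<A> \<R> (swap_trm a b M) (swap_trm a b M')"
  proof (rule sr_trmI)
    fix \<Gamma> A assume "has_type \<A> \<R> \<Gamma> (swap_trm a b M) A"
    from typing_swap(2)[OF this, of a b]
    have "has_type \<A> \<R> (sw_env a b \<Gamma>) M (swap_trm a b A)" by simp
    from typing_swap(2)[OF sr_trmD[OF sr this], of a b]
    show "has_type \<A> \<R> \<Gamma> (swap_trm a b M') A" by simp
  qed
next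
  assume sr: "sr_lst \<A> \<R> l l'"
  show "sr_lst \<A> \<R> (swap_lst a b l) (swap_lst a b l')"
  proof (rule sr_lstI)
    fix \<Gamma> B C assume "lst_type \<A> \<R> \<Gamma> B (swap_lst a b l) C"
    from typing_swap(3)[OF this, of a b]
    have "lst_type \<A> \<R> (sw_env a b \<Gamma>) (swap_trm a b B) l (swap_trm a b C)" by simp
    from typing_swap(3)[OF sr_lstD[OF sr this], of a b]
    show "lst_type \<A> \<R> \<Gamma> B (swap_lst a b l') C" by simp
  qed
qed

section \<open>Preservation of typing by each contextual rule\<close>

lemma sr_pi1:
  assumes "sr_trm \<A> \<R> A A'" "red_trm A A'" "has_type \<A> \<R> \<Gamma> (TPi x A B) T" "x \<notin> env_dom \<Gamma>"
  shows "has_type \<A> \<R> \<Gamma> (TPi x A' B) T"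
proof -
  obtain s1 s2 s3 where *: "has_type \<A> \<R> \<Gamma> A (TSort s1)" "has_type \<A> \<R> (\<Gamma> @ [(x, A)]) B (TSort s2)"
    "(s1, s2, s3) \<in> \<R>" "tconv \<A> \<R> \<Gamma> (TSort s3) T" using gen_Pi[OF assms(3,4)] by blast
  note A' = sr_trmD[OF assms(1) *(1)]
  show ?thesis
    by (rule has_type_tconv[OF Pi_wf[OF A' has_type_snoc_conv[OF *(2) A' r_into_equivclp] *(3)] *(4)])
      (rule assms(2))
qed

lemma sr_pi2:
  assumes "sr_trm \<A> \<R> B B'" "has_type \<A> \<R> \<Gamma> (TPi x A B) T" "x \<notin> env_dom \<Gamma>"
  shows "has_type \<A> \<R> \<Gamma> (TPi x A B') T"
proof -
  obtain s1 s2 s3 where *: "has_type \<A> \<R> \<Gamma> A (TSort s1)" "has_type \<A> \<R> (\<Gamma> @ [(x, A)]) B (TSort s2)"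
    "(s1, s2, s3) \<in> \<R>" "tconv \<A> \<R> \<Gamma> (TSort s3) T" using gen_Pi[OF assms(2,3)] by blast
  show ?thesis
    by (rule has_type_tconv[OF Pi_wf[OF *(1) sr_trmD[OF assms(1) *(2)] *(3)] *(4)])
qed

lemma sr_lam1:
  assumes "sr_trm \<A> \<R> A A'" "red_trm A A'" "has_type \<A> \<R> \<Gamma> (TLam x A M) T" "x \<notin> env_dom \<Gamma>"
  shows "has_type \<A> \<R> \<Gamma> (TLam x A' M) T"
proof -
  obtain B s where B: "has_type \<A> \<R> \<Gamma> (TPi x A B) (TSort s)" "has_type \<A> \<R> (\<Gamma> @ [(x, A)]) M B"
    "tconv \<A> \<R> \<Gamma> (TPi x A B) T" using gen_Lam[OF assms(3,4)] by blast
  obtain s1 where "has_type \<A> \<R> \<Gamma> A (TSort s1)" using gen_Pi[OF B(1) assms(4)] by blast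
  note A' = sr_trmD[OF assms(1) this]
  have conv: "conv A A'" using assms(2) by (rule r_into_equivclp)
  have "has_type \<A> \<R> \<Gamma> (TLam x A' M) (TPi x A' B)"
    by (rule Pi_R[OF sr_pi1[OF assms(1,2) B(1) assms(4)] has_type_snoc_conv[OF B(2) A' conv]])
  then have "has_type \<A> \<R> \<Gamma> (TLam x A' M) (TPi x A B)"
    by (rule conv_R[OF _ B(1)]) (intro conv_TPi equivclp_refl equivclp_sym[OF conv])
  then show ?thesis using B(3) by (rule has_type_tconv)
qed

lemma sr_lam2:
  assumes "sr_trm \<A> \<R> M M'" "has_type \<A> \<R> \<Gamma> (TLam x A M) T" "x \<notin> env_dom \<Gamma>"
  shows "has_type \<A> \<R> \<Gamma> (TLam x A M') T"
proof -
  obtain B s where B: "has_type \<A> \<R> \<Gamma> (TPi x A B) (TSort s)" "has_type \<A> \<R> (\<Gamma> @ [(x, A)]) M B"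
    "tconv \<A> \<R> \<Gamma> (TPi x A B) T" using gen_Lam[OF assms(2,3)] by blast
  show ?thesis by (rule has_type_tconv[OF Pi_R[OF B(1) sr_trmD[OF assms(1) B(2)]] B(3)])
qed

text \<open>The head \<open>M\<close> also occurs in the type of the tail, so that type is converted
  along with it; a cut on the codomain gives the new type its sort.\<close>

lemma sr_cons1:
  assumes "sr_trm \<A> \<R> M M'" "red_trm M M'" "lst_type \<A> \<R> \<Gamma> B (LCons M l) C"
  shows "lst_type \<A> \<R> \<Gamma> B (LCons M' l) C"
proof -
  have "finite (env_dom \<Gamma>)" by simp
  then obtain x where x: "x \<notin> env_dom \<Gamma>" by (rule obtain_fresh)
  from gen_Cons[OF assms(3) x] obtain A D s where *: "has_type \<A> \<R> \<Gamma> (TPi x A D) (TSort s)"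
    "has_type \<A> \<R> \<Gamma> M A" "lst_type \<A> \<R> \<Gamma> (TSub x M A D) l C" "tconv \<A> \<R> \<Gamma> (TPi x A D) B" by blast
  note M' = sr_trmD[OF assms(1) *(2)]
  obtain s2 where "has_type \<A> \<R> (\<Gamma> @ [(x, A)]) D (TSort s2)" using gen_Pi[OF *(1) x] by blast
  then have "has_type \<A> \<R> \<Gamma> (TSub x M' A D) (TSort s2)" by (intro cut_sort[OF cut_ctx_here[OF M']]) simp
  moreover have "conv (TSub x M A D) (TSub x M' A D)"
    by (intro conv_TSub equivclp_refl r_into_equivclp assms(2))
  ultimately have "lst_type \<A> \<R> \<Gamma> (TSub x M' A D) l C" by (rule conv_L[OF *(3)])
  from Pi_L[OF *(1) M' this] show ?thesis by (rule lst_type_tconv[OF _ *(4) tconv_refl])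
qed

lemma sr_cons2:
  assumes "sr_lst \<A> \<R> l l'" "lst_type \<A> \<R> \<Gamma> B (LCons M l) C"
  shows "lst_type \<A> \<R> \<Gamma> B (LCons M l') C"
proof -
  have "finite (env_dom \<Gamma>)" by simp
  then obtain x where x: "x \<notin> env_dom \<Gamma>" by (rule obtain_fresh)
  from gen_Cons[OF assms(2) x] obtain A D s where *: "has_type \<A> \<R> \<Gamma> (TPi x A D) (TSort s)"
    "has_type \<A> \<R> \<Gamma> M A" "lst_type \<A> \<R> \<Gamma> (TSub x M A D) l C" "tconv \<A> \<R> \<Gamma> (TPi x A D) B" by blast
  from Pi_L[OF *(1,2) sr_lstD[OF assms(1) *(3)]] show ?thesis
    by (rule lst_type_tconv[OF _ *(4) tconv_refl])
qed

lemma sr_sub3: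
  assumes "sr_trm \<A> \<R> M M'" "has_type \<A> \<R> \<Gamma>' (TSub y P G M) T" "y \<notin> env_dom \<Gamma>'"
  shows "has_type \<A> \<R> \<Gamma>' (TSub y P G M') T"
proof -
  obtain \<Gamma> \<Delta> C where cut: "cut_ctx \<A> \<R> \<Gamma> y P G \<Delta> \<Gamma>'"
    and M: "has_type \<A> \<R> (\<Gamma> @ [(y, G)] @ \<Delta>) M C"
    and T: "tconv \<A> \<R> \<Gamma>' (sub_type y P G C) T" using assms(2,3) by (rule gen_cut)
  show ?thesis by (rule has_type_tconv[OF cut_trm[OF cut sr_trmD[OF assms(1) M]] T])
qed

lemma sr_subl3:
  assumes "sr_lst \<A> \<R> l l'" "lst_type \<A> \<R> \<Gamma>' B (LSub y P G l) C" "y \<notin> env_dom \<Gamma>'"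
  shows "lst_type \<A> \<R> \<Gamma>' B (LSub y P G l') C"
proof -
  obtain \<Gamma> \<Delta> B' C' sB sC where cut: "cut_ctx \<A> \<R> \<Gamma> y P G \<Delta> \<Gamma>'"
    and l: "lst_type \<A> \<R> (\<Gamma> @ [(y, G)] @ \<Delta>) B' l C'"
    and T: "tconv \<A> \<R> \<Gamma>' (TSub y P G B') B" "tconv \<A> \<R> \<Gamma>' (TSub y P G C') C"
    using assms(2,3) by (rule gen_cut_lst)
  show ?thesis by (rule lst_type_tconv[OF cut_lst[OF cut sr_lstD[OF assms(1) l]] T])
qed

text \<open>Changing both arguments together serves a step in either of them, with
  \<open>sr_refl\<close> for the other. As \<open>y\<close> is now declared with \<open>G'\<close>,
  the reduct of \<open>P\<close> is retyped at \<open>G'\<close>.\<close>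

lemma cut_ctx_red:
  assumes cut: "cut_ctx \<A> \<R> \<Gamma> y P G \<Delta> \<Gamma>'" and wf: "wf_env \<A> \<R> (\<Gamma> @ [(y, G)] @ \<Delta>)"
    and P: "sr_trm \<A> \<R> P P'" "conv P P'" and G: "sr_trm \<A> \<R> G G'" "conv G G'"
  shows "cut_ctx \<A> \<R> \<Gamma> y P' G' \<Delta> \<Gamma>'" "\<Gamma> @ [(y, G)] @ \<Delta> \<sqsubseteq> \<Gamma> @ [(y, G')] @ \<Delta>"
    "wf_env \<A> \<R> (\<Gamma> @ [(y, G')] @ \<Delta>)"
proof -
  obtain s where "has_type \<A> \<R> \<Gamma> G (TSort s)" using wf by (rule wf_middleE)
  note G' = sr_trmD[OF G(1) this]
  have "has_type \<A> \<R> \<Gamma> P G" using cut unfolding cut_ctx_def by blast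
  note P' = conv_R[OF sr_trmD[OF P(1) this] G' G(2)]
  show "cut_ctx \<A> \<R> \<Gamma> y P' G' \<Delta> \<Gamma>'" by (rule cut_ctx_conv[OF cut P' P(2) G(2)])
  show "\<Gamma> @ [(y, G)] @ \<Delta> \<sqsubseteq> \<Gamma> @ [(y, G')] @ \<Delta>" using G(2) unfolding sub_environment_def by auto
  show "wf_env \<A> \<R> (\<Gamma> @ [(y, G')] @ \<Delta>)" by (rule wf_env_conv[OF G' G(2) wf])
qed

lemma sr_sub12:
  assumes P: "sr_trm \<A> \<R> P P'" "conv P P'" and G: "sr_trm \<A> \<R> G G'" "conv G G'"
    and "has_type \<A> \<R> \<Gamma>' (TSub y P G M) T" "y \<notin> env_dom \<Gamma>'"
  shows "has_type \<A> \<R> \<Gamma>' (TSub y P' G' M) T"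
proof -
  obtain \<Gamma> \<Delta> C where cut: "cut_ctx \<A> \<R> \<Gamma> y P G \<Delta> \<Gamma>'"
    and M: "has_type \<A> \<R> (\<Gamma> @ [(y, G)] @ \<Delta>) M C"
    and T: "tconv \<A> \<R> \<Gamma>' (sub_type y P G C) T" using assms(5,6) by (rule gen_cut)
  note cut' = cut_ctx_red[OF cut wf_of(2)[OF M] P G]
  have "has_type \<A> \<R> \<Gamma>' (TSub y P' G' M) (sub_type y P' G' C)"
    by (rule cut_trm[OF cut'(1) weakening(1)[OF cut'(2,3) M]])
  then show ?thesis
    by (rule has_type_tconv[OF has_type_tconv[OF _ sub_type_conv_annot[OF cut M P(2) G(2)]] T])
qed

lemma sr_subl12:
  assumes P: "sr_trm \<A> \<R> P P'" "conv P P'" and G: "sr_trm \<A> \<R> G G'" "conv G G'"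
    and "lst_type \<A> \<R> \<Gamma>' B (LSub y P G l) C" "y \<notin> env_dom \<Gamma>'"
  shows "lst_type \<A> \<R> \<Gamma>' B (LSub y P' G' l) C"
proof -
  obtain \<Gamma> \<Delta> B' C' sB sC where cut: "cut_ctx \<A> \<R> \<Gamma> y P G \<Delta> \<Gamma>'"
    and l: "lst_type \<A> \<R> (\<Gamma> @ [(y, G)] @ \<Delta>) B' l C'"
    and s: "has_type \<A> \<R> (\<Gamma> @ [(y, G)] @ \<Delta>) B' (TSort sB)"
      "has_type \<A> \<R> (\<Gamma> @ [(y, G)] @ \<Delta>) C' (TSort sC)"
    and T: "tconv \<A> \<R> \<Gamma>' (TSub y P G B') B" "tconv \<A> \<R> \<Gamma>' (TSub y P G C') C"
    using assms(5,6) by (rule gen_cut_lst)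
  note cut' = cut_ctx_red[OF cut wf_of(3)[OF l] P G]
  have "tconv \<A> \<R> \<Gamma>' (TSub y P' G' D) (TSub y P G D)"
    if "has_type \<A> \<R> (\<Gamma> @ [(y, G)] @ \<Delta>) D (TSort s)" for D s
    using cut_sort[OF cut that]
      conv_TSub[OF equivclp_sym[OF P(2)] equivclp_sym[OF G(2)] equivclp_refl[of red_trm D]]
    unfolding tconv_def by blast
  then have "lst_type \<A> \<R> \<Gamma>' (TSub y P G B') (LSub y P' G' l) (TSub y P G C')"
    using lst_type_tconv[OF cut_lst[OF cut'(1) weakening(2)[OF cut'(2,3) l]]] s by blast
  then show ?thesis by (rule lst_type_tconv[OF _ T])
qed


section \<open>Subject reduction\<close>

lemma fresh_for:
  obtains y where "y \<notin> env_dom (\<Gamma> :: 'b env)" "y \<notin> fv_trm (M :: 's trm)" "y \<notin> fv_trm (N :: 's trm)"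
    "y \<notin> fv_lst (l :: 's lst)" "y \<notin> fv_lst (m :: 's lst)" "y \<noteq> (x :: var)"
proof -
  have "finite (env_dom \<Gamma> \<union> fv_trm M \<union> fv_trm N \<union> fv_lst l \<union> fv_lst m \<union> {x})" by simp
  then obtain y where "y \<notin> env_dom \<Gamma> \<union> fv_trm M \<union> fv_trm N \<union> fv_lst l \<union> fv_lst m \<union> {x}"
    by (rule obtain_fresh)
  then show thesis by (intro that) auto
qed

text \<open>Typing is equivariant, hence so is preservation of typing, and the binder of a redex or of a
  context may be assumed to be fresh for the environment.\<close>

lemma sr_Pi_binder:
  assumes "\<And>\<Gamma> y T. y \<notin> env_dom \<Gamma> \<Longrightarrow> has_type \<A> \<R> \<Gamma> (TPi y A (swap_trm x y B)) T \<Longrightarrow>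
    has_type \<A> \<R> \<Gamma> (TPi y A' (swap_trm x y B')) T"
  shows "sr_trm \<A> \<R> (TPi x A B) (TPi x A' B')"
proof (rule sr_trmI)
  fix \<Gamma> T assume *: "has_type \<A> \<R> \<Gamma> (TPi x A B) T"
  obtain y where y: "y \<notin> env_dom \<Gamma>" "y \<notin> fv_trm B" "y \<notin> fv_trm B'" by (rule fresh_for) (rule that)
  then have "TPi x A B = TPi y A (swap_trm x y B)" "TPi x A' B' = TPi y A' (swap_trm x y B')"
    by (simp_all add: alpha_rename)
  with assms[OF y(1)] * show "has_type \<A> \<R> \<Gamma> (TPi x A' B') T" by simp
qed

lemma sr_Lam_binder:
  assumes "\<And>\<Gamma> y T. y \<notin> env_dom \<Gamma> \<Longrightarrow> has_type \<A> \<R> \<Gamma> (TLam y A (swap_trm x y B)) T \<Longrightarrow>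
    has_type \<A> \<R> \<Gamma> (TLam y A' (swap_trm x y B')) T"
  shows "sr_trm \<A> \<R> (TLam x A B) (TLam x A' B')"
proof (rule sr_trmI)
  fix \<Gamma> T assume *: "has_type \<A> \<R> \<Gamma> (TLam x A B) T"
  obtain y where y: "y \<notin> env_dom \<Gamma>" "y \<notin> fv_trm B" "y \<notin> fv_trm B'" by (rule fresh_for) (rule that)
  then have "TLam x A B = TLam y A (swap_trm x y B)" "TLam x A' B' = TLam y A' (swap_trm x y B')"
    by (simp_all add: alpha_rename)
  with assms[OF y(1)] * show "has_type \<A> \<R> \<Gamma> (TLam x A' B') T" by simp
qed

lemma sr_Sub_binder:
  assumes "\<And>\<Gamma> y T. y \<notin> env_dom \<Gamma> \<Longrightarrow> has_type \<A> \<R> \<Gamma> (TSub y P G (swap_trm x y M)) T \<Longrightarrow>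
    has_type \<A> \<R> \<Gamma> (TSub y P' G' (swap_trm x y M')) T"
  shows "sr_trm \<A> \<R> (TSub x P G M) (TSub x P' G' M')"
proof (rule sr_trmI)
  fix \<Gamma> T assume *: "has_type \<A> \<R> \<Gamma> (TSub x P G M) T"
  obtain y where y: "y \<notin> env_dom \<Gamma>" "y \<notin> fv_trm M" "y \<notin> fv_trm M'" by (rule fresh_for) (rule that)
  then have "TSub x P G M = TSub y P G (swap_trm x y M)" "TSub x P' G' M' = TSub y P' G' (swap_trm x y M')"
    by (simp_all add: alpha_rename)
  with assms[OF y(1)] * show "has_type \<A> \<R> \<Gamma> (TSub x P' G' M') T" by simp
qed

lemma sr_LSub_binder:
  assumes "\<And>\<Gamma> y B C. y \<notin> env_dom \<Gamma> \<Longrightarrow> lst_type \<A> \<R> \<Gamma> B (LSub y P G (swap_lst x y l)) C \<Longrightarrow>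
    lst_type \<A> \<R> \<Gamma> B (LSub y P' G' (swap_lst x y l')) C"
  shows "sr_lst \<A> \<R> (LSub x P G l) (LSub x P' G' l')"
proof (rule sr_lstI)
  fix \<Gamma> B C assume *: "lst_type \<A> \<R> \<Gamma> B (LSub x P G l) C"
  obtain y where y: "y \<notin> env_dom \<Gamma>" "y \<notin> fv_lst l" "y \<notin> fv_lst l'" by (rule fresh_for) (rule that)
  then have "LSub x P G l = LSub y P G (swap_lst x y l)" "LSub x P' G' l' = LSub y P' G' (swap_lst x y l')"
    by (simp_all add: alpha_rename)
  with assms[OF y(1)] * show "lst_type \<A> \<R> \<Gamma> B (LSub x P' G' l') C" by simp
qed

text \<open>A redex of \<open>sub_lam\<close> or \<open>sub_pi\<close> binds two names, and both
  must become fresh for \<Gamma> in redex and contractum simultaneously.\<close>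

lemma rename_sub_binder:
  assumes "x \<noteq> y" "x \<notin> fv_trm P" "x \<notin> fv_trm G"
  obtains z w A' M' where "z \<notin> env_dom \<Gamma>" "w \<notin> env_dom \<Gamma>" "w \<noteq> z"
    "TSub y P G (TLam x A M) = TSub z P G (TLam w A' M')"
    "TLam x (TSub y P G A) (TSub y P G M) = TLam w (TSub z P G A') (TSub z P G M')"
    "TSub y P G (TPi x A M) = TSub z P G (TPi w A' M')"
    "TPi x (TSub y P G A) (TSub y P G M) = TPi w (TSub z P G A') (TSub z P G M')"
proof -
  obtain z where z: "z \<notin> env_dom \<Gamma>" "z \<notin> fv_trm A" "z \<notin> fv_trm M" "z \<noteq> x" by (rule fresh_for) (rule that)
  \<comment> \<open>The list packs \<open>P\<close>, \<open>G\<close> and \<open>y\<close> together,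
    so that a single freshness condition keeps \<open>w\<close> away from all three.\<close>
  obtain w where w: "w \<notin> env_dom \<Gamma>" "w \<noteq> z" "w \<notin> fv_trm M"
    "w \<notin> fv_lst (LCons P (LCons G (LCons (TVar y LNil) LNil)))"
    by (rule fresh_for) (rule that)
  let ?M = "swap_trm x w M"
  \<comment> \<open>Both \<open>x\<close> and \<open>w\<close> avoid \<open>y\<close> and the free
    variables of \<open>P\<close> and \<open>G\<close>, so the swap passes through the substitution
    and acts on its body alone.\<close>
  have M: "swap_trm x w (TSub y P G M) = TSub y P G ?M"
    using w assms by (simp add: swap_fresh)
  have z': "z \<notin> fv_trm ?M - {y}" using w z by (auto simp: sw_def)
  have ren: "TSub y P G N = TSub z P G (swap_trm y z N)" if "z \<notin> fv_trm N - {y}" for N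
    using that by (rule alpha_rename)
  have under: "TLam x A M = TLam w A ?M" "TPi x A M = TPi w A ?M" for A
    using w by (auto intro: alpha_rename)
  have "w \<notin> fv_trm (TSub y P G M) - {x}" using w by simp
  note under' = alpha_rename(1,2)[OF this, unfolded M]
  have sw: "swap_trm y z (TLam w A ?M) = TLam w (swap_trm y z A) (swap_trm y z ?M)"
    "swap_trm y z (TPi w A ?M) = TPi w (swap_trm y z A) (swap_trm y z ?M)" using w by simp_all
  have A: "TSub y P G A = TSub z P G (swap_trm y z A)" using z by (intro ren) simp
  show thesis
  proof (rule that[OF z(1) w(1,2)])
    show "TSub y P G (TLam x A M) = TSub z P G (TLam w (swap_trm y z A) (swap_trm y z ?M))"
      "TSub y P G (TPi x A M) = TSub z P G (TPi w (swap_trm y z A) (swap_trm y z ?M))"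
      unfolding under sw[symmetric] using z z' by (intro ren; auto)+
    show "TLam x (TSub y P G A) (TSub y P G M) =
        TLam w (TSub z P G (swap_trm y z A)) (TSub z P G (swap_trm y z ?M))"
      "TPi x (TSub y P G A) (TSub y P G M) =
        TPi w (TSub z P G (swap_trm y z A)) (TSub z P G (swap_trm y z ?M))"
      unfolding under' A ren[OF z'] by simp_all
  qed
qed

lemma sr_refl: "sr_trm \<A> \<R> M M"
  by (simp add: sr_trm_def)

lemma subject_reduction:
  fixes M M' :: "'s trm" and l l' :: "'s lst"
  shows "red_trm M M' \<Longrightarrow> sr_trm \<A> \<R> M M'" "red_lst l l' \<Longrightarrow> sr_lst \<A> \<R> l l'"
proof (induction rule: red_trm_red_lst.inducts)
  case (beta x A M N l)
  show ?case
  proof (rule sr_trmI)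
    fix \<Gamma> T assume *: "has_type \<A> \<R> \<Gamma> (TCut (TLam x A M) (LCons N l)) T"
    obtain y where y: "y \<notin> env_dom \<Gamma>" "y \<notin> fv_trm M" by (rule fresh_for) (rule that)
    then have "TLam x A M = TLam y A (swap_trm x y M)" "TSub x N A M = TSub y N A (swap_trm x y M)"
      by (simp_all add: alpha_rename)
    with sr_beta[OF _ y(1)] * show "has_type \<A> \<R> \<Gamma> (TCut (TSub x N A M) l) T" by simp
  qed
next
  case (cut_nil M)
  show ?case by (rule sr_trmI) (rule sr_cut_nil)
next
  case (cut_var x l l')
  show ?case
    by (rule sr_trmI) (blast dest: gen_Cut gen_Var intro: select Cut1)
next
  case (cut_cut M l l')
  show ?case
    by (rule sr_trmI) (blast dest: gen_Cut intro: Cut3 Cut1)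
next
  case (app_cons M l' l)
  show ?case by (rule sr_lstI) (rule sr_app_cons)
next
  case (app_nil_left l)
  show ?case by (rule sr_lstI) (rule sr_app_nil_left)
next
  case (app_app l l' l'')
  show ?case
    by (rule sr_lstI) (blast dest: gen_App intro: Cut1)
next
  case (app_nil_right l)
  show ?case by (rule sr_lstI) (rule sr_app_nil_right)
next
  case (sub_lam x y P G A M)
  show ?case
  proof (rule sr_trmI)
    fix \<Gamma> T assume *: "has_type \<A> \<R> \<Gamma> (TSub y P G (TLam x A M)) T"
    obtain z w A' M' where r: "z \<notin> env_dom \<Gamma>" "w \<notin> env_dom \<Gamma>" "w \<noteq> z"
      "TSub y P G (TLam x A M) = TSub z P G (TLam w A' M')"
      "TLam x (TSub y P G A) (TSub y P G M) = TLam w (TSub z P G A') (TSub z P G M')"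
      using sub_lam by (rule rename_sub_binder)
    from sr_sub_lam[OF *[unfolded r] r(1-3)]
    show "has_type \<A> \<R> \<Gamma> (TLam x (TSub y P G A) (TSub y P G M)) T" unfolding r .
  qed
next
  case (sub_pi x y P G A M)
  show ?case
  proof (rule sr_trmI)
    fix \<Gamma> T assume *: "has_type \<A> \<R> \<Gamma> (TSub y P G (TPi x A M)) T"
    obtain z w A' M' where r: "z \<notin> env_dom \<Gamma>" "w \<notin> env_dom \<Gamma>" "w \<noteq> z"
      "TSub y P G (TPi x A M) = TSub z P G (TPi w A' M')"
      "TPi x (TSub y P G A) (TSub y P G M) = TPi w (TSub z P G A') (TSub z P G M')"
      using sub_pi by (rule rename_sub_binder)
    from sr_sub_pi[OF *[unfolded r] r(1-3)]
    show "has_type \<A> \<R> \<Gamma> (TPi x (TSub y P G A) (TSub y P G M)) T" unfolding r .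
  qed
next
  case (sub_var_same y P G l)
  show ?case
  proof (rule sr_trmI)
    fix \<Gamma> T assume *: "has_type \<A> \<R> \<Gamma> (TSub y P G (TVar y l)) T"
    obtain z where z: "z \<notin> env_dom \<Gamma>" "z \<noteq> y" "z \<notin> fv_lst l" by (rule fresh_for) (rule that)
    then have "TSub y P G (TVar y l) = TSub z P G (TVar z (swap_lst y z l))"
      "LSub y P G l = LSub z P G (swap_lst y z l)"
      using alpha_rename(3)[of z "TVar y l" y] by (simp_all add: alpha_rename(4))
    with sr_sub_var_same[OF _ z(1)] * show "has_type \<A> \<R> \<Gamma> (TCut P (LSub y P G l)) T" by simp
  qed
next
  case (sub_var_other x y P G l)
  show ?case
  proof (rule sr_trmI)
    fix \<Gamma> T assume *: "has_type \<A> \<R> \<Gamma> (TSub y P G (TVar x l)) T"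
    obtain z where z: "z \<notin> env_dom \<Gamma>" "z \<noteq> x" "z \<notin> fv_lst l" by (rule fresh_for) (rule that)
    then have "TSub y P G (TVar x l) = TSub z P G (TVar x (swap_lst y z l))"
      "LSub y P G l = LSub z P G (swap_lst y z l)"
      using alpha_rename(3)[of z "TVar x l" y] sub_var_other by (simp_all add: alpha_rename(4))
    with sr_sub_var_other[OF _ z(1)] z(2) * show "has_type \<A> \<R> \<Gamma> (TVar x (LSub y P G l)) T" by simp
  qed
next
  case (sub_cut y P G M l)
  show ?case
  proof (rule sr_trmI)
    fix \<Gamma> T assume *: "has_type \<A> \<R> \<Gamma> (TSub y P G (TCut M l)) T"
    obtain z where z: "z \<notin> env_dom \<Gamma>" "z \<notin> fv_trm M" "z \<notin> fv_lst l" by (rule fresh_for) (rule that)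
    then have "TSub y P G (TCut M l) = TSub z P G (TCut (swap_trm y z M) (swap_lst y z l))"
      "LSub y P G l = LSub z P G (swap_lst y z l)" "TSub y P G M = TSub z P G (swap_trm y z M)"
      using alpha_rename(3)[of z "TCut M l" y] by (simp_all add: alpha_rename(3,4))
    with sr_sub_cut[OF _ z(1)] * show "has_type \<A> \<R> \<Gamma> (TCut (TSub y P G M) (LSub y P G l)) T" by simp
  qed
next
  case (sub_sort y P G s)
  show ?case
  proof (rule sr_trmI)
    fix \<Gamma> T assume *: "has_type \<A> \<R> \<Gamma> (TSub y P G (TSort s)) T"
    obtain z where z: "z \<notin> env_dom \<Gamma>" by (rule fresh_for) (rule that)
    have "TSub y P G (TSort s) = TSub z P G (TSort s)"
      using alpha_rename(3)[of z "TSort s" y] by simp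
    with sr_sub_sort[OF _ z(1)] * show "has_type \<A> \<R> \<Gamma> (TSort s) T" by simp
  qed
next
  case (sub_nil y P G)
  show ?case
  proof (rule sr_lstI)
    fix \<Gamma> B C assume *: "lst_type \<A> \<R> \<Gamma> B (LSub y P G LNil) C"
    obtain z where z: "z \<notin> env_dom \<Gamma>" by (rule fresh_for) (rule that)
    have "LSub y P G LNil = LSub z P G LNil"
      using alpha_rename(4)[of z LNil y] by simp
    with sr_sub_nil[OF _ z(1)] * show "lst_type \<A> \<R> \<Gamma> B LNil C" by simp
  qed
next
  case (sub_cons y P G M l)
  show ?case
  proof (rule sr_lstI)
    fix \<Gamma> B C assume *: "lst_type \<A> \<R> \<Gamma> B (LSub y P G (LCons M l)) C"
    obtain z where z: "z \<notin> env_dom \<Gamma>" "z \<notin> fv_trm M" "z \<notin> fv_lst l" by (rule fresh_for) (rule that)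
    then have "LSub y P G (LCons M l) = LSub z P G (LCons (swap_trm y z M) (swap_lst y z l))"
      "LSub y P G l = LSub z P G (swap_lst y z l)" "TSub y P G M = TSub z P G (swap_trm y z M)"
      using alpha_rename(4)[of z "LCons M l" y] by (simp_all add: alpha_rename(3,4))
    with sr_sub_cons[OF _ z(1)] * show "lst_type \<A> \<R> \<Gamma> B (LCons (TSub y P G M) (LSub y P G l)) C" by simp
  qed
next
  case (sub_app y P G l l')
  show ?case
  proof (rule sr_lstI)
    fix \<Gamma> B C assume *: "lst_type \<A> \<R> \<Gamma> B (LSub y P G (LApp l l')) C"
    obtain z where z: "z \<notin> env_dom \<Gamma>" "z \<notin> fv_lst l" "z \<notin> fv_lst l'" by (rule fresh_for) (rule that)
    then have "LSub y P G (LApp l l') = LSub z P G (LApp (swap_lst y z l) (swap_lst y z l'))"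
      "LSub y P G l = LSub z P G (swap_lst y z l)" "LSub y P G l' = LSub z P G (swap_lst y z l')"
      using alpha_rename(4)[of z "LApp l l'" y] by (simp_all add: alpha_rename(4))
    with sr_sub_app[OF _ z(1)] * show "lst_type \<A> \<R> \<Gamma> B (LApp (LSub y P G l) (LSub y P G l')) C" by simp
  qed
next
  case (ctx_pi1 A A' x B)
  show ?case by (rule sr_Pi_binder) (rule sr_pi1[OF ctx_pi1.IH ctx_pi1.hyps])
next
  case (ctx_pi2 B B' x A)
  show ?case by (rule sr_Pi_binder) (rule sr_pi2[OF sr_swap(1)[OF ctx_pi2.IH]])
next
  case (ctx_lam1 A A' x M)
  show ?case by (rule sr_Lam_binder) (rule sr_lam1[OF ctx_lam1.IH ctx_lam1.hyps])
next
  case (ctx_lam2 M M' x A)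
  show ?case by (rule sr_Lam_binder) (rule sr_lam2[OF sr_swap(1)[OF ctx_lam2.IH]])
next
  case (ctx_var l l' x)
  then show ?case
    by (intro sr_trmI) (blast dest: gen_Var intro: select sr_lstD)
next
  case (ctx_cut1 M M' l)
  then show ?case
    by (intro sr_trmI) (blast dest: gen_Cut intro: Cut3 sr_trmD)
next
  case (ctx_cut2 l l' M)
  then show ?case
    by (intro sr_trmI) (blast dest: gen_Cut intro: Cut3 sr_lstD)
next
  case (ctx_sub1 N N' x A M)
  show ?case
    by (rule sr_Sub_binder)
      (rule sr_sub12[OF ctx_sub1.IH r_into_equivclp[of red_trm, OF ctx_sub1.hyps] sr_refl equivclp_refl])
next
  case (ctx_sub2 A A' x N M)
  show ?case
    by (rule sr_Sub_binder)
      (rule sr_sub12[OF sr_refl equivclp_refl ctx_sub2.IH r_into_equivclp[of red_trm, OF ctx_sub2.hyps]])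
next
  case (ctx_sub3 M M' x N A)
  show ?case by (rule sr_Sub_binder) (rule sr_sub3[OF sr_swap(1)[OF ctx_sub3.IH]])
next
  case (ctx_cons1 M M' l)
  show ?case by (rule sr_lstI) (rule sr_cons1[OF ctx_cons1.IH ctx_cons1.hyps])
next
  case (ctx_cons2 l l' M)
  show ?case by (rule sr_lstI) (rule sr_cons2[OF ctx_cons2.IH])
next
  case (ctx_app1 l l'' l')
  then show ?case
    by (intro sr_lstI) (blast dest: gen_App intro: Cut1 sr_lstD)
next
  case (ctx_app2 l' l'' l)
  then show ?case
    by (intro sr_lstI) (blast dest: gen_App intro: Cut1 sr_lstD)
next
  case (ctx_subl1 N N' x A l)
  show ?case
    by (rule sr_LSub_binder)
      (rule sr_subl12[OF ctx_subl1.IH r_into_equivclp[of red_trm, OF ctx_subl1.hyps] sr_refl equivclp_refl])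
next
  case (ctx_subl2 A A' x N l)
  show ?case
    by (rule sr_LSub_binder)
      (rule sr_subl12[OF sr_refl equivclp_refl ctx_subl2.IH r_into_equivclp[of red_trm, OF ctx_subl2.hyps]])
next
  case (ctx_subl3 l l' x N A)
  show ?case by (rule sr_LSub_binder) (rule sr_subl3[OF sr_swap(2)[OF ctx_subl3.IH]])
qed

theorem theorem3p7:
  fixes \<A> :: "('s \<times> 's) set" and \<R> :: "('s \<times> 's \<times> 's) set"
  shows "(\<forall>\<Gamma> M M' A. has_type \<A> \<R> \<Gamma> M A \<and> red_trm M M' \<longrightarrow> has_type \<A> \<R> \<Gamma> M' A) \<and>
    (\<forall>\<Gamma> B l l' C. lst_type \<A> \<R> \<Gamma> B l C \<and> red_lst l l' \<longrightarrow> lst_type \<A> \<R> \<Gamma> B l' C)"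
  using subject_reduction unfolding sr_trm_def sr_lst_def by blast

end
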